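(* Let $0\le s\in\mathbb{R}$, $u\in L_2(\Omega)$, and define the forms $$a(z,v):=\langle z,v\rangle_{H^s(\Omega)},\qquad l_u(v):=\langle u,v\rangle_{L_2(\Omega)},\qquad \forall\, v,z\in H^s(\Omega).$$ Then the element $E_s^*u$ is given as the unique solution $z\in H^s(\Omega)$ of $$a(z,v)=l_u(v)\qquad\forall\, v\in H^s(\Omega).$$ Similarly, for $m\in\mathbb{N}$, with $a(z,v):=\langle z,v\rangle_{H^m(\Omega)}$ for $z,v\in H^m_0(\Omega)$, the element $E_{m,0}^*u$ is the unique solution $z\in H_0^m(\Omega)$ of $$a(z,v)=l_u(v)\qquad\forall\, v\in H_0^m(\Omega).$$
   Context: $\Omega\subseteq\mathbb{R}^N$ ($N\in\mathbb{N}$) is nonempty and open. $L_2(\Omega)$ is the complex Lebesgue space with $\langle u,v\rangle_{L_2(\Omega)}=\int_\Omega u\overline v\,dx$. For $m\in\mathbb{N}$, $H^m(\Omega)$ is the space of $u\in L_2(\Omega)$ whose weak derivatives $D^\alpha u$, $0\le|\alpha|\le m$, lie in $L_2(\Omega)$, with standard norm $\big(\sum_{0\le|\alpha|\le m}\|D^\alpha u\|_{L_2(\Omega)}^2\big)^{1/2}$; $H^0(\Omega)=L_2(\Omega)$; $H^m_0(\Omega)$ is the closure of $C_0^\infty(\Omega)$ in $H^m(\Omega)$. Sobolev spaces of non-integer order $s\ge 0$ are considered only for $\Omega=\mathbb{R}^N$: $H^s(\mathbb{R}^N)$ is the space of $u\in L_2(\mathbb{R}^N)$ with $(1+4\pi^2|\cdot|^2)^{s/2}\mathcal{F}u\in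 L_2(\mathbb{R}^N)$, normed by $\|(1+4\pi^2|\cdot|^2)^{s/2}\mathcal{F}u\|_{L_2(\mathbb{R}^N)}$, where $(\mathcal{F}u)(\xi)=\int_{\mathbb{R}^N}e^{-2\pi i\xi\cdot x}u(x)\,dx$ is the Fourier transform. The inner product $\langle\cdot,\cdot\rangle_{H^s(\Omega)}$ (respectively $\langle\cdot,\cdot\rangle_{H^m(\Omega)}$ on $H^m_0(\Omega)$) may be any fixed inner product inducing a norm equivalent to the standard one on the respective space; the same inner product is used in the definition of $a$ and of the adjoint. $E_s:H^s(\Omega)\to L_2(\Omega)$, $E_su:=u$, and $E_{m,0}:H_0^m(\Omega)\to L_2(\Omega)$, $E_{m,0}u:=u$, are the embedding operators. The adjoint $A^*:Y\to X$ of a bounded linear operator $A:X\to Y$ between Hilbert spaces is defined by $\langle A^*u,v\rangle_X=\langle u,Av\rangle_Y$ for all $u\in Y$, $v\in X$. (In the complex case $a$ is sesquilinear and $l_u$ antilinear.) *)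

theory Defs
  imports "HOL-Analysis.Analysis"
begin

text \<open>
  The complex Lebesgue space $L_2(\Omega)$: elements are genuine equivalence classes modulo
  equality almost everywhere on \<open>\<Omega>\<close>. The members of a class are functions on the whole space, whose values off \<open>\<Omega>\<close> are irrelevant.
\<close>

type_synonym 'n fn = "real^'n \<Rightarrow> complex"

definition ae_class :: "(real^'n) set \<Rightarrow> 'n fn \<Rightarrow> 'n fn set" where
  "ae_class \<Omega> f =
    {g \<in> borel_measurable (lebesgue_on \<Omega>). AE x in lebesgue_on \<Omega>. g x = f x}"

definition rep :: "'n fn set \<Rightarrow> 'n fn" where
  "rep u = (SOME f. f \<in> u)"

definition square_integrable :: "(real^'n) set \<Rightarrow> 'n fn \<Rightarrow> bool" where
  "square_integrable \<Omega> f \<longleftrightarrow> f \<in> borel_measurable (lebesgue_on \<Omega>) \<and>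
     integrable (lebesgue_on \<Omega>) (\<lambda>x. (cmod (f x))\<^sup>2)"

definition L2 :: "(real^'n) set \<Rightarrow> 'n fn set set" where
  "L2 \<Omega> = ae_class \<Omega> ` {f. square_integrable \<Omega> f}"

definition cls_zero :: "(real^'n) set \<Rightarrow> 'n fn set" where
  "cls_zero \<Omega> = ae_class \<Omega> (\<lambda>x. 0)"

definition cls_add :: "(real^'n) set \<Rightarrow> 'n fn set \<Rightarrow> 'n fn set \<Rightarrow> 'n fn set" where
  "cls_add \<Omega> u v = ae_class \<Omega> (\<lambda>x. rep u x + rep v x)"

definition cls_diff :: "(real^'n) set \<Rightarrow> 'n fn set \<Rightarrow> 'n fn set \<Rightarrow> 'n fn set" where
  "cls_diff \<Omega> u v = ae_class \<Omega> (\<lambda>x. rep u x - rep v x)"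

definition cls_scale :: "(real^'n) set \<Rightarrow> complex \<Rightarrow> 'n fn set \<Rightarrow> 'n fn set" where
  "cls_scale \<Omega> c u = ae_class \<Omega> (\<lambda>x. c * rep u x)"

definition L2_inner :: "(real^'n) set \<Rightarrow> 'n fn set \<Rightarrow> 'n fn set \<Rightarrow> complex" where
  "L2_inner \<Omega> u v = (\<integral>x. rep u x * cnj (rep v x) \<partial>lebesgue_on \<Omega>)"

definition L2_norm :: "(real^'n) set \<Rightarrow> 'n fn set \<Rightarrow> real" where
  "L2_norm \<Omega> u = sqrt (Re (L2_inner \<Omega> u u))"

definition partial_deriv :: "'n \<Rightarrow> 'n fn \<Rightarrow> 'n::finite fn" where
  "partial_deriv i f x = vector_derivative (\<lambda>t. f (x + t *\<^sub>R axis i 1)) (at 0)"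

definition iter_partial :: "'n list \<Rightarrow> 'n fn \<Rightarrow> 'n::finite fn" where
  "iter_partial w f = foldr partial_deriv w f"

definition smooth :: "'n::finite fn \<Rightarrow> bool" where
  "smooth f \<longleftrightarrow> (\<forall>w. continuous_on UNIV (iter_partial w f) \<and>
     (\<forall>i x. (\<lambda>t. iter_partial w f (x + t *\<^sub>R axis i 1)) differentiable (at (0::real))))"

text \<open>
  The space $C_0^\infty(\Omega)$; its members are extended by zero to the whole space.
\<close>

definition test_functions :: "(real^'n::finite) set \<Rightarrow> 'n fn set" where
  "test_functions \<Omega> =
     {\<phi>. smooth \<phi> \<and> compact (closure {x. \<phi> x \<noteq> 0}) \<and> closure {x. \<phi> x \<noteq> 0} \<subseteq> \<Omega>}"

text \<open>
  A multi-index is a function \<open>\<alpha>\<close> on the coordinates. The order in which the partial derivatives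
  are taken is fixed by an arbitrary choice, which is immaterial since \<open>multi_deriv\<close> is only applied to
  smooth functions.
\<close>

definition mi_order :: "('n::finite \<Rightarrow> nat) \<Rightarrow> nat" where
  "mi_order \<alpha> = (\<Sum>i\<in>UNIV. \<alpha> i)"

definition multi_deriv :: "('n \<Rightarrow> nat) \<Rightarrow> 'n fn \<Rightarrow> 'n::finite fn" where
  "multi_deriv \<alpha> f = iter_partial (SOME w. \<forall>i. count_list w i = \<alpha> i) f"

definition has_weak_deriv ::
  "(real^'n::finite) set \<Rightarrow> ('n \<Rightarrow> nat) \<Rightarrow> 'n fn set \<Rightarrow> 'n fn set \<Rightarrow> bool" where
  "has_weak_deriv \<Omega> \<alpha> u v \<longleftrightarrow> (\<forall>\<phi>\<in>test_functions \<Omega>.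
     (\<integral>x. rep u x * multi_deriv \<alpha> \<phi> x \<partial>lebesgue_on \<Omega>) =
     (-1) ^ mi_order \<alpha> * (\<integral>x. rep v x * \<phi> x \<partial>lebesgue_on \<Omega>))"

definition weak_deriv ::
  "(real^'n::finite) set \<Rightarrow> ('n \<Rightarrow> nat) \<Rightarrow> 'n fn set \<Rightarrow> 'n fn set" where
  "weak_deriv \<Omega> \<alpha> u = (THE v. v \<in> L2 \<Omega> \<and> has_weak_deriv \<Omega> \<alpha> u v)"

definition Hm :: "nat \<Rightarrow> (real^'n::finite) set \<Rightarrow> 'n fn set set" where
  "Hm m \<Omega> =
     {u \<in> L2 \<Omega>. \<forall>\<alpha>. mi_order \<alpha> \<le> m \<longrightarrow> (\<exists>v\<in>L2 \<Omega>. has_weak_deriv \<Omega> \<alpha> u v)}"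

definition Hm_norm :: "nat \<Rightarrow> (real^'n::finite) set \<Rightarrow> 'n fn set \<Rightarrow> real" where
  "Hm_norm m \<Omega> u = sqrt (\<Sum>\<alpha> | mi_order \<alpha> \<le> m. (L2_norm \<Omega> (weak_deriv \<Omega> \<alpha> u))\<^sup>2)"

definition Hm0 :: "nat \<Rightarrow> (real^'n::finite) set \<Rightarrow> 'n fn set set" where
  "Hm0 m \<Omega> = {u \<in> Hm m \<Omega>. \<forall>\<epsilon>>0. \<exists>\<phi>\<in>test_functions \<Omega>.
     Hm_norm m \<Omega> (cls_diff \<Omega> u (ae_class \<Omega> \<phi>)) < \<epsilon>}"

definition fourier_integral :: "'n::finite fn \<Rightarrow> 'n fn" where
  "fourier_integral f \<xi> = (\<integral>x. exp (- 2 * pi * \<i> * (\<xi> \<bullet> x)) * f x \<partial>lebesgue)"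

text \<open>
  For \<open>u\<close> in $L_2$ the Fourier integral need not converge absolutely, and the transform is
  understood, as usual, as the $L_2$-limit of the Fourier integrals over balls of radius
  \<open>R \<rightarrow> \<infinity>\<close>. The limit is expressed by a nonnegative integral, so that no convention about
  non-integrable functions enters.
\<close>

definition fourier :: "'n::finite fn set \<Rightarrow> 'n fn set" where
  "fourier u = (THE v. v \<in> L2 UNIV \<and>
     ((\<lambda>R. \<integral>\<^sup>+\<xi>. ennreal ((cmod (fourier_integral (\<lambda>x. indicator (ball 0 R) x * rep u x) \<xi>
         - rep v \<xi>))\<^sup>2) \<partial>lebesgue) \<longlongrightarrow> 0) (at_top :: real filter))"

definition weighted_fourier :: "real \<Rightarrow> 'n::finite fn set \<Rightarrow> 'n fn set" where
  "weighted_fourier s u = ae_class UNIV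
     (\<lambda>\<xi>. of_real ((1 + 4 * pi\<^sup>2 * (norm \<xi>)\<^sup>2) powr (s / 2)) * rep (fourier u) \<xi>)"

definition Hfrac :: "real \<Rightarrow> 'n::finite fn set set" where
  "Hfrac s = {u \<in> L2 UNIV. weighted_fourier s u \<in> L2 UNIV}"

definition Hfrac_norm :: "real \<Rightarrow> 'n::finite fn set \<Rightarrow> real" where
  "Hfrac_norm s u = L2_norm UNIV (weighted_fourier s u)"

text \<open>
  Integer orders use weak derivatives on \<open>\<Omega>\<close>. Fractional orders are only meaningful for
  \<open>\<Omega> = UNIV\<close>; for them the argument \<open>\<Omega>\<close> is ignored.
\<close>

definition Hs :: "real \<Rightarrow> (real^'n::finite) set \<Rightarrow> 'n fn set set" where
  "Hs s \<Omega> = (if s \<in> \<nat> then Hm (nat \<lfloor>s\<rfloor>) \<Omega> else Hfrac s)"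

definition Hs_norm :: "real \<Rightarrow> (real^'n::finite) set \<Rightarrow> 'n fn set \<Rightarrow> real" where
  "Hs_norm s \<Omega> u = (if s \<in> \<nat> then Hm_norm (nat \<lfloor>s\<rfloor>) \<Omega> u else Hfrac_norm s u)"

definition inner_product_on ::
  "(real^'n) set \<Rightarrow> 'n fn set set \<Rightarrow> ('n fn set \<Rightarrow> 'n fn set \<Rightarrow> complex) \<Rightarrow> bool" where
  "inner_product_on \<Omega> X ip \<longleftrightarrow>
     (\<forall>u\<in>X. \<forall>v\<in>X. \<forall>w\<in>X. ip (cls_add \<Omega> u v) w = ip u w + ip v w) \<and>
     (\<forall>c. \<forall>u\<in>X. \<forall>v\<in>X. ip (cls_scale \<Omega> c u) v = c * ip u v) \<and>
     (\<forall>u\<in>X. \<forall>v\<in>X. ip v u = cnj (ip u v)) \<and>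
     (\<forall>u\<in>X. u \<noteq> cls_zero \<Omega> \<longrightarrow> Re (ip u u) > 0)"

definition equivalent_norms_on :: "'a set \<Rightarrow> ('a \<Rightarrow> real) \<Rightarrow> ('a \<Rightarrow> real) \<Rightarrow> bool" where
  "equivalent_norms_on X p q \<longleftrightarrow>
     (\<exists>c>0. \<exists>C>0. \<forall>u\<in>X. c * p u \<le> q u \<and> q u \<le> C * p u)"

definition admissible_inner_product ::
  "(real^'n) set \<Rightarrow> 'n fn set set \<Rightarrow> ('n fn set \<Rightarrow> real)
     \<Rightarrow> ('n fn set \<Rightarrow> 'n fn set \<Rightarrow> complex) \<Rightarrow> bool" where
  "admissible_inner_product \<Omega> X nrm ip \<longleftrightarrow> inner_product_on \<Omega> X ip \<and>
     equivalent_norms_on X nrm (\<lambda>u. sqrt (Re (ip u u)))"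

definition embedding :: "'a set \<Rightarrow> 'a \<Rightarrow> 'a" where
  "embedding X = (\<lambda>u\<in>X. u)"

text \<open>
  The adjoint of \<open>A\<close> maps \<open>Y\<close> to \<open>X\<close>; it is required to be \<open>undefined\<close> off \<open>Y\<close> so that the
  description determines it uniquely as a function.
\<close>

definition hilbert_adjoint ::
  "'a set \<Rightarrow> ('a \<Rightarrow> 'a \<Rightarrow> complex) \<Rightarrow> 'b set \<Rightarrow> ('b \<Rightarrow> 'b \<Rightarrow> complex)
     \<Rightarrow> ('a \<Rightarrow> 'b) \<Rightarrow> 'b \<Rightarrow> 'a" where
  "hilbert_adjoint X ipX Y ipY A =
     (THE B. B \<in> Y \<rightarrow>\<^sub>E X \<and> (\<forall>u\<in>Y. \<forall>v\<in>X. ipX (B u) v = ipY u (A v)))"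

end

theory Submission
  imports Defs "HOL-Probability.Characteristic_Functions" "HOL-Computational_Algebra.Polynomial"
begin

text \<open>
  The defining property of the adjoint of an embedding \<open>X \<rightarrow> L\<^sub>2\<close> is literally the variational
  equation \<open>a (z, v) = l\<^sub>u (v)\<close>. The assertion is therefore that this equation has exactly one solution
  for every \<open>u\<close> in \<open>L\<^sub>2\<close>. Uniqueness is positive definiteness of \<open>a\<close>; existence is the Riesz
  representation theorem (\<open>Riesz_representation\<close>, \<open>adjoint_of_embedding\<close>). As the norm of \<open>a\<close> is
  equivalent to the standard one, the Riesz theorem needs two properties of the standard norm: it
  dominates the \<open>L\<^sub>2\<close> norm, so that \<open>l\<^sub>u\<close> is bounded, and it is complete.

  Both Sobolev norms are graph norms \<open>(\<Sum>i. \<parallel>T\<^sub>i u\<parallel>\<^sup>2)\<^sup>1\<^sup>/\<^sup>2\<close> of finitely many operators in \<open>L\<^sub>2\<close>, and a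
  graph norm is complete if the operators are closed, because \<open>L\<^sub>2\<close> is complete (\<open>Riesz_Fischer\<close>,
  \<open>gnorm_complete\<close>).

  For integer order the operators are the weak derivatives. They are single-valued by the
  fundamental lemma of the calculus of variations: smooth bumps approximate indicators of boxes, so a
  function that annihilates all test functions has integral zero over small boxes and vanishes
  almost everywhere by Lebesgue differentiation (\<open>fundamental_lemma\<close>). They are closed since both
  sides of the defining identity are \<open>L\<^sub>2\<close> inner products with fixed functions (\<open>Hm_graph_space\<close>).
  The closure of the test functions is a closed subspace; here integration by parts is needed to see
  that test functions lie in the Sobolev space at all (\<open>test_function_Hm\<close>).

  For fractional order there is a single operator, the weighted Fourier transform. That the \<open>L\<^sub>2\<close>
  limit defining the transform exists, and that the transform is isometric, is Plancherel's theorem.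
  It is proved for functions in \<open>L\<^sub>1 \<inter> L\<^sub>2\<close> by damping \<open>|F f|\<^sup>2\<close> with Gaussians: the damped integral equals
  a Gaussian mean of \<open>\<parallel>f\<parallel>\<^sup>2 - \<parallel>f (\<cdot> + z) - f\<parallel>\<^sup>2 / 2\<close>, and translations are continuous in \<open>L\<^sub>2\<close>
  (\<open>Plancherel_L1_L2\<close>). Only isometry and linearity are used, not surjectivity: if \<open>u\<^sub>n\<close> is Cauchy in
  the Sobolev norm and \<open>u\<^sub>n \<rightarrow> u\<close> in \<open>L\<^sub>2\<close>, then \<open>F u\<^sub>n \<rightarrow> F u\<close>, which identifies the limit of the
  weighted transforms (\<open>Hfrac_graph_space\<close>).
\<close>

section \<open>Riesz representation\<close>

text \<open>
  A complex inner product, possibly degenerate, on a set \<open>X\<close> that is closed under an addition and a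
  scalar multiplication. No vector space axioms are imposed on \<open>add\<close> and \<open>scale\<close>: every identity that is
  needed can be checked after applying \<open>ip\<close>.
\<close>

locale carrier_inner =
  fixes X :: "'a set" and add :: "'a \<Rightarrow> 'a \<Rightarrow> 'a" and scale :: "complex \<Rightarrow> 'a \<Rightarrow> 'a"
    and ip :: "'a \<Rightarrow> 'a \<Rightarrow> complex"
  assumes nonempty: "X \<noteq> {}"
    and add_closed: "\<lbrakk>u \<in> X; v \<in> X\<rbrakk> \<Longrightarrow> add u v \<in> X"
    and scale_closed: "u \<in> X \<Longrightarrow> scale c u \<in> X"
    and ip_add: "\<lbrakk>u \<in> X; v \<in> X; w \<in> X\<rbrakk> \<Longrightarrow> ip (add u v) w = ip u w + ip v w"
    and ip_scale: "\<lbrakk>u \<in> X; v \<in> X\<rbrakk> \<Longrightarrow> ip (scale c u) v = c * ip u v"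
    and ip_sym: "\<lbrakk>u \<in> X; v \<in> X\<rbrakk> \<Longrightarrow> ip v u = cnj (ip u v)"
    and ip_nonneg: "u \<in> X \<Longrightarrow> 0 \<le> Re (ip u u)"
begin

definition nrm :: "'a \<Rightarrow> real" where "nrm u = sqrt (Re (ip u u))"

definition sub :: "'a \<Rightarrow> 'a \<Rightarrow> 'a" where "sub u v = add u (scale (-1) v)"

lemma sub_closed: "\<lbrakk>u \<in> X; v \<in> X\<rbrakk> \<Longrightarrow> sub u v \<in> X"
  by (simp add: sub_def add_closed scale_closed)

lemma nrm_nonneg: "u \<in> X \<Longrightarrow> 0 \<le> nrm u"
  by (simp add: nrm_def ip_nonneg)

lemma nrm_sq: "u \<in> X \<Longrightarrow> (nrm u)\<^sup>2 = Re (ip u u)"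
  by (simp add: nrm_def ip_nonneg)

lemma ip_add_right: "\<lbrakk>u \<in> X; v \<in> X; w \<in> X\<rbrakk> \<Longrightarrow> ip w (add u v) = ip w u + ip w v"
  by (metis add_closed complex_cnj_add ip_add ip_sym)

lemma ip_scale_right: "\<lbrakk>u \<in> X; v \<in> X\<rbrakk> \<Longrightarrow> ip v (scale c u) = cnj c * ip v u"
  by (metis scale_closed complex_cnj_mult ip_scale ip_sym)

lemma ip_sub: "\<lbrakk>u \<in> X; v \<in> X; w \<in> X\<rbrakk> \<Longrightarrow> ip (sub u v) w = ip u w - ip v w"
  by (simp add: sub_def ip_add ip_scale scale_closed)

lemma ip_sub_right: "\<lbrakk>u \<in> X; v \<in> X; w \<in> X\<rbrakk> \<Longrightarrow> ip w (sub u v) = ip w u - ip w v"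
  by (simp add: sub_def ip_add_right ip_scale_right scale_closed)

lemma Re_ip_sym: "\<lbrakk>u \<in> X; v \<in> X\<rbrakk> \<Longrightarrow> Re (ip v u) = Re (ip u v)"
  using ip_sym[of u v] by (metis cnj.simps(1))

lemma nrm_scale:
  assumes "u \<in> X" shows "nrm (scale c u) = cmod c * nrm u"
proof -
  have "ip (scale c u) (scale c u) = of_real ((cmod c)\<^sup>2) * ip u u"
    unfolding complex_norm_square using assms by (simp add: ip_scale ip_scale_right scale_closed)
  then show ?thesis
    by (simp add: nrm_def real_sqrt_mult)
qed

lemma nrm_add_sq:
  assumes "u \<in> X" "v \<in> X"
  shows "(nrm (add u v))\<^sup>2 = (nrm u)\<^sup>2 + 2 * Re (ip u v) + (nrm v)\<^sup>2"
  using assms by (simp add: nrm_sq add_closed ip_add ip_add_right Re_ip_sym[of u v])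

lemma nrm_sub_sq:
  assumes "u \<in> X" "v \<in> X"
  shows "(nrm (sub u v))\<^sup>2 = (nrm u)\<^sup>2 - 2 * Re (ip u v) + (nrm v)\<^sup>2"
  using assms by (simp add: nrm_sq sub_closed ip_sub ip_sub_right Re_ip_sym[of u v])

lemma Cauchy_Schwarz:
  assumes "u \<in> X" "v \<in> X"
  shows "cmod (ip u v) \<le> nrm u * nrm v"
proof -
  \<comment> \<open>The nonnegative polynomial \<open>A - 2 t P + t\<^sup>2 P B\<close> in \<open>t\<close> is the square of the norm of \<open>u - t \<langle>u, v\<rangle> v\<close>.\<close>
  define P A B where "P = (cmod (ip u v))\<^sup>2" and "A = (nrm u)\<^sup>2" and "B = (nrm v)\<^sup>2"
  have q: "0 \<le> A - 2 * t * P + t\<^sup>2 * P * B" for t :: real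
  proof -
    let ?c = "- of_real t * ip u v"
    have cc: "Re (cnj (ip u v) * ip u v) = P"
      by (simp add: P_def cmod_power2) (simp add: power2_eq_square)
    have "ip u (scale ?c v) = - (of_real t * (cnj (ip u v) * ip u v))"
      using assms by (simp add: ip_scale_right)
    then have "Re (ip u (scale ?c v)) = - (t * P)"
      using cc by simp
    moreover have "(nrm (scale ?c v))\<^sup>2 = t\<^sup>2 * P * B"
      using assms by (simp add: nrm_scale P_def B_def norm_mult power_mult_distrib)
    ultimately have "(nrm (add u (scale ?c v)))\<^sup>2 = A - 2 * t * P + t\<^sup>2 * P * B"
      using assms nrm_add_sq[of u "scale ?c v"] by (simp add: A_def scale_closed mult.assoc)
    then show ?thesis using zero_le_power2 by metis
  qed
  have "P \<ge> 0" "A \<ge> 0" "B \<ge> 0" by (simp_all add: P_def A_def B_def)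
  have "P \<le> A * B"
  \<comment> \<open>The case \<open>B = 0\<close> has to be treated since \<open>ip\<close> may be degenerate.\<close>
  proof (cases "B = 0")
    case True
    have "P = 0"
    proof (rule ccontr)
      assume "P \<noteq> 0"
      then show False
        using q[of "(A + 1) / (2 * P)"] True by simp
    qed
    then show ?thesis using \<open>A \<ge> 0\<close> \<open>B \<ge> 0\<close> by simp
  next
    case False
    then have "B > 0" using \<open>B \<ge> 0\<close> by simp
    have "0 \<le> A - P / B"
      using q[of "1 / B"] \<open>B > 0\<close> by (simp add: power2_eq_square)
    then show ?thesis using \<open>B > 0\<close> by (simp add: field_simps)
  qed
  then have "(cmod (ip u v))\<^sup>2 \<le> (nrm u * nrm v)\<^sup>2"
    by (simp add: P_def A_def B_def power_mult_distrib)
  then show ?thesis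
    using assms nrm_nonneg by (meson mult_nonneg_nonneg power2_le_imp_le)
qed

lemma nrm_triangle:
  assumes "u \<in> X" "v \<in> X"
  shows "nrm (add u v) \<le> nrm u + nrm v"
proof -
  have "Re (ip u v) \<le> nrm u * nrm v"
    using Cauchy_Schwarz[OF assms] complex_Re_le_cmod order_trans by blast
  then have "(nrm (add u v))\<^sup>2 \<le> (nrm u + nrm v)\<^sup>2"
    unfolding nrm_add_sq[OF assms] by (simp add: power2_sum)
  then show ?thesis
    using assms by (meson add_nonneg_nonneg nrm_nonneg power2_le_imp_le)
qed

lemma nrm_sub_comm:
  assumes "u \<in> X" "v \<in> X" shows "nrm (sub u v) = nrm (sub v u)"
proof -
  have "(nrm (sub u v))\<^sup>2 = (nrm (sub v u))\<^sup>2"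
    using assms Re_ip_sym[of u v] by (simp add: nrm_sub_sq)
  then show ?thesis
    using assms by (simp add: nrm_nonneg sub_closed power2_eq_iff_nonneg)
qed

lemma nrm_sub_triangle:
  assumes "u \<in> X" "v \<in> X" "w \<in> X"
  shows "nrm (sub u w) \<le> nrm (sub u v) + nrm (sub v w)"
proof -
  have "ip (sub u w) (sub u w) = ip (add (sub u v) (sub v w)) (add (sub u v) (sub v w))"
    using assms by (simp add: ip_sub ip_sub_right ip_add ip_add_right sub_closed add_closed)
  then have "nrm (sub u w) = nrm (add (sub u v) (sub v w))"
    by (simp add: nrm_def)
  then show ?thesis
    using nrm_triangle assms sub_closed by metis
qed

lemma nrm_sub_add_le:
  assumes "u \<in> X" "v \<in> X" "x \<in> X" "y \<in> X"
  shows "nrm (sub (add u v) (add x y)) \<le> nrm (sub u x) + nrm (sub v y)"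
proof -
  have "ip (sub (add u v) (add x y)) (sub (add u v) (add x y)) =
      ip (add (sub u x) (sub v y)) (add (sub u x) (sub v y))"
    using assms by (simp add: ip_sub ip_sub_right ip_add ip_add_right sub_closed add_closed)
  then have "nrm (sub (add u v) (add x y)) = nrm (add (sub u x) (sub v y))"
    by (simp add: nrm_def)
  then show ?thesis
    using nrm_triangle assms sub_closed by metis
qed

lemma nrm_sub_scale:
  assumes "u \<in> X" "v \<in> X"
  shows "nrm (sub (scale c u) (scale c v)) = cmod c * nrm (sub u v)"
proof -
  have "ip (sub (scale c u) (scale c v)) (sub (scale c u) (scale c v)) =
      ip (scale c (sub u v)) (scale c (sub u v))"
    using assms
    by (simp add: ip_sub ip_sub_right ip_scale ip_scale_right sub_closed scale_closed right_diff_distrib)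
  then have "nrm (sub (scale c u) (scale c v)) = nrm (scale c (sub u v))"
    by (simp add: nrm_def)
  then show ?thesis
    using nrm_scale assms sub_closed by metis
qed

lemma nrm_diff_le:
  assumes "u \<in> X" "v \<in> X"
  shows "\<bar>nrm u - nrm v\<bar> \<le> nrm (sub u v)"
proof -
  have *: "nrm a - nrm b \<le> nrm (sub a b)" if "a \<in> X" "b \<in> X" for a b
  proof -
    have "ip a a = ip (add (sub a b) b) (add (sub a b) b)"
      using that by (simp add: ip_sub ip_sub_right ip_add ip_add_right sub_closed add_closed)
    then have "nrm a = nrm (add (sub a b) b)" by (simp add: nrm_def)
    then show ?thesis using nrm_triangle[of "sub a b" b] that sub_closed by simp
  qed
  show ?thesis
    using *[OF assms] *[OF assms(2,1)] nrm_sub_comm[OF assms] by linarith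
qed

text \<open>The minimiser of \<open>\<parallel>v\<parallel>\<^sup>2 - 2 Re (l v)\<close> represents \<open>l\<close>: a minimising sequence is Cauchy by the
  parallelogram law, and the first variation vanishes at its limit.\<close>
theorem Riesz_representation:
  fixes l :: "'a \<Rightarrow> complex"
  assumes complete: "\<And>x. \<lbrakk>\<And>n. x n \<in> X; \<And>e. e > 0 \<Longrightarrow> \<exists>N. \<forall>m\<ge>N. \<forall>n\<ge>N. nrm (sub (x m) (x n)) < e\<rbrakk>
                    \<Longrightarrow> \<exists>z\<in>X. (\<lambda>n::nat. nrm (sub (x n) z)) \<longlonglongrightarrow> 0"
    and l_add: "\<And>u v. \<lbrakk>u \<in> X; v \<in> X\<rbrakk> \<Longrightarrow> l (add u v) = l u + l v"
    and l_scale: "\<And>c v. v \<in> X \<Longrightarrow> l (scale c v) = cnj c * l v"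
    and l_bounded: "\<And>v. v \<in> X \<Longrightarrow> cmod (l v) \<le> C * nrm v"
  shows "\<exists>z\<in>X. \<forall>v\<in>X. ip z v = l v"
proof -
  define J where "J v = (nrm v)\<^sup>2 - 2 * Re (l v)" for v
  have J_lower: "- C\<^sup>2 \<le> J v" if "v \<in> X" for v
  proof -
    have "Re (l v) \<le> C * nrm v"
      using l_bounded[OF that] complex_Re_le_cmod order_trans by blast
    moreover have "0 \<le> (nrm v - C)\<^sup>2" by simp
    ultimately show ?thesis by (simp add: J_def power2_diff algebra_simps)
  qed
  define m where "m = Inf (J ` X)"
  have bdd: "bdd_below (J ` X)" using J_lower by (auto intro!: bdd_belowI2)
  have m_le: "m \<le> J v" if "v \<in> X" for v
    unfolding m_def using bdd that by (simp add: cInf_lower)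
  have "\<exists>v\<in>X. J v < m + 1 / real (Suc n)" for n
  proof -
    have "Inf (J ` X) < m + 1 / real (Suc n)" by (simp add: m_def)
    then show ?thesis using nonempty bdd by (subst (asm) cInf_less_iff) auto
  qed
  then obtain x where x: "\<And>n. x n \<in> X" "\<And>n. J (x n) < m + 1 / real (Suc n)" by metis
  \<comment> \<open>parallelogram law\<close>
  have para: "(nrm (sub u v))\<^sup>2 \<le> 2 * (J u - m) + 2 * (J v - m)" if "u \<in> X" "v \<in> X" for u v
  proof -
    let ?w = "scale (1/2) (add u v)"
    have w: "?w \<in> X" using that by (simp add: add_closed scale_closed)
    have "J ?w = (nrm (add u v))\<^sup>2 / 4 - Re (l u) - Re (l v)"
      using that by (simp add: J_def l_scale l_add nrm_scale add_closed power_mult_distrib power2_eq_square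
          add_divide_distrib)
    moreover have "m \<le> J ?w" using m_le w by blast
    ultimately show ?thesis
      using that by (simp add: J_def nrm_add_sq nrm_sub_sq field_simps)
  qed
  have "\<exists>N. \<forall>i\<ge>N. \<forall>k\<ge>N. nrm (sub (x i) (x k)) < e" if "e > 0" for e
  proof -
    have "e\<^sup>2 / 4 > 0" using that by simp
    from reals_Archimedean[OF this] obtain N where N: "1 / real (Suc N) < e\<^sup>2 / 4"
      unfolding inverse_eq_divide by blast
    have small: "J (x i) < m + e\<^sup>2 / 4" if "i \<ge> N" for i
    proof -
      have "1 / real (Suc i) \<le> 1 / real (Suc N)" using that by (simp add: frac_le)
      then have "m + 1 / real (Suc i) < m + e\<^sup>2 / 4"
        using N by (intro add_strict_left_mono) (rule le_less_trans)
      then show ?thesis using x(2)[of i] by (rule less_trans[rotated])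
    qed
    have "nrm (sub (x i) (x k)) < e" if "i \<ge> N" "k \<ge> N" for i k
    proof -
      have "(nrm (sub (x i) (x k)))\<^sup>2 < e\<^sup>2"
        using para[OF x(1) x(1), of i k] small[OF that(1)] small[OF that(2)] by argo
      then show ?thesis using \<open>e > 0\<close> by (simp add: power2_less_imp_less)
    qed
    then show ?thesis by blast
  qed
  from complete[OF x(1) this] obtain z where z: "z \<in> X" "(\<lambda>n. nrm (sub (x n) z)) \<longlonglongrightarrow> 0" by blast
  have "(\<lambda>n. nrm (x n) - nrm z) \<longlonglongrightarrow> 0"
    by (rule Lim_null_comparison[OF _ z(2)]) (use nrm_diff_le x z in auto)
  then have n_lim: "(\<lambda>n. nrm (x n)) \<longlonglongrightarrow> nrm z" by (simp add: LIM_zero_cancel)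
  have "cmod (l (x n) - l z) \<le> C * nrm (sub (x n) z)" for n
    using l_bounded[OF sub_closed[OF x(1) z(1)]] x z by (simp add: sub_def l_add l_scale scale_closed)
  moreover have "(\<lambda>n. C * nrm (sub (x n) z)) \<longlonglongrightarrow> 0"
    using tendsto_mult_left[OF z(2), of C] by simp
  ultimately have "(\<lambda>n. l (x n) - l z) \<longlonglongrightarrow> 0"
    by (intro Lim_null_comparison[where f="\<lambda>n. l (x n) - l z"]) auto
  then have l_lim: "(\<lambda>n. l (x n)) \<longlonglongrightarrow> l z" by (simp add: LIM_zero_cancel)
  have "(\<lambda>n. J (x n)) \<longlonglongrightarrow> J z"
    unfolding J_def by (intro tendsto_intros n_lim l_lim)
  moreover have "(\<lambda>n. m + 1 / real (Suc n)) \<longlonglongrightarrow> m + 0"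
    by (intro tendsto_intros LIMSEQ_Suc[OF lim_1_over_n])
  ultimately have Jz: "J z \<le> m"
    using x(2) by (intro LIMSEQ_le[of "\<lambda>n. J (x n)" "J z" "\<lambda>n. m + 1 / real (Suc n)" m]) (auto intro: less_imp_le)
  have Re_eq: "Re (ip z v) = Re (l v)" if v: "v \<in> X" for v
  proof -
    define d where "d = Re (ip z v) - Re (l v)"
    \<comment> \<open>the summand 1 only ensures \<open>B > 0\<close>\<close>
    define B where "B = (nrm v)\<^sup>2 + 1"
    \<comment> \<open>first variation of \<open>J\<close> at its minimiser, in the direction \<open>v\<close>\<close>
    have q: "0 \<le> 2 * t * d + t\<^sup>2 * (nrm v)\<^sup>2" for t :: real
    proof -
      have "J z \<le> J (add z (scale (of_real t) v))"
        using Jz m_le z v by (meson add_closed order_trans scale_closed)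
      then show ?thesis
        using z v by (simp add: J_def l_add l_scale nrm_add_sq nrm_scale scale_closed ip_scale_right
            d_def power_mult_distrib algebra_simps)
    qed
    have "B > 0" by (simp add: B_def add_nonneg_pos)
    have "0 \<le> 2 * t * d + t\<^sup>2 * B" for t
      using q[of t] zero_le_power2[of t] unfolding B_def distrib_left by linarith
    from this[of "- d / B"] have "0 \<le> - (d\<^sup>2 / B)"
      using \<open>B > 0\<close> by (simp add: power2_eq_square field_simps)
    then have "d = 0" using \<open>B > 0\<close> by (simp add: divide_le_0_iff) 
    then show ?thesis by (simp add: d_def)
  qed
  have "ip z v = l v" if v: "v \<in> X" for v
  proof (rule complex_eqI)
    show "Re (ip z v) = Re (l v)" using Re_eq v by blast
    \<comment> \<open>the real parts in the direction \<open>\<i> v\<close>\<close>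
    show "Im (ip z v) = Im (l v)"
      using Re_eq[OF scale_closed[OF v, of \<i>]] z v by (simp add: ip_scale_right l_scale)
  qed
  then show ?thesis using z by blast
qed

end

section \<open>Riesz-Fischer\<close>

text \<open>
  The squared \<open>L\<^sub>2\<close> distance of two functions, infinite if they are measurable
  and their difference is not square integrable.
\<close>

abbreviation sqdist :: "'a measure \<Rightarrow> ('a \<Rightarrow> complex) \<Rightarrow> ('a \<Rightarrow> complex) \<Rightarrow> ennreal" where
  "sqdist M f g \<equiv> \<integral>\<^sup>+x. ennreal ((cmod (f x - g x))\<^sup>2) \<partial>M"

lemma norm_add_sq_le:
  fixes a b :: "'a :: real_normed_vector"
  shows "(norm (a + b))\<^sup>2 \<le> 2 * (norm a)\<^sup>2 + 2 * (norm b)\<^sup>2"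
proof -
  have "(norm (a + b))\<^sup>2 \<le> (norm a + norm b)\<^sup>2"
    by (simp add: norm_triangle_ineq power_mono)
  also have "\<dots> \<le> 2 * (norm a)\<^sup>2 + 2 * (norm b)\<^sup>2"
    using sum_squares_bound[of "norm a" "norm b"] by (simp add: power2_sum)
  finally show ?thesis .
qed

lemma sqdist_triangle:
  assumes [measurable]: "f \<in> borel_measurable M" "g \<in> borel_measurable M" "h \<in> borel_measurable M"
  shows "sqdist M f h \<le> 2 * sqdist M f g + 2 * sqdist M g h"
proof -
  have "sqdist M f h \<le> (\<integral>\<^sup>+x. 2 * ennreal ((cmod (f x - g x))\<^sup>2) + 2 * ennreal ((cmod (g x - h x))\<^sup>2) \<partial>M)"
  proof (rule nn_integral_mono)
    fix x
    have "(cmod (f x - h x))\<^sup>2 \<le> 2 * (cmod (f x - g x))\<^sup>2 + 2 * (cmod (g x - h x))\<^sup>2"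
      using norm_add_sq_le[of "f x - g x" "g x - h x"] by simp
    then have "ennreal ((cmod (f x - h x))\<^sup>2) \<le> ennreal (2 * (cmod (f x - g x))\<^sup>2 + 2 * (cmod (g x - h x))\<^sup>2)"
      by (rule ennreal_leI)
    then show "ennreal ((cmod (f x - h x))\<^sup>2) \<le> 2 * ennreal ((cmod (f x - g x))\<^sup>2) + 2 * ennreal ((cmod (g x - h x))\<^sup>2)"
      by (simp add: ennreal_plus ennreal_mult)
  qed
  also have "\<dots> = 2 * sqdist M f g + 2 * sqdist M g h"
    by (simp add: nn_integral_add nn_integral_cmult)
  finally show ?thesis .
qed

text \<open>
  Fast convergence in \<open>L\<^sub>2\<close> implies summability almost everywhere. The weights \<open>2\<^sup>k\<close> keep the sum of
  the integrals of \<open>2\<^sup>k h\<^sub>k\<^sup>2\<close> finite, so \<open>h\<^sub>k \<le> 2\<^sup>-\<^sup>k\<^sup>/\<^sup>2\<close> eventually at almost every point.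
\<close>

lemma AE_summable_of_sq_geometric:
  fixes h :: "nat \<Rightarrow> 'a \<Rightarrow> real"
  assumes [measurable]: "\<And>k. h k \<in> borel_measurable M" and nn: "\<And>k x. 0 \<le> h k x"
    and le: "\<And>k. (\<integral>\<^sup>+x. ennreal ((h k x)\<^sup>2) \<partial>M) \<le> ennreal ((1/4) ^ k)"
  shows "AE x in M. summable (\<lambda>k. h k x)"
proof -
  have "(\<integral>\<^sup>+x. (\<Sum>k. ennreal (2 ^ k * (h k x)\<^sup>2)) \<partial>M) = (\<Sum>k. \<integral>\<^sup>+x. ennreal (2 ^ k * (h k x)\<^sup>2) \<partial>M)"
    by (intro nn_integral_suminf) measurable
  also have "\<dots> \<le> (\<Sum>k. ennreal ((1/2) ^ k))"
  proof (rule suminf_le)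
    fix k
    have "(\<integral>\<^sup>+x. ennreal (2 ^ k * (h k x)\<^sup>2) \<partial>M) = ennreal (2 ^ k) * (\<integral>\<^sup>+x. ennreal ((h k x)\<^sup>2) \<partial>M)"
      by (simp add: ennreal_mult nn_integral_cmult)
    also have "\<dots> \<le> ennreal (2 ^ k) * ennreal ((1/4) ^ k)"
      by (intro mult_left_mono le) simp
    also have "\<dots> = ennreal ((1/2) ^ k)"
      by (simp add: ennreal_mult[symmetric] power_mult_distrib[symmetric])
    finally show "(\<integral>\<^sup>+x. ennreal (2 ^ k * (h k x)\<^sup>2) \<partial>M) \<le> ennreal ((1/2) ^ k)" .
  qed auto
  also have "\<dots> < \<infinity>"
    unfolding infinity_ennreal_def less_top[symmetric]
    by (rule ennreal_suminf_neq_top) (simp_all add: summable_geometric)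
  finally have "AE x in M. (\<Sum>k. ennreal (2 ^ k * (h k x)\<^sup>2)) \<noteq> \<infinity>"
    by (intro nn_integral_noteq_infinite) auto
  then show ?thesis
  proof eventually_elim
    case (elim x)
    then have "summable (\<lambda>k. 2 ^ k * (h k x)\<^sup>2)"
      by (intro summable_suminf_not_top) (auto simp: infinity_ennreal_def)
    then have "(\<lambda>k. 2 ^ k * (h k x)\<^sup>2) \<longlonglongrightarrow> 0"
      by (rule summable_LIMSEQ_zero)
    then have "eventually (\<lambda>k. 2 ^ k * (h k x)\<^sup>2 < 1) sequentially"
      by (rule order_tendstoD) simp
    then have "eventually (\<lambda>k. norm (h k x) \<le> (1 / sqrt 2) ^ k) sequentially"
    proof eventually_elim
      case (elim k)
      have "(h k x)\<^sup>2 \<le> (1/2) ^ k"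
        using elim by (simp add: field_simps power_one_over)
      also have "\<dots> = ((1 / sqrt 2) ^ k)\<^sup>2"
        by (simp add: power_divide power_mult[symmetric] mult.commute[of k 2]) (simp add: power_mult)
      finally have "h k x \<le> (1 / sqrt 2) ^ k"
        by (rule power2_le_imp_le) simp
      then show ?case using nn by simp
    qed
    moreover have "summable (\<lambda>k. (1 / sqrt 2) ^ k)"
      by (intro summable_geometric) simp
    ultimately show ?case by (rule summable_comparison_test_ev)
  qed
qed

theorem Riesz_Fischer:
  fixes f :: "nat \<Rightarrow> 'a \<Rightarrow> complex"
  assumes meas[measurable]: "\<And>n. f n \<in> borel_measurable M"
    and Cauchy: "\<And>e. e > 0 \<Longrightarrow> \<exists>N. \<forall>m\<ge>N. \<forall>n\<ge>N. sqdist M (f m) (f n) \<le> ennreal e"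
  obtains g where "g \<in> borel_measurable M"
    "\<And>e. e > 0 \<Longrightarrow> \<exists>N. \<forall>n\<ge>N. sqdist M (f n) g \<le> ennreal e"
proof -
  have "\<forall>k. \<exists>N. \<forall>m\<ge>N. \<forall>n\<ge>N. sqdist M (f m) (f n) \<le> ennreal ((1/4) ^ k)"
    using Cauchy by simp
  then obtain N where N: "\<And>k m n. \<lbrakk>m \<ge> N k; n \<ge> N k\<rbrakk> \<Longrightarrow> sqdist M (f m) (f n) \<le> ennreal ((1/4) ^ k)"
    by metis
  \<comment> \<open>an increasing sequence of indices with \<open>r k \<ge> N k\<close> and \<open>r k \<ge> k\<close>\<close>
  define r where "r k = k + (\<Sum>j\<le>k. N j)" for k
  have r_ge: "r k \<ge> N k" "r (Suc k) \<ge> N k" "r k \<ge> k" for k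
    using member_le_sum[of k "{..k}" N] by (auto simp: r_def)
  have "AE x in M. summable (\<lambda>k. cmod (f (r (Suc k)) x - f (r k) x))"
    by (rule AE_summable_of_sq_geometric) (use N r_ge in auto)
  then have conv: "AE x in M. (\<lambda>k. f (r k) x) \<longlonglongrightarrow> lim (\<lambda>k. f (r k) x)"
  proof eventually_elim
    case (elim x)
    then have "summable (\<lambda>k. f (r (Suc k)) x - f (r k) x)"
      by (rule summable_norm_cancel)
    then have "convergent (\<lambda>n. \<Sum>k<n. f (r (Suc k)) x - f (r k) x)"
      by (simp add: summable_iff_convergent)
    then have "convergent (\<lambda>n. f (r n) x - f (r 0) x)"
      unfolding sum_lessThan_telescope[of "\<lambda>k. f (r k) x"] .
    then obtain L where "(\<lambda>n. f (r n) x - f (r 0) x) \<longlonglongrightarrow> L"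
      by (auto simp: convergent_def)
    then have "(\<lambda>n. f (r n) x - f (r 0) x + f (r 0) x) \<longlonglongrightarrow> L + f (r 0) x"
      by (intro tendsto_intros)
    then show ?case by (simp add: convergent_LIMSEQ_iff[symmetric] convergentI)
  qed
  define g where "g x = lim (\<lambda>k. f (r k) x)" for x
  have [measurable]: "g \<in> borel_measurable M" unfolding g_def by measurable
  have "\<exists>N. \<forall>n\<ge>N. sqdist M (f n) g \<le> ennreal e" if "e > 0" for e
  proof -
    obtain K where K: "\<And>m n. \<lbrakk>m \<ge> K; n \<ge> K\<rbrakk> \<Longrightarrow> sqdist M (f m) (f n) \<le> ennreal e"
      using Cauchy[OF \<open>e > 0\<close>] by blast
    have "sqdist M (f n) g \<le> ennreal e" if "n \<ge> K" for n
    proof -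
      have "sqdist M (f n) g = (\<integral>\<^sup>+x. liminf (\<lambda>k. ennreal ((cmod (f n x - f (r k) x))\<^sup>2)) \<partial>M)"
      proof (rule nn_integral_cong_AE, use conv in eventually_elim)
        fix x assume "(\<lambda>k. f (r k) x) \<longlonglongrightarrow> lim (\<lambda>k. f (r k) x)"
        then have "(\<lambda>k. ennreal ((cmod (f n x - f (r k) x))\<^sup>2)) \<longlonglongrightarrow> ennreal ((cmod (f n x - g x))\<^sup>2)"
          unfolding g_def by (intro tendsto_intros tendsto_ennrealI)
        then show "ennreal ((cmod (f n x - g x))\<^sup>2) = liminf (\<lambda>k. ennreal ((cmod (f n x - f (r k) x))\<^sup>2))"
          by (rule lim_imp_Liminf[OF sequentially_bot, symmetric])
      qed
      also have "\<dots> \<le> liminf (\<lambda>k. sqdist M (f n) (f (r k)))"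
        by (rule nn_integral_liminf) measurable
      also have "\<dots> \<le> limsup (\<lambda>k. sqdist M (f n) (f (r k)))"
        by (rule Liminf_le_Limsup) simp
      also have "\<dots> \<le> ennreal e"
      proof (rule Limsup_bounded)
        show "eventually (\<lambda>k. sqdist M (f n) (f (r k)) \<le> ennreal e) sequentially"
          using eventually_ge_at_top[of K]
          by eventually_elim (use K[OF that] r_ge(3) order_trans in blast)
      qed
      finally show ?thesis .
    qed
    then show ?thesis by blast
  qed
  then show ?thesis using that[of g] by simp
qed

section \<open>The space L2\<close>

lemma borel_measurable_cnj[measurable (raw)]:
  "f \<in> borel_measurable M \<Longrightarrow> (\<lambda>x. cnj (f x)) \<in> borel_measurable M"
  by (rule borel_measurable_continuous_on[of cnj]) (auto intro: continuous_intros)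

text \<open>
  The distance of two classes in \<open>L\<^sub>2\<close>.
\<close>

abbreviation L2_dist :: "(real^'n) set \<Rightarrow> 'n fn set \<Rightarrow> 'n fn set \<Rightarrow> real" where
  "L2_dist \<Omega> u v \<equiv> L2_norm \<Omega> (cls_diff \<Omega> u v)"

lemma square_integrable_meas[measurable_dest]:
  "square_integrable \<Omega> f \<Longrightarrow> f \<in> borel_measurable (lebesgue_on \<Omega>)"
  by (simp add: square_integrable_def)

lemma square_integrable_iff:
  assumes "f \<in> borel_measurable (lebesgue_on \<Omega>)"
  shows "square_integrable \<Omega> f \<longleftrightarrow> sqdist (lebesgue_on \<Omega>) f (\<lambda>x. 0) < \<infinity>"
  using assms by (simp add: square_integrable_def integrable_iff_bounded)

lemma square_integrable_bound:
  assumes "f \<in> borel_measurable (lebesgue_on \<Omega>)" "square_integrable \<Omega> g"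
    "AE x in lebesgue_on \<Omega>. cmod (f x) \<le> cmod (g x)"
  shows "square_integrable \<Omega> f"
  unfolding square_integrable_def
proof
  show "integrable (lebesgue_on \<Omega>) (\<lambda>x. (cmod (f x))\<^sup>2)"
  proof (rule Bochner_Integration.integrable_bound)
    show "integrable (lebesgue_on \<Omega>) (\<lambda>x. (cmod (g x))\<^sup>2)"
      using assms(2) by (simp add: square_integrable_def)
    show "AE x in lebesgue_on \<Omega>. norm ((cmod (f x))\<^sup>2) \<le> norm ((cmod (g x))\<^sup>2)"
      using assms(3) by eventually_elim (simp add: power_mono)
  qed (use assms(1) in measurable)
qed fact

lemma square_integrable_add:
  assumes "square_integrable \<Omega> f" "square_integrable \<Omega> g"
  shows "square_integrable \<Omega> (\<lambda>x. f x + g x)"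
  unfolding square_integrable_def
proof
  note [measurable] = assms[THEN square_integrable_meas]
  show "integrable (lebesgue_on \<Omega>) (\<lambda>x. (cmod (f x + g x))\<^sup>2)"
  proof (rule Bochner_Integration.integrable_bound)
    show "integrable (lebesgue_on \<Omega>) (\<lambda>x. 2 * (cmod (f x))\<^sup>2 + 2 * (cmod (g x))\<^sup>2)"
      using assms by (simp add: square_integrable_def)
    show "AE x in lebesgue_on \<Omega>. norm ((cmod (f x + g x))\<^sup>2) \<le> norm (2 * (cmod (f x))\<^sup>2 + 2 * (cmod (g x))\<^sup>2)"
      using norm_add_sq_le by (intro AE_I2) auto
  qed measurable
  show "(\<lambda>x. f x + g x) \<in> borel_measurable (lebesgue_on \<Omega>)" by measurable
qed

lemma square_integrable_cmult:
  assumes "square_integrable \<Omega> f"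
  shows "square_integrable \<Omega> (\<lambda>x. c * f x)"
  using assms by (auto simp: square_integrable_def norm_mult power_mult_distrib)

lemma square_integrable_zero: "square_integrable \<Omega> (\<lambda>x. 0)"
  by (simp add: square_integrable_def)

lemma square_integrable_diff:
  assumes "square_integrable \<Omega> f" "square_integrable \<Omega> g"
  shows "square_integrable \<Omega> (\<lambda>x. f x - g x)"
  using square_integrable_add[OF assms(1) square_integrable_cmult[OF assms(2), of "-1"]] by simp

lemma square_integrable_mult:
  assumes "square_integrable \<Omega> f" "square_integrable \<Omega> g"
  shows "integrable (lebesgue_on \<Omega>) (\<lambda>x. f x * g x)"
proof (rule Bochner_Integration.integrable_bound)
  note [measurable] = assms[THEN square_integrable_meas]
  show "integrable (lebesgue_on \<Omega>) (\<lambda>x. (cmod (f x))\<^sup>2 + (cmod (g x))\<^sup>2)"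
    using assms by (simp add: square_integrable_def)
  show "AE x in lebesgue_on \<Omega>. norm (f x * g x) \<le> norm ((cmod (f x))\<^sup>2 + (cmod (g x))\<^sup>2)"
  proof (intro AE_I2)
    fix x
    have "cmod (f x) * cmod (g x) \<ge> 0" by simp
    then have "cmod (f x) * cmod (g x) \<le> (cmod (f x))\<^sup>2 + (cmod (g x))\<^sup>2"
      using sum_squares_bound[of "cmod (f x)" "cmod (g x)"] unfolding mult.assoc by linarith
    then show "norm (f x * g x) \<le> norm ((cmod (f x))\<^sup>2 + (cmod (g x))\<^sup>2)"
      by (simp add: norm_mult)
  qed
qed (use assms[THEN square_integrable_meas] in measurable)

lemma square_integrable_cnj: "square_integrable \<Omega> f \<Longrightarrow> square_integrable \<Omega> (\<lambda>x. cnj (f x))"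
  by (rule square_integrable_bound[where g=f]) (auto dest: square_integrable_meas)

lemma ae_class_cong:
  assumes "AE x in lebesgue_on \<Omega>. f x = g x"
  shows "ae_class \<Omega> f = ae_class \<Omega> g"
  using assms by (auto simp: ae_class_def)

lemma mem_ae_class: "f \<in> borel_measurable (lebesgue_on \<Omega>) \<Longrightarrow> f \<in> ae_class \<Omega> f"
  by (simp add: ae_class_def)

lemma rep_ae_class:
  assumes "f \<in> borel_measurable (lebesgue_on \<Omega>)"
  shows "rep (ae_class \<Omega> f) \<in> borel_measurable (lebesgue_on \<Omega>)"
    and "AE x in lebesgue_on \<Omega>. rep (ae_class \<Omega> f) x = f x"
proof -
  have "rep (ae_class \<Omega> f) \<in> ae_class \<Omega> f"
    unfolding rep_def using someI[of "\<lambda>g. g \<in> ae_class \<Omega> f", OF mem_ae_class[OF assms]] .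
  then show "rep (ae_class \<Omega> f) \<in> borel_measurable (lebesgue_on \<Omega>)"
    and "AE x in lebesgue_on \<Omega>. rep (ae_class \<Omega> f) x = f x"
    by (auto simp: ae_class_def)
qed

lemma ae_class_L2: "square_integrable \<Omega> f \<Longrightarrow> ae_class \<Omega> f \<in> L2 \<Omega>"
  by (simp add: L2_def)

lemma L2_cases:
  assumes "u \<in> L2 \<Omega>" obtains f where "square_integrable \<Omega> f" "u = ae_class \<Omega> f"
  using assms by (auto simp: L2_def)

lemma rep_L2:
  assumes "u \<in> L2 \<Omega>"
  shows "square_integrable \<Omega> (rep u)" and "ae_class \<Omega> (rep u) = u"
proof -
  obtain f where f: "square_integrable \<Omega> f" "u = ae_class \<Omega> f" using assms L2_cases by blast
  note r = rep_ae_class[OF square_integrable_meas[OF f(1)]]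
  show "square_integrable \<Omega> (rep u)"
    by (rule square_integrable_bound[OF _ f(1)]) (use r f in auto)
  show "ae_class \<Omega> (rep u) = u"
    using ae_class_cong[OF r(2)] f by simp
qed

lemma L2_eqI:
  assumes "u \<in> L2 \<Omega>" "v \<in> L2 \<Omega>" "AE x in lebesgue_on \<Omega>. rep u x = rep v x"
  shows "u = v"
  using ae_class_cong[OF assms(3)] rep_L2(2) assms by metis

lemma rep_meas[measurable_dest]: "u \<in> L2 \<Omega> \<Longrightarrow> rep u \<in> borel_measurable (lebesgue_on \<Omega>)"
  using rep_L2 square_integrable_meas by blast

lemma
  assumes "u \<in> L2 \<Omega>" "v \<in> L2 \<Omega>"
  shows cls_add_L2: "cls_add \<Omega> u v \<in> L2 \<Omega>"
    and rep_cls_add: "AE x in lebesgue_on \<Omega>. rep (cls_add \<Omega> u v) x = rep u x + rep v x"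
    and cls_diff_L2: "cls_diff \<Omega> u v \<in> L2 \<Omega>"
    and rep_cls_diff: "AE x in lebesgue_on \<Omega>. rep (cls_diff \<Omega> u v) x = rep u x - rep v x"
  using square_integrable_add[OF assms[THEN rep_L2(1)]] square_integrable_diff[OF assms[THEN rep_L2(1)]]
  by (auto simp: cls_add_def cls_diff_def intro: ae_class_L2 rep_ae_class square_integrable_meas)

lemma
  assumes "u \<in> L2 \<Omega>"
  shows cls_scale_L2: "cls_scale \<Omega> c u \<in> L2 \<Omega>"
    and rep_cls_scale: "AE x in lebesgue_on \<Omega>. rep (cls_scale \<Omega> c u) x = c * rep u x"
  using square_integrable_cmult[OF rep_L2(1)[OF assms], of c]
  by (auto simp: cls_scale_def intro: ae_class_L2 rep_ae_class square_integrable_meas)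

lemma
  assumes "f \<in> borel_measurable (lebesgue_on \<Omega>)" "g \<in> borel_measurable (lebesgue_on \<Omega>)"
  shows cls_add_ae_class: "cls_add \<Omega> (ae_class \<Omega> f) (ae_class \<Omega> g) = ae_class \<Omega> (\<lambda>x. f x + g x)"
    and cls_diff_ae_class: "cls_diff \<Omega> (ae_class \<Omega> f) (ae_class \<Omega> g) = ae_class \<Omega> (\<lambda>x. f x - g x)"
proof -
  note r = rep_ae_class(2)[OF assms(1)] rep_ae_class(2)[OF assms(2)]
  show "cls_add \<Omega> (ae_class \<Omega> f) (ae_class \<Omega> g) = ae_class \<Omega> (\<lambda>x. f x + g x)"
    unfolding cls_add_def by (rule ae_class_cong) (use r in \<open>eventually_elim, simp\<close>)
  show "cls_diff \<Omega> (ae_class \<Omega> f) (ae_class \<Omega> g) = ae_class \<Omega> (\<lambda>x. f x - g x)"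
    unfolding cls_diff_def by (rule ae_class_cong) (use r in \<open>eventually_elim, simp\<close>)
qed

lemma cls_scale_ae_class:
  assumes "f \<in> borel_measurable (lebesgue_on \<Omega>)"
  shows "cls_scale \<Omega> c (ae_class \<Omega> f) = ae_class \<Omega> (\<lambda>x. c * f x)"
  unfolding cls_scale_def
  by (rule ae_class_cong) (use rep_ae_class(2)[OF assms] in \<open>eventually_elim, simp\<close>)

lemma cls_zero_L2: "cls_zero \<Omega> \<in> L2 \<Omega>"
  and rep_cls_zero: "AE x in lebesgue_on \<Omega>. rep (cls_zero \<Omega>) x = 0"
  unfolding cls_zero_def by (auto intro: ae_class_L2 square_integrable_zero rep_ae_class(2))

lemma cls_diff_eq:
  assumes "u \<in> L2 \<Omega>" "v \<in> L2 \<Omega>"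
  shows "cls_diff \<Omega> u v = cls_add \<Omega> u (cls_scale \<Omega> (-1) v)"
proof (rule L2_eqI)
  show "AE x in lebesgue_on \<Omega>. rep (cls_diff \<Omega> u v) x = rep (cls_add \<Omega> u (cls_scale \<Omega> (-1) v)) x"
    using rep_cls_diff[OF assms] rep_cls_add[OF assms(1) cls_scale_L2[OF assms(2), where c="-1"]]
      rep_cls_scale[OF assms(2), where c="-1"]
    by eventually_elim simp
qed (use assms in \<open>auto intro: cls_diff_L2 cls_add_L2 cls_scale_L2\<close>)

lemma cls_diff_eq_zero:
  assumes "u \<in> L2 \<Omega>" "v \<in> L2 \<Omega>" "cls_diff \<Omega> u v = cls_zero \<Omega>"
  shows "u = v"
proof (rule L2_eqI[OF assms(1,2)])
  show "AE x in lebesgue_on \<Omega>. rep u x = rep v x"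
    using rep_cls_diff[OF assms(1,2)] rep_cls_zero[of \<Omega>] unfolding assms(3) by eventually_elim simp
qed

lemma cls_scale_zero:
  assumes "u \<in> L2 \<Omega>" shows "cls_scale \<Omega> 0 u = cls_zero \<Omega>"
  by (simp add: cls_scale_def cls_zero_def)

lemma L2_inner_ae:
  assumes "f \<in> borel_measurable (lebesgue_on \<Omega>)" "g \<in> borel_measurable (lebesgue_on \<Omega>)"
    "u \<in> L2 \<Omega>" "v \<in> L2 \<Omega>"
    "AE x in lebesgue_on \<Omega>. rep u x = f x" "AE x in lebesgue_on \<Omega>. rep v x = g x"
  shows "L2_inner \<Omega> u v = (\<integral>x. f x * cnj (g x) \<partial>lebesgue_on \<Omega>)"
proof -
  note [measurable] = assms(1,2) rep_meas[OF assms(3)] rep_meas[OF assms(4)]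
  show ?thesis unfolding L2_inner_def
  proof (rule integral_cong_AE)
    show "AE x in lebesgue_on \<Omega>. rep u x * cnj (rep v x) = f x * cnj (g x)"
      using assms(5,6) by eventually_elim simp
  qed measurable
qed

lemma L2_inner_self:
  assumes "u \<in> L2 \<Omega>"
  shows "L2_inner \<Omega> u u = of_real (\<integral>x. (cmod (rep u x))\<^sup>2 \<partial>lebesgue_on \<Omega>)"
  unfolding L2_inner_def complex_norm_square[symmetric] by (rule integral_complex_of_real)

lemma L2_norm_nn_integral:
  assumes "u \<in> L2 \<Omega>"
  shows "sqdist (lebesgue_on \<Omega>) (rep u) (\<lambda>x. 0) = ennreal ((L2_norm \<Omega> u)\<^sup>2)"
  using rep_L2(1)[OF assms] unfolding L2_norm_def L2_inner_self[OF assms] square_integrable_def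
  by (simp add: nn_integral_eq_integral)

lemma L2_carrier_inner: "carrier_inner (L2 \<Omega>) (cls_add \<Omega>) (cls_scale \<Omega>) (L2_inner \<Omega>)"
proof
  show "L2 \<Omega> \<noteq> {}" using cls_zero_L2 by blast
next
  fix u v assume uv: "u \<in> L2 \<Omega>" "v \<in> L2 \<Omega>"
  show "cls_add \<Omega> u v \<in> L2 \<Omega>" using uv by (rule cls_add_L2)
  note si = rep_L2(1)[OF uv(1)] rep_L2(1)[OF uv(2)]
  note [measurable] = si[THEN square_integrable_meas]
  show "L2_inner \<Omega> v u = cnj (L2_inner \<Omega> u v)"
    unfolding L2_inner_def by (subst Bochner_Integration.integral_cnj[symmetric]) (simp add: mult.commute)
  fix c
  show "L2_inner \<Omega> (cls_scale \<Omega> c u) v = c * L2_inner \<Omega> u v"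
  proof (subst L2_inner_ae[where f="\<lambda>x. c * rep u x" and g="rep v"])
    show "(\<integral>x. c * rep u x * cnj (rep v x) \<partial>lebesgue_on \<Omega>) = c * L2_inner \<Omega> u v"
      by (simp add: L2_inner_def mult.assoc)
  qed (use uv in \<open>auto intro: cls_scale_L2 rep_cls_scale\<close>)
  fix w assume w: "w \<in> L2 \<Omega>"
  note [measurable] = square_integrable_meas[OF rep_L2(1)[OF w]]
  show "L2_inner \<Omega> (cls_add \<Omega> u v) w = L2_inner \<Omega> u w + L2_inner \<Omega> v w"
  proof (subst L2_inner_ae[where f="\<lambda>x. rep u x + rep v x" and g="rep w"])
    have "integrable (lebesgue_on \<Omega>) (\<lambda>x. rep u x * cnj (rep w x))" 
      "integrable (lebesgue_on \<Omega>) (\<lambda>x. rep v x * cnj (rep w x))"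
      by (auto intro!: square_integrable_mult si square_integrable_cnj rep_L2 w)
    then show "(\<integral>x. (rep u x + rep v x) * cnj (rep w x) \<partial>lebesgue_on \<Omega>) = L2_inner \<Omega> u w + L2_inner \<Omega> v w"
      by (simp add: L2_inner_def distrib_right)
  qed (use uv w in \<open>auto intro: cls_add_L2 rep_cls_add\<close>)
next
  fix u c assume u: "u \<in> L2 \<Omega>"
  show "cls_scale \<Omega> c u \<in> L2 \<Omega>" using u by (rule cls_scale_L2)
  show "0 \<le> Re (L2_inner \<Omega> u u)" by (simp add: L2_inner_self[OF u])
qed

text \<open>
  The abstract norm of the locale is \<open>L2_norm\<close>; its difference is \<open>cls_diff\<close> by \<open>L2_sub_eq\<close> below.
\<close>

interpretation L2: carrier_inner "L2 \<Omega>" "cls_add \<Omega>" "cls_scale \<Omega>" "L2_inner \<Omega>"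
  rewrites "carrier_inner.nrm (L2_inner \<Omega>) = L2_norm \<Omega>"
  for \<Omega> :: "(real^'n::finite) set"
proof -
  show "carrier_inner (L2 \<Omega>) (cls_add \<Omega>) (cls_scale \<Omega>) (L2_inner \<Omega>)" by (rule L2_carrier_inner)
  then interpret carrier_inner "L2 \<Omega>" "cls_add \<Omega>" "cls_scale \<Omega>" "L2_inner \<Omega>" .
  show "nrm = L2_norm \<Omega>" by (simp add: fun_eq_iff nrm_def L2_norm_def)
qed

lemma L2_sub_eq: "\<lbrakk>u \<in> L2 \<Omega>; v \<in> L2 \<Omega>\<rbrakk> \<Longrightarrow> L2.sub \<Omega> u v = cls_diff \<Omega> u v"
  by (simp add: L2.sub_def cls_diff_eq)

lemma L2_norm_nonneg: "u \<in> L2 \<Omega> \<Longrightarrow> 0 \<le> L2_norm \<Omega> u"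
  by (rule L2.nrm_nonneg)

lemma L2_diff_triangle:
  assumes "u \<in> L2 \<Omega>" "v \<in> L2 \<Omega>" "w \<in> L2 \<Omega>"
  shows "L2_dist \<Omega> u w \<le> L2_dist \<Omega> u v + L2_dist \<Omega> v w"
  using L2.nrm_sub_triangle[OF assms] assms by (simp add: L2_sub_eq)

lemma L2_diff_comm:
  assumes "u \<in> L2 \<Omega>" "v \<in> L2 \<Omega>"
  shows "L2_dist \<Omega> u v = L2_dist \<Omega> v u"
  using L2.nrm_sub_comm[OF assms] assms by (simp add: L2_sub_eq)

lemma L2_diff_add_le:
  assumes "u \<in> L2 \<Omega>" "v \<in> L2 \<Omega>" "x \<in> L2 \<Omega>" "y \<in> L2 \<Omega>"
  shows "L2_dist \<Omega> (cls_add \<Omega> u v) (cls_add \<Omega> x y) \<le> L2_dist \<Omega> u x + L2_dist \<Omega> v y"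
  using L2.nrm_sub_add_le[OF assms] assms by (simp add: L2_sub_eq cls_add_L2)

lemma L2_diff_scale:
  assumes "u \<in> L2 \<Omega>" "v \<in> L2 \<Omega>"
  shows "L2_dist \<Omega> (cls_scale \<Omega> c u) (cls_scale \<Omega> c v) = cmod c * L2_dist \<Omega> u v"
  using L2.nrm_sub_scale[OF assms] assms by (simp add: L2_sub_eq cls_scale_L2)

lemma sqdist_L2:
  assumes "u \<in> L2 \<Omega>" "v \<in> L2 \<Omega>"
  shows "sqdist (lebesgue_on \<Omega>) (rep u) (rep v) = ennreal ((L2_dist \<Omega> u v)\<^sup>2)"
proof -
  have "sqdist (lebesgue_on \<Omega>) (rep u) (rep v) = sqdist (lebesgue_on \<Omega>) (rep (cls_diff \<Omega> u v)) (\<lambda>x. 0)"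
    by (rule nn_integral_cong_AE) (use rep_cls_diff[OF assms] in \<open>eventually_elim, simp\<close>)
  then show ?thesis using L2_norm_nn_integral[OF cls_diff_L2[OF assms]] by simp
qed

lemma L2_norm_eq_0:
  assumes "u \<in> L2 \<Omega>" "L2_norm \<Omega> u = 0" shows "u = cls_zero \<Omega>"
proof (rule L2_eqI[OF assms(1) cls_zero_L2])
  note [measurable] = rep_meas[OF assms(1)]
  have "sqdist (lebesgue_on \<Omega>) (rep u) (\<lambda>x. 0) = 0"
    using L2_norm_nn_integral[OF assms(1)] assms(2) by simp
  then have "AE x in lebesgue_on \<Omega>. ennreal ((cmod (rep u x - 0))\<^sup>2) = 0"
    by (subst (asm) nn_integral_0_iff_AE) auto
  then show "AE x in lebesgue_on \<Omega>. rep u x = rep (cls_zero \<Omega>) x"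
    using rep_cls_zero[of \<Omega>] by eventually_elim simp
qed

theorem L2_complete:
  assumes u: "\<And>n. u n \<in> L2 \<Omega>"
    and Cauchy: "\<And>e. e > 0 \<Longrightarrow> \<exists>N. \<forall>m\<ge>N. \<forall>n\<ge>N. L2_dist \<Omega> (u m) (u n) < e"
  shows "\<exists>v\<in>L2 \<Omega>. (\<lambda>n::nat. L2_dist \<Omega> (u n) v) \<longlonglongrightarrow> 0"
proof -
  let ?M = "lebesgue_on \<Omega>"
  have nn: "0 \<le> L2_norm \<Omega> w" if "w \<in> L2 \<Omega>" for w using that by (rule L2.nrm_nonneg)
  note [measurable] = rep_meas[OF u]
  have "\<exists>N. \<forall>m\<ge>N. \<forall>n\<ge>N. sqdist ?M (rep (u m)) (rep (u n)) \<le> ennreal e" if "e > 0" for e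
  proof -
    have "sqrt e > 0" using that by simp
    then obtain N where N: "\<And>m n. \<lbrakk>m \<ge> N; n \<ge> N\<rbrakk> \<Longrightarrow> L2_dist \<Omega> (u m) (u n) < sqrt e"
      using Cauchy by blast
    have "sqdist ?M (rep (u m)) (rep (u n)) \<le> ennreal e" if "m \<ge> N" "n \<ge> N" for m n
    proof -
      have "(L2_dist \<Omega> (u m) (u n))\<^sup>2 \<le> (sqrt e)\<^sup>2"
        using N[OF that] nn[OF cls_diff_L2[OF u u]] by (intro power_mono) auto
      then show ?thesis using \<open>e > 0\<close> by (simp add: sqdist_L2[OF u u] ennreal_leI)
    qed
    then show ?thesis by blast
  qed
  then obtain g where g[measurable]: "g \<in> borel_measurable ?M"
    and gl: "\<And>e. e > 0 \<Longrightarrow> \<exists>N. \<forall>n\<ge>N. sqdist ?M (rep (u n)) g \<le> ennreal e"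
    by (rule Riesz_Fischer[rotated]) auto
  obtain N where N: "sqdist ?M (rep (u N)) g \<le> ennreal 1" using gl[of 1] by auto
  have "sqdist ?M g (\<lambda>x. 0) \<le> 2 * sqdist ?M g (rep (u N)) + 2 * sqdist ?M (rep (u N)) (\<lambda>x. 0)"
    by (rule sqdist_triangle) measurable
  also have "\<dots> \<le> 2 * ennreal 1 + 2 * ennreal ((L2_norm \<Omega> (u N))\<^sup>2)"
    using N by (intro add_mono mult_left_mono) (simp_all add: norm_minus_commute L2_norm_nn_integral[OF u, simplified])
  also have "\<dots> < \<infinity>" by (simp add: ennreal_mult_less_top)
  finally have si: "square_integrable \<Omega> g" by (simp add: square_integrable_iff)
  define v where "v = ae_class \<Omega> g"
  have v: "v \<in> L2 \<Omega>" unfolding v_def using si by (rule ae_class_L2)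
  have vg: "sqdist ?M (rep (u n)) (rep v) = sqdist ?M (rep (u n)) g" for n
    by (rule nn_integral_cong_AE) (use rep_ae_class(2)[OF g] in \<open>eventually_elim, simp add: v_def\<close>)
  have "(\<lambda>n. L2_dist \<Omega> (u n) v) \<longlonglongrightarrow> 0"
  proof (rule LIMSEQ_I)
    fix e :: real assume "e > 0"
    then obtain N where N: "\<And>n. n \<ge> N \<Longrightarrow> sqdist ?M (rep (u n)) g \<le> ennreal ((e/2)\<^sup>2)"
      using gl[of "(e/2)\<^sup>2"] by auto
    have "norm (L2_dist \<Omega> (u n) v - 0) < e" if "n \<ge> N" for n
    proof -
      have "(L2_dist \<Omega> (u n) v)\<^sup>2 \<le> (e/2)\<^sup>2"
        using N[OF that] unfolding vg[symmetric] sqdist_L2[OF u v] by simp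
      then have "L2_dist \<Omega> (u n) v \<le> e/2"
        by (rule power2_le_imp_le) (use \<open>e > 0\<close> in simp)
      then show ?thesis using \<open>e > 0\<close> nn[OF cls_diff_L2[OF u v]] by simp
    qed
    then show "\<exists>N. \<forall>n\<ge>N. norm (L2_dist \<Omega> (u n) v - 0) < e" by blast
  qed
  then show ?thesis using v by blast
qed

section \<open>Hilbert spaces embedded in L2\<close>

text \<open>
  A linear subspace of \<open>L\<^sub>2\<close> on \<open>\<Omega>\<close>.
\<close>

locale L2_subspace =
  fixes \<Omega> :: "(real^'n::finite) set" and X :: "'n fn set set"
  assumes sub_L2: "X \<subseteq> L2 \<Omega>"
    and zero_mem: "cls_zero \<Omega> \<in> X"
    and add_mem: "\<lbrakk>u \<in> X; v \<in> X\<rbrakk> \<Longrightarrow> cls_add \<Omega> u v \<in> X"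
    and scale_mem: "u \<in> X \<Longrightarrow> cls_scale \<Omega> c u \<in> X"
begin

lemma mem_L2: "u \<in> X \<Longrightarrow> u \<in> L2 \<Omega>"
  using sub_L2 by blast

lemma diff_mem: "\<lbrakk>u \<in> X; v \<in> X\<rbrakk> \<Longrightarrow> cls_diff \<Omega> u v \<in> X"
  by (simp add: cls_diff_eq mem_L2 add_mem scale_mem)

lemma admissible_carrier_inner:
  assumes "inner_product_on \<Omega> X a"
  shows "carrier_inner X (cls_add \<Omega>) (cls_scale \<Omega>) a"
proof
  show "X \<noteq> {}" using zero_mem by blast
next
  fix u assume u: "u \<in> X"
  show "0 \<le> Re (a u u)"
  proof (cases "u = cls_zero \<Omega>")
    case True
    have "a (cls_scale \<Omega> 0 u) u = 0 * a u u"
      using assms u unfolding inner_product_on_def by blast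
    then show ?thesis
      using True cls_scale_zero[OF mem_L2[OF u]] by simp
  next
    case False
    then have "0 < Re (a u u)" using assms u unfolding inner_product_on_def by blast
    then show ?thesis by simp
  qed
next
  note D = assms[unfolded inner_product_on_def]
  show "a (cls_add \<Omega> u v) w = a u w + a v w" if "u \<in> X" "v \<in> X" "w \<in> X" for u v w
    using D[THEN conjunct1] that by blast
  show "a (cls_scale \<Omega> c u) v = c * a u v" if "u \<in> X" "v \<in> X" for u v c
    using D[THEN conjunct2, THEN conjunct1] that by blast
  show "a v u = cnj (a u v)" if "u \<in> X" "v \<in> X" for u v
    using D[THEN conjunct2, THEN conjunct2, THEN conjunct1] that by blast
qed (fact add_mem scale_mem)+

text \<open>
  Here \<open>q\<close> is the standard norm, complete on \<open>X\<close> and dominating the \<open>L\<^sub>2\<close> norm, and \<open>a\<close> is any inner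
  product whose norm is equivalent to \<open>q\<close>.
\<close>

theorem adjoint_of_embedding:
  assumes complete: "\<And>x. \<lbrakk>\<And>n. x n \<in> X; \<And>e. e > 0 \<Longrightarrow> \<exists>N. \<forall>m\<ge>N. \<forall>n\<ge>N. q (cls_diff \<Omega> (x m) (x n)) < e\<rbrakk>
                    \<Longrightarrow> \<exists>z\<in>X. (\<lambda>n::nat. q (cls_diff \<Omega> (x n) z)) \<longlonglongrightarrow> 0"
    and L2_le: "\<And>v. v \<in> X \<Longrightarrow> L2_norm \<Omega> v \<le> q v"
    and adm: "admissible_inner_product \<Omega> X q a"
    and u: "u \<in> L2 \<Omega>"
    and Eadj: "Eadj = hilbert_adjoint X a (L2 \<Omega>) (L2_inner \<Omega>) (embedding X)"
  shows "Eadj u \<in> X \<and> (\<forall>v\<in>X. a (Eadj u) v = L2_inner \<Omega> u v) \<and>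
         (\<forall>z\<in>X. (\<forall>v\<in>X. a z v = L2_inner \<Omega> u v) \<longrightarrow> z = Eadj u)"
proof -
  have ip: "inner_product_on \<Omega> X a"
    using adm by (simp add: admissible_inner_product_def)
  interpret A: carrier_inner X "cls_add \<Omega>" "cls_scale \<Omega>" a
    by (rule admissible_carrier_inner[OF ip])
  have sub: "A.sub u v = cls_diff \<Omega> u v" if "u \<in> X" "v \<in> X" for u v
    using that by (simp add: A.sub_def cls_diff_eq mem_L2)
  from adm obtain c C where cC: "c > 0" "C > 0"
    and le: "\<And>v. v \<in> X \<Longrightarrow> c * q v \<le> A.nrm v" "\<And>v. v \<in> X \<Longrightarrow> A.nrm v \<le> C * q v"
    by (auto simp: admissible_inner_product_def equivalent_norms_on_def A.nrm_def)
  have A_complete: "\<exists>z\<in>X. (\<lambda>n::nat. A.nrm (A.sub (x n) z)) \<longlonglongrightarrow> 0"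
    if x: "\<And>n. x n \<in> X" and Cau: "\<And>e. e > 0 \<Longrightarrow> \<exists>N. \<forall>m\<ge>N. \<forall>n\<ge>N. A.nrm (A.sub (x m) (x n)) < e" for x
  proof -
    have "\<exists>N. \<forall>m\<ge>N. \<forall>n\<ge>N. q (cls_diff \<Omega> (x m) (x n)) < e" if "e > 0" for e
    proof -
      obtain N where N: "\<And>m n. \<lbrakk>m \<ge> N; n \<ge> N\<rbrakk> \<Longrightarrow> A.nrm (A.sub (x m) (x n)) < c * e"
        using Cau[of "c * e"] cC \<open>e > 0\<close> by auto
      have "q (cls_diff \<Omega> (x m) (x n)) < e" if "m \<ge> N" "n \<ge> N" for m n
      proof -
        have "c * q (cls_diff \<Omega> (x m) (x n)) < c * e"
          using N[OF that] le(1)[OF diff_mem[OF x x], of m n] by (simp add: sub x)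
        then show ?thesis using cC by simp
      qed
      then show ?thesis by blast
    qed
    from complete[OF x this] obtain z where z: "z \<in> X" "(\<lambda>n. q (cls_diff \<Omega> (x n) z)) \<longlonglongrightarrow> 0" by blast
    have "(\<lambda>n. A.nrm (A.sub (x n) z)) \<longlonglongrightarrow> 0"
    proof (rule Lim_null_comparison)
      show "\<forall>\<^sub>F n in sequentially. norm (A.nrm (A.sub (x n) z)) \<le> C * q (cls_diff \<Omega> (x n) z)"
        using le(2)[OF diff_mem[OF x z(1)]] A.nrm_nonneg[OF diff_mem[OF x z(1)]]
        by (simp add: sub x z(1))
      show "(\<lambda>n. C * q (cls_diff \<Omega> (x n) z)) \<longlonglongrightarrow> 0"
        using tendsto_mult_left[OF z(2), of C] by simp
    qed
    then show ?thesis using z by blast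
  qed
  have ex: "\<exists>z\<in>X. \<forall>v\<in>X. a z v = L2_inner \<Omega> w v" if w: "w \<in> L2 \<Omega>" for w
  proof (rule A.Riesz_representation[OF A_complete])
    fix u v assume "u \<in> X" "v \<in> X"
    then show "L2_inner \<Omega> w (cls_add \<Omega> u v) = L2_inner \<Omega> w u + L2_inner \<Omega> w v"
      using w mem_L2 L2.ip_add_right by blast
  next
    fix c v assume "v \<in> X"
    then show "L2_inner \<Omega> w (cls_scale \<Omega> c v) = cnj c * L2_inner \<Omega> w v"
      using w mem_L2 L2.ip_scale_right by blast
  next
    fix v assume v: "v \<in> X"
    have "cmod (L2_inner \<Omega> w v) \<le> L2_norm \<Omega> w * L2_norm \<Omega> v"
      using L2.Cauchy_Schwarz w v mem_L2 by blast
    also have "\<dots> \<le> L2_norm \<Omega> w * (A.nrm v / c)"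
    proof (rule mult_left_mono)
      show "L2_norm \<Omega> v \<le> A.nrm v / c"
        using L2_le[OF v] le(1)[OF v] cC by (simp add: field_simps) (smt (verit) mult_left_mono)
      show "0 \<le> L2_norm \<Omega> w" using w by (rule L2.nrm_nonneg)
    qed
    finally show "cmod (L2_inner \<Omega> w v) \<le> (L2_norm \<Omega> w / c) * A.nrm v" by simp
  qed auto
  have uniq: "z = z'" if z: "z \<in> X" "z' \<in> X" and eq: "\<And>v. v \<in> X \<Longrightarrow> a z v = a z' v" for z z'
  proof -
    have "a (cls_diff \<Omega> z z') (cls_diff \<Omega> z z') = 0"
      using A.ip_sub[of z z' "cls_diff \<Omega> z z'"] eq z diff_mem by (simp add: sub)
    then have "\<not> 0 < Re (a (cls_diff \<Omega> z z') (cls_diff \<Omega> z z'))" by simp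
    then have "cls_diff \<Omega> z z' = cls_zero \<Omega>"
      using ip diff_mem[OF z] unfolding inner_product_on_def by blast
    then show ?thesis using cls_diff_eq_zero z mem_L2 by blast
  qed
  \<comment> \<open>\<open>B\<close> is the only function satisfying the description by which the adjoint is defined.\<close>
  define B where "B = (\<lambda>w\<in>L2 \<Omega>. SOME z. z \<in> X \<and> (\<forall>v\<in>X. a z v = L2_inner \<Omega> w v))"
  have B: "B w \<in> X \<and> (\<forall>v\<in>X. a (B w) v = L2_inner \<Omega> w v)" if "w \<in> L2 \<Omega>" for w
    unfolding B_def using that someI_ex[OF ex[OF that, unfolded Bex_def]] by simp
  have "Eadj = B"
    unfolding Eadj hilbert_adjoint_def
  proof (rule the_equality)
    show "B \<in> L2 \<Omega> \<rightarrow>\<^sub>E X \<and> (\<forall>u\<in>L2 \<Omega>. \<forall>v\<in>X. a (B u) v = L2_inner \<Omega> u (embedding X v))"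
      using B by (auto simp: B_def embedding_def)
  next
    fix B' assume B': "B' \<in> L2 \<Omega> \<rightarrow>\<^sub>E X \<and> (\<forall>u\<in>L2 \<Omega>. \<forall>v\<in>X. a (B' u) v = L2_inner \<Omega> u (embedding X v))"
    show "B' = B"
    proof (rule PiE_ext)
      show "B' \<in> L2 \<Omega> \<rightarrow>\<^sub>E X" "B \<in> L2 \<Omega> \<rightarrow>\<^sub>E X" using B B' by (auto simp: B_def)
      fix w assume w: "w \<in> L2 \<Omega>"
      show "B' w = B w"
        by (rule uniq) (use B[OF w] B' w in \<open>auto simp: embedding_def\<close>)
    qed
  qed
  then show ?thesis
    using B[OF u] uniq by metis
qed

end

text \<open>
  A domain \<open>X\<close> with finitely many operators \<open>T i\<close> from \<open>X\<close> to \<open>L\<^sub>2\<close> that are jointly closed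
  (assumption \<open>T_closed\<close>) and whose graph norm dominates the \<open>L\<^sub>2\<close> norm.
\<close>

locale graph_space = L2_subspace \<Omega> X for \<Omega> :: "(real^'n::finite) set" and X +
  fixes A :: "'i set" and T :: "'i \<Rightarrow> 'n fn set \<Rightarrow> 'n fn set"
  assumes finite_A: "finite A"
    and T_L2: "\<lbrakk>i \<in> A; u \<in> X\<rbrakk> \<Longrightarrow> T i u \<in> L2 \<Omega>"
    and T_add: "\<lbrakk>i \<in> A; u \<in> X; v \<in> X\<rbrakk> \<Longrightarrow> T i (cls_add \<Omega> u v) = cls_add \<Omega> (T i u) (T i v)"
    and T_scale: "\<lbrakk>i \<in> A; u \<in> X\<rbrakk> \<Longrightarrow> T i (cls_scale \<Omega> c u) = cls_scale \<Omega> c (T i u)"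
    and L2_norm_le: "u \<in> X \<Longrightarrow> (L2_norm \<Omega> u)\<^sup>2 \<le> (\<Sum>i\<in>A. (L2_norm \<Omega> (T i u))\<^sup>2)"
    and T_closed: "\<lbrakk>\<And>n::nat. x n \<in> X; w \<in> L2 \<Omega>; (\<lambda>n. L2_dist \<Omega> (x n) w) \<longlonglongrightarrow> 0;
        \<And>i. i \<in> A \<Longrightarrow> y i \<in> L2 \<Omega>; \<And>i. i \<in> A \<Longrightarrow> (\<lambda>n. L2_dist \<Omega> (T i (x n)) (y i)) \<longlonglongrightarrow> 0\<rbrakk>
        \<Longrightarrow> w \<in> X \<and> (\<forall>i\<in>A. T i w = y i)"
begin

text \<open>
  The graph norm. It does not contain \<open>\<parallel>u\<parallel>\<close> itself, which is dominated by assumption.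
\<close>

definition gnorm :: "'n fn set \<Rightarrow> real" where
  "gnorm u = sqrt (\<Sum>i\<in>A. (L2_norm \<Omega> (T i u))\<^sup>2)"

lemma T_diff: "\<lbrakk>i \<in> A; u \<in> X; v \<in> X\<rbrakk> \<Longrightarrow> T i (cls_diff \<Omega> u v) = cls_diff \<Omega> (T i u) (T i v)"
  by (simp add: cls_diff_eq mem_L2 T_L2 T_add T_scale scale_mem)

sublocale G: carrier_inner X "cls_add \<Omega>" "cls_scale \<Omega>" "\<lambda>u v. \<Sum>i\<in>A. L2_inner \<Omega> (T i u) (T i v)"
proof
  show "X \<noteq> {}" using zero_mem by blast
next
  fix u v w assume "u \<in> X" "v \<in> X" "w \<in> X"
  then show "(\<Sum>i\<in>A. L2_inner \<Omega> (T i (cls_add \<Omega> u v)) (T i w)) =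
       (\<Sum>i\<in>A. L2_inner \<Omega> (T i u) (T i w)) + (\<Sum>i\<in>A. L2_inner \<Omega> (T i v) (T i w))"
    by (simp add: T_add T_L2 L2.ip_add flip: sum.distrib)
next
  fix u v c assume uv: "u \<in> X" "v \<in> X"
  then show "(\<Sum>i\<in>A. L2_inner \<Omega> (T i (cls_scale \<Omega> c u)) (T i v)) = c * (\<Sum>i\<in>A. L2_inner \<Omega> (T i u) (T i v))"
    by (simp add: T_scale T_L2 L2.ip_scale flip: sum_distrib_left)
  show "(\<Sum>i\<in>A. L2_inner \<Omega> (T i v) (T i u)) = cnj (\<Sum>i\<in>A. L2_inner \<Omega> (T i u) (T i v))"
    unfolding cnj_sum by (intro sum.cong refl L2.ip_sym T_L2 uv)
next
  fix u assume "u \<in> X"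
  then show "0 \<le> Re (\<Sum>i\<in>A. L2_inner \<Omega> (T i u) (T i u))"
    by (auto simp: T_L2 L2.ip_nonneg intro: sum_nonneg)
qed (auto intro: add_mem scale_mem)

lemma gnorm_eq: "u \<in> X \<Longrightarrow> G.nrm u = gnorm u"
  by (simp add: G.nrm_def gnorm_def L2.nrm_sq T_L2)

lemma sub_eq: "\<lbrakk>u \<in> X; v \<in> X\<rbrakk> \<Longrightarrow> G.sub u v = cls_diff \<Omega> u v"
  by (simp add: G.sub_def cls_diff_eq mem_L2)

lemma L2_norm_le_gnorm: "u \<in> X \<Longrightarrow> L2_norm \<Omega> u \<le> gnorm u"
  unfolding gnorm_def using L2_norm_le by (simp add: real_le_rsqrt)

lemma L2_norm_T_le_gnorm:
  assumes "u \<in> X" "i \<in> A" shows "L2_norm \<Omega> (T i u) \<le> gnorm u"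
  unfolding gnorm_def
  by (rule real_le_rsqrt) (rule member_le_sum[OF assms(2), of "\<lambda>i. (L2_norm \<Omega> (T i u))\<^sup>2"], use finite_A in auto)

theorem gnorm_complete:
  assumes u: "\<And>n. u n \<in> X"
    and Cauchy: "\<And>e. e > 0 \<Longrightarrow> \<exists>N. \<forall>m\<ge>N. \<forall>n\<ge>N. gnorm (cls_diff \<Omega> (u m) (u n)) < e"
  shows "\<exists>z\<in>X. (\<lambda>n::nat. gnorm (cls_diff \<Omega> (u n) z)) \<longlonglongrightarrow> 0"
proof -
  note du = diff_mem[OF u u]
  have "\<exists>w\<in>L2 \<Omega>. (\<lambda>n. L2_dist \<Omega> (u n) w) \<longlonglongrightarrow> 0"
  proof (rule L2_complete)
    show "u n \<in> L2 \<Omega>" for n using u mem_L2 by blast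
    show "\<exists>N. \<forall>m\<ge>N. \<forall>n\<ge>N. L2_dist \<Omega> (u m) (u n) < e" if "e > 0" for e
      using Cauchy[OF that] L2_norm_le_gnorm[OF du] le_less_trans by blast
  qed
  then obtain w where w: "w \<in> L2 \<Omega>" "(\<lambda>n. L2_dist \<Omega> (u n) w) \<longlonglongrightarrow> 0" by blast
  have "\<exists>v\<in>L2 \<Omega>. (\<lambda>n. L2_dist \<Omega> (T i (u n)) v) \<longlonglongrightarrow> 0" if i: "i \<in> A" for i
  proof (rule L2_complete)
    show "T i (u n) \<in> L2 \<Omega>" for n using u T_L2[OF i] by blast
    show "\<exists>N. \<forall>m\<ge>N. \<forall>n\<ge>N. L2_dist \<Omega> (T i (u m)) (T i (u n)) < e" if "e > 0" for e
      using Cauchy[OF that] L2_norm_T_le_gnorm[OF du i] le_less_trans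
      unfolding T_diff[OF i u u] by blast
  qed
  then obtain v where v: "\<And>i. i \<in> A \<Longrightarrow> v i \<in> L2 \<Omega>"
      "\<And>i. i \<in> A \<Longrightarrow> (\<lambda>n. L2_dist \<Omega> (T i (u n)) (v i)) \<longlonglongrightarrow> 0"
    by metis
  have w': "w \<in> X" "\<And>i. i \<in> A \<Longrightarrow> T i w = v i"
    using T_closed[OF u w v] by auto
  have "(\<lambda>n. gnorm (cls_diff \<Omega> (u n) w)) \<longlonglongrightarrow> sqrt (\<Sum>i\<in>A. 0\<^sup>2)"
    unfolding gnorm_def
  proof (intro tendsto_intros)
    fix i assume i: "i \<in> A"
    show "(\<lambda>n. L2_norm \<Omega> (T i (cls_diff \<Omega> (u n) w))) \<longlonglongrightarrow> 0"
      using v(2)[OF i] by (simp add: T_diff i u w')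
  qed
  then show ?thesis using w'(1) by auto
qed

lemma adjoint_of_graph_embedding:
  assumes "admissible_inner_product \<Omega> X gnorm a" "u \<in> L2 \<Omega>"
    and "Eadj = hilbert_adjoint X a (L2 \<Omega>) (L2_inner \<Omega>) (embedding X)"
  shows "Eadj u \<in> X \<and> (\<forall>v\<in>X. a (Eadj u) v = L2_inner \<Omega> u v) \<and>
         (\<forall>z\<in>X. (\<forall>v\<in>X. a z v = L2_inner \<Omega> u v) \<longrightarrow> z = Eadj u)"
  by (rule adjoint_of_embedding[OF gnorm_complete L2_norm_le_gnorm assms])

text \<open>A subspace \<open>Y\<close> of \<open>X\<close> that is closed in the graph norm inherits completeness.\<close>

lemma adjoint_of_closed_subspace_embedding:
  assumes "L2_subspace \<Omega> Y" "Y \<subseteq> X"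
    and closed: "\<And>z. \<lbrakk>z \<in> X; \<And>e. e > 0 \<Longrightarrow> \<exists>y\<in>Y. gnorm (cls_diff \<Omega> z y) < e\<rbrakk> \<Longrightarrow> z \<in> Y"
    and "admissible_inner_product \<Omega> Y gnorm a" "u \<in> L2 \<Omega>"
    and "Eadj = hilbert_adjoint Y a (L2 \<Omega>) (L2_inner \<Omega>) (embedding Y)"
  shows "Eadj u \<in> Y \<and> (\<forall>v\<in>Y. a (Eadj u) v = L2_inner \<Omega> u v) \<and>
         (\<forall>z\<in>Y. (\<forall>v\<in>Y. a z v = L2_inner \<Omega> u v) \<longrightarrow> z = Eadj u)"
proof (rule L2_subspace.adjoint_of_embedding[OF assms(1) _ _ assms(4-6)])
  show "L2_norm \<Omega> v \<le> gnorm v" if "v \<in> Y" for v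
    using that assms(2) L2_norm_le_gnorm by blast
  fix x :: "nat \<Rightarrow> 'n fn set"
  assume x: "\<And>n. x n \<in> Y" and "\<And>e. e > 0 \<Longrightarrow> \<exists>N. \<forall>m\<ge>N. \<forall>n\<ge>N. gnorm (cls_diff \<Omega> (x m) (x n)) < e"
  then obtain z where z: "z \<in> X" "(\<lambda>n. gnorm (cls_diff \<Omega> (x n) z)) \<longlonglongrightarrow> 0"
    using gnorm_complete[of x] assms(2) by blast
  have "z \<in> Y"
  proof (rule closed[OF z(1)])
    fix e :: real assume "e > 0"
    then have "eventually (\<lambda>n. gnorm (cls_diff \<Omega> (x n) z) < e) sequentially"
      using z(2) order_tendstoD(2) by blast
    then obtain n where "gnorm (cls_diff \<Omega> (x n) z) < e"
      using eventually_happens'[OF sequentially_bot] by blast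
    moreover have xX: "x n \<in> X" using x assms(2) by blast
    have "gnorm (cls_diff \<Omega> z (x n)) = gnorm (cls_diff \<Omega> (x n) z)"
      using G.nrm_sub_comm[OF z(1) xX] by (simp add: sub_eq gnorm_eq diff_mem z(1) xX)
    ultimately show "\<exists>y\<in>Y. gnorm (cls_diff \<Omega> z y) < e" using x by metis
  qed
  then show "\<exists>z\<in>Y. (\<lambda>n. gnorm (cls_diff \<Omega> (x n) z)) \<longlonglongrightarrow> 0" using z by blast
qed

end

section \<open>Test functions\<close>

lemma iter_partial_Nil: "iter_partial [] f = f"
  and iter_partial_Cons: "iter_partial (i # w) f = partial_deriv i (iter_partial w f)"
  and iter_partial_append: "iter_partial (v @ w) f = iter_partial v (iter_partial w f)"
  by (simp_all add: iter_partial_def)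

text \<open>
  A set of continuous functions that is closed under taking partial derivatives consists of smooth
  functions.
\<close>

lemma smooth_coinduct:
  assumes "f \<in> A"
    and "\<And>g. g \<in> A \<Longrightarrow> continuous_on UNIV g"
    and "\<And>g i. g \<in> A \<Longrightarrow>
           \<exists>h\<in>A. \<forall>x. ((\<lambda>t. g (x + t *\<^sub>R axis i 1)) has_vector_derivative h x) (at 0)"
  shows "smooth f"
proof -
  have *: "iter_partial w f \<in> A" for w
  proof (induction w)
    case Nil
    then show ?case using assms(1) by (simp add: iter_partial_Nil)
  next
    case (Cons i w)
    obtain h where h: "h \<in> A" "\<And>x. ((\<lambda>t. iter_partial w f (x + t *\<^sub>R axis i 1)) has_vector_derivative h x) (at 0)"
      using assms(3)[OF Cons.IH, of i] by blast
    have "partial_deriv i (iter_partial w f) = h"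
      using h(2) by (auto simp: partial_deriv_def vector_derivative_at)
    then show ?case using h(1) by (simp add: iter_partial_Cons)
  qed
  show ?thesis
    unfolding smooth_def using assms(2,3)[OF *] by (blast intro: differentiableI_vector)
qed

lemma smooth_continuous: "smooth f \<Longrightarrow> continuous_on UNIV f"
  by (metis smooth_def iter_partial_Nil)

lemma smooth_has_partial_deriv:
  assumes "smooth f"
  shows "((\<lambda>t. f (x + t *\<^sub>R axis i 1)) has_vector_derivative partial_deriv i f x) (at 0)"
proof -
  have "(\<lambda>t. f (x + t *\<^sub>R axis i 1)) differentiable (at 0)"
    using assms unfolding smooth_def by (metis iter_partial_Nil)
  then show ?thesis unfolding partial_deriv_def by (simp add: vector_derivative_works)
qed

lemma smooth_partial_deriv: "smooth f \<Longrightarrow> smooth (partial_deriv i f)"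
  unfolding smooth_def by (metis iter_partial_append iter_partial_Cons iter_partial_Nil)

lemma smooth_lincomb:
  assumes "smooth f" "smooth g"
  shows "smooth (\<lambda>x. c * f x + d * g x)"
proof (rule smooth_coinduct[where A="{\<lambda>x. c * f x + d * g x |f g. smooth f \<and> smooth g}"])
  fix h i assume "h \<in> {\<lambda>x. c * f x + d * g x |f g. smooth f \<and> smooth g}"
  then obtain f g where h: "h = (\<lambda>x. c * f x + d * g x)" "smooth f" "smooth g" by blast
  show "continuous_on UNIV h"
    unfolding h(1) by (intro continuous_intros smooth_continuous h)
  show "\<exists>k\<in>{\<lambda>x. c * f x + d * g x |f g. smooth f \<and> smooth g}.
           \<forall>x. ((\<lambda>t. h (x + t *\<^sub>R axis i 1)) has_vector_derivative k x) (at 0)"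
  proof (intro bexI allI)
    show "(\<lambda>x. c * partial_deriv i f x + d * partial_deriv i g x) \<in> {\<lambda>x. c * f x + d * g x |f g. smooth f \<and> smooth g}"
      using h smooth_partial_deriv by blast
    show "((\<lambda>t. h (x + t *\<^sub>R axis i 1)) has_vector_derivative c * partial_deriv i f x + d * partial_deriv i g x) (at 0)" for x
      unfolding h(1) by (intro derivative_intros has_vector_derivative_mult_right smooth_has_partial_deriv h)
  qed
qed (use assms in blast)

lemma test_functions_D:
  assumes "\<phi> \<in> test_functions \<Omega>"
  obtains K where "compact K" "K \<subseteq> \<Omega>" "\<And>x. x \<notin> K \<Longrightarrow> \<phi> x = 0" "smooth \<phi>"
proof (rule that[of "closure {x. \<phi> x \<noteq> 0}"])
  show "\<phi> x = 0" if "x \<notin> closure {x. \<phi> x \<noteq> 0}" for x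
    using that subsetD[OF closure_subset, of x "{x. \<phi> x \<noteq> 0}"] by auto
qed (use assms in \<open>simp_all add: test_functions_def\<close>)

lemma test_functions_I:
  assumes "smooth \<phi>" "compact K" "K \<subseteq> \<Omega>" "\<And>x. x \<notin> K \<Longrightarrow> \<phi> x = 0"
  shows "\<phi> \<in> test_functions \<Omega>"
proof -
  have "{x. \<phi> x \<noteq> 0} \<subseteq> K" using assms(4) by blast
  then have "closure {x. \<phi> x \<noteq> 0} \<subseteq> K"
    using assms(2) by (simp add: closure_minimal compact_imp_closed)
  moreover have "bounded {x. \<phi> x \<noteq> 0}"
    using \<open>{x. \<phi> x \<noteq> 0} \<subseteq> K\<close> assms(2) bounded_subset compact_imp_bounded by blast
  ultimately show ?thesis
    using assms(1,3) by (auto simp: test_functions_def compact_closure)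
qed

lemma test_functions_lincomb:
  assumes "\<phi> \<in> test_functions \<Omega>" "\<psi> \<in> test_functions \<Omega>"
  shows "(\<lambda>x. c * \<phi> x + d * \<psi> x) \<in> test_functions \<Omega>"
proof -
  obtain K where K: "compact K" "K \<subseteq> \<Omega>" "\<And>x. x \<notin> K \<Longrightarrow> \<phi> x = 0" "smooth \<phi>"
    by (rule test_functions_D[OF assms(1)]) blast
  obtain L where L: "compact L" "L \<subseteq> \<Omega>" "\<And>x. x \<notin> L \<Longrightarrow> \<psi> x = 0" "smooth \<psi>"
    by (rule test_functions_D[OF assms(2)]) blast
  show ?thesis
    by (rule test_functions_I[of _ "K \<union> L"]) (use K L in \<open>auto intro: smooth_lincomb\<close>)
qed

lemma test_functions_partial_deriv:
  assumes "\<phi> \<in> test_functions \<Omega>"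
  shows "partial_deriv i \<phi> \<in> test_functions \<Omega>"
proof -
  obtain K where K: "compact K" "K \<subseteq> \<Omega>" "\<And>x. x \<notin> K \<Longrightarrow> \<phi> x = 0" "smooth \<phi>"
    by (rule test_functions_D[OF assms]) blast
  show ?thesis
  proof (rule test_functions_I[OF smooth_partial_deriv[OF K(4)] K(1,2)])
    fix x assume "x \<notin> K"
    then have "\<forall>\<^sub>F t in nhds 0. x + t *\<^sub>R axis i 1 \<notin> K"
    proof -
      have "open (- K)" using K(1) by (simp add: compact_imp_closed open_Compl)
      moreover have "((\<lambda>t::real. x + t *\<^sub>R axis i 1) \<longlongrightarrow> x + 0 *\<^sub>R axis i 1) (nhds 0)"
        by (intro tendsto_intros filterlim_ident)
      ultimately show ?thesis
        using \<open>x \<notin> K\<close> topological_tendstoD[of "\<lambda>t::real. x + t *\<^sub>R axis i 1" x "nhds 0" "- K"] by simp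
    qed
    then have "\<forall>\<^sub>F t in nhds 0. \<phi> (x + t *\<^sub>R axis i 1) = 0"
      by eventually_elim (use K(3) in blast)
    then have "((\<lambda>t. \<phi> (x + t *\<^sub>R axis i 1)) has_vector_derivative 0) (at 0)"
      using has_vector_derivative_const[of 0 "at 0"]
      by (subst has_vector_derivative_cong_ev[where g="\<lambda>t. 0"]) (use K(3) \<open>x \<notin> K\<close> in auto)
    then show "partial_deriv i \<phi> x = 0"
      by (simp add: partial_deriv_def vector_derivative_at)
  qed
qed

lemma test_functions_iter_partial:
  "\<phi> \<in> test_functions \<Omega> \<Longrightarrow> iter_partial w \<phi> \<in> test_functions \<Omega>"
  by (induction w) (simp_all add: iter_partial_Nil iter_partial_Cons test_functions_partial_deriv)

lemma test_functions_multi_deriv: "\<phi> \<in> test_functions \<Omega> \<Longrightarrow> multi_deriv \<alpha> \<phi> \<in> test_functions \<Omega>"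
  by (simp add: multi_deriv_def test_functions_iter_partial)

lemma multi_deriv_zero:
  fixes f :: "'n::finite fn"
  shows "multi_deriv (\<lambda>_. 0) f = f"
proof -
  have "(SOME w :: 'n list. \<forall>i. count_list w i = 0) = []"
    by (rule some_equality) (auto, metis count_list_0_iff list.set_intros(1) neq_Nil_conv)
  then show ?thesis by (simp add: multi_deriv_def iter_partial_Nil)
qed

lemma test_functions_square_integrable:
  fixes \<Omega> :: "(real^'n::finite) set"
  assumes "open \<Omega>" "\<phi> \<in> test_functions \<Omega>"
  shows "square_integrable \<Omega> \<phi>"
proof -
  obtain K where K: "compact K" "K \<subseteq> \<Omega>" "\<And>x. x \<notin> K \<Longrightarrow> \<phi> x = 0" "smooth \<phi>"
    by (rule test_functions_D[OF assms(2)]) blast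
  have sets: "\<Omega> \<in> sets lebesgue" "K \<in> sets lebesgue"
    using assms(1) K(1) by (auto simp: compact_imp_closed)
  have meas: "\<phi> \<in> borel_measurable (lebesgue_on \<Omega>)"
    using smooth_continuous[OF K(4)] sets(1) continuous_on_subset
    by (blast intro: continuous_imp_measurable_on_sets_lebesgue)
  have "compact (\<phi> ` K)"
    using smooth_continuous[OF K(4)] K(1) compact_continuous_image continuous_on_subset by blast
  then obtain B where B: "\<And>x. x \<in> K \<Longrightarrow> cmod (\<phi> x) \<le> B"
    using compact_imp_bounded bounded_iff by (metis image_eqI)
  have "integrable (lebesgue_on \<Omega>) (\<lambda>x. B\<^sup>2 * indicator K x)"
  proof -
    have "emeasure (lebesgue_on \<Omega>) K = emeasure lebesgue K"
      using sets K(2) by (intro emeasure_restrict_space) auto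
    moreover have "emeasure lebesgue K < \<infinity>"
      using lmeasurable_compact[OF K(1)] unfolding fmeasurable_def by blast
    ultimately have "emeasure (lebesgue_on \<Omega>) K < \<infinity>" by (rule ord_eq_less_trans)
    moreover have "K \<in> sets (lebesgue_on \<Omega>)"
      using sets K(2) by (simp add: sets_restrict_space_iff)
    ultimately show ?thesis by (intro integrable_mult_right integrable_real_indicator)
  qed
  then have "integrable (lebesgue_on \<Omega>) (\<lambda>x. (cmod (\<phi> x))\<^sup>2)"
  proof (rule Bochner_Integration.integrable_bound)
    show "AE x in lebesgue_on \<Omega>. norm ((cmod (\<phi> x))\<^sup>2) \<le> norm (B\<^sup>2 * indicator K x)"
    proof (intro AE_I2)
      fix x show "norm ((cmod (\<phi> x))\<^sup>2) \<le> norm (B\<^sup>2 * indicator K x)"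
        by (cases "x \<in> K") (use B K(3) in \<open>auto intro: power_mono\<close>)
    qed
  qed (use meas in measurable)
  then show ?thesis using meas by (simp add: square_integrable_def)
qed

section \<open>Bump functions\<close>

text \<open>
  The functions \<open>p (1/t) exp (-1/t)\<close> for a polynomial \<open>p\<close>, extended by zero to \<open>t \<le> 0\<close>. This class is
  closed under differentiation; \<open>flat_exp_deriv\<close> gives the polynomial of the derivative.
\<close>

definition flat_exp :: "real poly \<Rightarrow> real \<Rightarrow> real" where
  "flat_exp p t = (if t > 0 then poly p (1 / t) * exp (- (1 / t)) else 0)"

definition flat_exp_deriv :: "real poly \<Rightarrow> real poly" where
  "flat_exp_deriv p = [:0, 0, 1:] * (p - pderiv p)"

lemma tendsto_poly_mult_exp_minus: "((\<lambda>y. poly p y * exp (- y)) \<longlongrightarrow> (0::real)) at_top"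
proof -
  have "((\<lambda>y. \<Sum>i\<le>degree p. coeff p i * (y ^ i / exp y)) \<longlongrightarrow> (\<Sum>i\<le>degree p. coeff p i * 0)) at_top"
    by (intro tendsto_intros tendsto_power_div_exp_0)
  moreover have "(\<Sum>i\<le>degree p. coeff p i * (y ^ i / exp y)) = poly p y * exp (- y)" for y :: real
    by (simp add: poly_altdef sum_distrib_right exp_minus divide_inverse mult.assoc)
  ultimately show ?thesis by simp
qed

lemma flat_exp_has_derivative: "(flat_exp p has_real_derivative flat_exp (flat_exp_deriv p) t) (at t)"
proof (cases t "0::real" rule: linorder_cases)
  case less
  have "((\<lambda>t. 0) has_real_derivative 0) (at t)" by simp
  then have "(flat_exp p has_real_derivative 0) (at t)"
    by (rule has_field_derivative_transform_within_open[where S="{..<0}"]) (use less in \<open>auto simp: flat_exp_def\<close>)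
  then show ?thesis using less by (simp add: flat_exp_def)
next
  case greater
  have "((\<lambda>t. poly p (1 / t) * exp (- (1 / t))) has_real_derivative flat_exp (flat_exp_deriv p) t) (at t)"
    using greater
    by (auto simp: flat_exp_def flat_exp_deriv_def field_simps power2_eq_square intro!: derivative_eq_intros DERIV_chain2[OF poly_DERIV])
  then show ?thesis
    by (rule has_field_derivative_transform_within_open[where S="{0<..}"]) (use greater in \<open>auto simp: flat_exp_def\<close>)
next
  case equal
  have "((\<lambda>h. flat_exp p h / h) \<longlongrightarrow> 0) (at 0)"
  proof (rule filterlim_split_at)
    have "\<forall>\<^sub>F h in at_left (0::real). flat_exp p h / h = 0"
      by (simp add: eventually_at_filter flat_exp_def)
    then show "((\<lambda>h. flat_exp p h / h) \<longlongrightarrow> 0) (at_left 0)"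
      by (rule tendsto_eventually)
    have "((\<lambda>h. poly (pCons 0 p) (inverse h) * exp (- inverse h)) \<longlongrightarrow> 0) (at_right (0::real))"
      by (rule filterlim_compose[OF tendsto_poly_mult_exp_minus filterlim_inverse_at_top_right])
    moreover have "\<forall>\<^sub>F h in at_right (0::real). poly (pCons 0 p) (inverse h) * exp (- inverse h) = flat_exp p h / h"
      by (simp add: eventually_at_filter flat_exp_def field_simps)
    ultimately show "((\<lambda>h. flat_exp p h / h) \<longlongrightarrow> 0) (at_right 0)"
      by (rule Lim_transform_eventually)
  qed
  then have "(flat_exp p has_real_derivative 0) (at 0)"
    by (simp add: DERIV_def flat_exp_def)
  then show ?thesis using equal by (simp add: flat_exp_def)
qed

lemma flat_exp_one: "flat_exp 1 t = (if t > 0 then exp (- (1 / t)) else 0)"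
  by (simp add: flat_exp_def)

text \<open>
  The algebra generated by the constants and the functions \<open>flat_exp\<close> of affine functions of a single
  coordinate. It is closed under partial derivatives, so it consists of smooth functions.
\<close>

inductive_set bump_algebra :: "(real^'n::finite \<Rightarrow> complex) set" where
  base: "(\<lambda>x. of_real (flat_exp p (c * x $ i + d))) \<in> bump_algebra"
| const: "(\<lambda>x. c) \<in> bump_algebra"
| add: "f \<in> bump_algebra \<Longrightarrow> g \<in> bump_algebra \<Longrightarrow> (\<lambda>x. f x + g x) \<in> bump_algebra"
| mult: "f \<in> bump_algebra \<Longrightarrow> g \<in> bump_algebra \<Longrightarrow> (\<lambda>x. f x * g x) \<in> bump_algebra"

lemma flat_exp_continuous: "continuous_on UNIV (flat_exp p)"
  using flat_exp_has_derivative by (meson DERIV_continuous_on has_field_derivative_at_within)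

lemma bump_algebra_continuous: "f \<in> bump_algebra \<Longrightarrow> continuous_on UNIV f"
proof (induction rule: bump_algebra.induct)
  case (base p c i d)
  have "continuous_on UNIV (\<lambda>x::real^'a. flat_exp p (c * x $ i + d))"
    by (rule continuous_on_compose2[OF flat_exp_continuous]) (auto intro!: continuous_intros)
  then show ?case by (intro continuous_intros)
qed (auto intro!: continuous_intros)

lemma bump_algebra_deriv:
  "f \<in> bump_algebra \<Longrightarrow>
    \<exists>g\<in>bump_algebra. \<forall>x. ((\<lambda>t. f (x + t *\<^sub>R axis j 1)) has_vector_derivative g x) (at 0)"
proof (induction rule: bump_algebra.induct)
  case (base p c i d)
  define e :: real where "e = (if i = j then c else 0)"
  show ?case
  proof (intro bexI allI)
    show "(\<lambda>x. of_real e * of_real (flat_exp (flat_exp_deriv p) (c * x $ i + d))) \<in> bump_algebra"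
      by (intro bump_algebra.intros)
    fix x :: "real^'a"
    have eq: "c * (x + t *\<^sub>R axis j 1) $ i + d = (c * x $ i + d) + e * t" for t
      by (simp add: e_def axis_def algebra_simps)
    have "((\<lambda>t. flat_exp p ((c * x $ i + d) + e * t)) has_real_derivative flat_exp (flat_exp_deriv p) ((c * x $ i + d) + e * 0) * e) (at 0)"
      by (rule DERIV_chain2[OF flat_exp_has_derivative]) (auto intro!: derivative_eq_intros)
    then have "((\<lambda>t. flat_exp p ((c * x $ i + d) + e * t)) has_vector_derivative e * flat_exp (flat_exp_deriv p) (c * x $ i + d)) (at 0)"
      by (simp add: has_real_derivative_iff_has_vector_derivative mult.commute)
    then have "((\<lambda>t. complex_of_real (flat_exp p ((c * x $ i + d) + e * t))) has_vector_derivative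
        of_real (e * flat_exp (flat_exp_deriv p) (c * x $ i + d))) (at 0)"
      by (rule bounded_linear.has_vector_derivative[OF bounded_linear_of_real])
    then show "((\<lambda>t. complex_of_real (flat_exp p (c * (x + t *\<^sub>R axis j 1) $ i + d))) has_vector_derivative
        of_real e * of_real (flat_exp (flat_exp_deriv p) (c * x $ i + d))) (at 0)"
      unfolding eq by simp
  qed
next
  case (const c)
  show ?case by (intro bexI[of _ "\<lambda>x. 0"]) (auto intro: bump_algebra.const)
next
  case (add f g)
  then obtain f' g' where
    "f' \<in> bump_algebra" "\<And>x. ((\<lambda>t. f (x + t *\<^sub>R axis j 1)) has_vector_derivative f' x) (at 0)"
    "g' \<in> bump_algebra" "\<And>x. ((\<lambda>t. g (x + t *\<^sub>R axis j 1)) has_vector_derivative g' x) (at 0)"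
    by blast
  then show ?case
    by (intro bexI[of _ "\<lambda>x. f' x + g' x"]) (auto intro!: bump_algebra.add derivative_intros)
next
  case (mult f g)
  then obtain f' g' where
    d: "f' \<in> bump_algebra" "\<And>x. ((\<lambda>t. f (x + t *\<^sub>R axis j 1)) has_vector_derivative f' x) (at 0)"
    "g' \<in> bump_algebra" "\<And>x. ((\<lambda>t. g (x + t *\<^sub>R axis j 1)) has_vector_derivative g' x) (at 0)"
    by blast
  show ?case
  proof (intro bexI allI)
    show "(\<lambda>x. f x * g' x + f' x * g x) \<in> bump_algebra"
      using d mult by (intro bump_algebra.intros)
    show "((\<lambda>t. f (x + t *\<^sub>R axis j 1) * g (x + t *\<^sub>R axis j 1)) has_vector_derivative f x * g' x + f' x * g x) (at 0)" for x
      using has_vector_derivative_mult[OF d(2,4), of x x] by simp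
  qed
qed

lemma bump_algebra_smooth: "f \<in> bump_algebra \<Longrightarrow> smooth f"
  by (rule smooth_coinduct[of _ bump_algebra]) (auto intro: bump_algebra_continuous bump_algebra_deriv)

lemma bump_algebra_prod:
  "finite I \<Longrightarrow> (\<And>i. i \<in> I \<Longrightarrow> f i \<in> bump_algebra) \<Longrightarrow> (\<lambda>x. \<Prod>i\<in>I. f i x) \<in> bump_algebra"
  by (induction I rule: finite_induct) (auto intro: bump_algebra.intros)

text \<open>
  A smooth function with values in \<open>[0, 1]\<close> that vanishes off the open box between \<open>a\<close> and \<open>b\<close>. For
  \<open>n \<rightarrow> \<infinity>\<close> it tends pointwise to the indicator function of the box.
\<close>

definition box_bump :: "real^'n::finite \<Rightarrow> real^'n \<Rightarrow> nat \<Rightarrow> real^'n \<Rightarrow> real" where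
  "box_bump a b n x = (\<Prod>i\<in>UNIV. flat_exp 1 (real (Suc n) * (x $ i - a $ i)) * flat_exp 1 (real (Suc n) * (b $ i - x $ i)))"

lemma box_bump_smooth: "smooth (\<lambda>x. of_real (box_bump a b n x))"
proof (rule bump_algebra_smooth)
  have "(\<lambda>x. \<Prod>i\<in>UNIV. complex_of_real (flat_exp 1 (real (Suc n) * x $ i + (- real (Suc n) * a $ i))) *
     of_real (flat_exp 1 (- real (Suc n) * x $ i + real (Suc n) * b $ i))) \<in> bump_algebra"
    by (intro bump_algebra_prod bump_algebra.intros) auto
  moreover have "flat_exp 1 (real (Suc n) * x $ i + (- real (Suc n) * a $ i)) = flat_exp 1 (real (Suc n) * (x $ i - a $ i))"
    "flat_exp 1 (- real (Suc n) * x $ i + real (Suc n) * b $ i) = flat_exp 1 (real (Suc n) * (b $ i - x $ i))" for x i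
    by (simp_all add: algebra_simps)
  ultimately show "(\<lambda>x. complex_of_real (box_bump a b n x)) \<in> bump_algebra"
    unfolding box_bump_def of_real_prod of_real_mult by simp
qed

lemma flat_exp_one_bounds: "0 \<le> flat_exp 1 t" "flat_exp 1 t \<le> 1"
  by (auto simp: flat_exp_one)

lemma box_bump_bounds: "0 \<le> box_bump a b n x" "box_bump a b n x \<le> 1"
  unfolding box_bump_def
  by (auto intro!: prod_nonneg prod_le_1 mult_le_one mult_nonneg_nonneg flat_exp_one_bounds)

lemma box_bump_outside:
  assumes "x \<notin> box a b" shows "box_bump a b n x = 0"
proof -
  obtain i where "x $ i \<le> a $ i \<or> b $ i \<le> x $ i"
    using assms by (auto simp: mem_box_cart not_less)
  then have "flat_exp 1 (real (Suc n) * (x $ i - a $ i)) = 0 \<or> flat_exp 1 (real (Suc n) * (b $ i - x $ i)) = 0"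
    by (auto simp: flat_exp_one zero_less_mult_iff)
  then show ?thesis unfolding box_bump_def by (auto intro!: prod_zero bexI[of _ i])
qed

lemma box_bump_tendsto: "(\<lambda>n. box_bump a b n x) \<longlonglongrightarrow> indicator (box a b) x"
proof (cases "x \<in> box a b")
  case True
  have *: "(\<lambda>n. flat_exp 1 (real (Suc n) * s)) \<longlonglongrightarrow> 1" if "s > 0" for s
  proof -
    have "(\<lambda>n. exp (- ((1 / s) * (1 / real (Suc n))))) \<longlonglongrightarrow> exp (- ((1 / s) * 0))"
      by (intro tendsto_intros LIMSEQ_Suc[OF lim_1_over_n])
    moreover have "exp (- ((1 / s) * (1 / real (Suc n)))) = flat_exp 1 (real (Suc n) * s)" for n
      using that by (simp add: flat_exp_one mult.commute zero_less_mult_iff)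
    ultimately show ?thesis by simp
  qed
  have "(\<lambda>n. box_bump a b n x) \<longlonglongrightarrow> (\<Prod>i\<in>(UNIV::'a set). 1 * 1)"
    unfolding box_bump_def
    by (intro tendsto_intros *) (use True in \<open>auto simp: mem_box_cart\<close>)
  then show ?thesis using True by simp
next
  case False
  then show ?thesis by (simp add: box_bump_outside)
qed

lemma box_bump_test_function:
  assumes "cbox a b \<subseteq> \<Omega>"
  shows "(\<lambda>x. of_real (box_bump a b n x)) \<in> test_functions \<Omega>"
  by (rule test_functions_I[OF box_bump_smooth compact_cbox assms])
     (metis box_bump_outside box_subset_cbox of_real_0 subsetD)

section \<open>The fundamental lemma of the calculus of variations\<close>

lemma integral_box_eq_0:
  fixes \<Omega> :: "(real^'n::finite) set"
  assumes "open \<Omega>" and v: "square_integrable \<Omega> v"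
    and zero: "\<forall>\<phi>\<in>test_functions \<Omega>. (\<integral>x. v x * \<phi> x \<partial>lebesgue_on \<Omega>) = 0"
    and sub: "cbox a b \<subseteq> \<Omega>"
  shows "set_integrable lebesgue (box a b) v" "(\<integral>x\<in>box a b. v x \<partial>lebesgue) = 0"
proof -
  have [measurable]: "v \<in> borel_measurable (lebesgue_on \<Omega>)" using v by (rule square_integrable_meas)
  have sets: "\<Omega> \<in> sets lebesgue" using assms(1) by auto
  have boxsub: "box a b \<subseteq> \<Omega>" using sub box_subset_cbox by blast
  have box[measurable]: "box a b \<in> sets (lebesgue_on \<Omega>)" 
    using sets boxsub by (simp add: sets_restrict_space_iff)
  have [measurable]: "(\<lambda>x. of_real (box_bump a b n x) :: complex) \<in> borel_measurable (lebesgue_on \<Omega>)" for n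
    using test_functions_square_integrable[OF assms(1) box_bump_test_function[OF sub]] by (rule square_integrable_meas)
  have ind: "square_integrable \<Omega> (\<lambda>x. of_real (indicator (box a b) x))"
  proof -
    have "(\<lambda>x. (cmod (of_real (indicator (box a b) x)))\<^sup>2) = indicator (box a b)"
      by (auto simp: indicator_def)
    moreover have "integrable (lebesgue_on \<Omega>) (indicator (box a b) :: _ \<Rightarrow> real)"
    proof (rule integrable_real_indicator[OF box])
      have "emeasure (lebesgue_on \<Omega>) (box a b) = emeasure lebesgue (box a b)"
        using sets boxsub by (intro emeasure_restrict_space) auto
      then show "emeasure (lebesgue_on \<Omega>) (box a b) < \<infinity>"
        using lmeasurable_box[of a b] unfolding fmeasurable_def by simp
    qed
    ultimately show ?thesis by (simp add: square_integrable_def)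
  qed
  have int: "integrable (lebesgue_on \<Omega>) (\<lambda>x. v x * of_real (indicator (box a b) x))"
    by (rule square_integrable_mult[OF v ind])
  have "(\<lambda>n. \<integral>x. v x * of_real (box_bump a b n x) \<partial>lebesgue_on \<Omega>)
      \<longlonglongrightarrow> (\<integral>x. v x * of_real (indicator (box a b) x) \<partial>lebesgue_on \<Omega>)"
  proof (rule integral_dominated_convergence)
    show "integrable (lebesgue_on \<Omega>) (\<lambda>x. cmod (v x * of_real (indicator (box a b) x)))"
      using int by (rule integrable_norm)
    show "AE x in lebesgue_on \<Omega>. (\<lambda>n. v x * of_real (box_bump a b n x)) \<longlonglongrightarrow> v x * of_real (indicator (box a b) x)"
      by (intro AE_I2 tendsto_intros tendsto_of_real box_bump_tendsto)
    show "AE x in lebesgue_on \<Omega>. norm (v x * of_real (box_bump a b n x)) \<le> cmod (v x * of_real (indicator (box a b) x))" for n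
    proof (intro AE_I2)
      fix x show "norm (v x * of_real (box_bump a b n x)) \<le> cmod (v x * of_real (indicator (box a b) x))"
        using box_bump_bounds[of a b n x] box_bump_outside[of x a b n]
        by (cases "x \<in> box a b") (auto simp: norm_mult mult_left_le)
    qed
  qed measurable
  then have zero': "(\<integral>x. v x * of_real (indicator (box a b) x) \<partial>lebesgue_on \<Omega>) = 0"
    by (simp add: zero box_bump_test_function[OF sub] LIMSEQ_const_iff)
  have eq: "indicator \<Omega> x *\<^sub>R (v x * of_real (indicator (box a b) x)) = indicator (box a b) x *\<^sub>R v x" for x
    using boxsub by (auto simp: indicator_def)
  show "set_integrable lebesgue (box a b) v"
    using int sets unfolding set_integrable_def by (simp add: integrable_restrict_space eq)
  show "(\<integral>x\<in>box a b. v x \<partial>lebesgue) = 0"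
    using zero' sets unfolding set_lebesgue_integral_def by (simp add: integral_restrict_space eq)
qed

lemma AE_cbox_eq_0:
  fixes \<Omega> :: "(real^'n::finite) set"
  assumes "open \<Omega>" and v: "square_integrable \<Omega> v"
    and zero: "\<forall>\<phi>\<in>test_functions \<Omega>. (\<integral>x. v x * \<phi> x \<partial>lebesgue_on \<Omega>) = 0"
    and sub: "cbox a b \<subseteq> \<Omega>"
  shows "negligible {x \<in> cbox a b. v x \<noteq> 0}"
proof -
  note int0 = integral_box_eq_0[OF assms(1,2) zero]
  \<comment> \<open>Differentiation of integrals requires integrability on every box, hence the restriction of \<open>v\<close>.\<close>
  define f where "f x = (if x \<in> box a b then v x else 0)" for x
  have fint: "integrable lebesgue f"
    using int0(1)[OF sub] unfolding set_integrable_def f_def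
    by (rule back_subst[of "integrable lebesgue"]) (auto simp: indicator_def)
  then have "f integrable_on UNIV" by (rule integrable_on_lebesgue)
  then have "f integrable_on cbox c d" for c d
    using integrable_on_subcbox by blast
  then obtain N where N: "negligible N"
    "\<And>x e. \<lbrakk>x \<notin> N; 0 < e\<rbrakk> \<Longrightarrow> \<exists>d>0. \<forall>h. 0 < h \<and> h < d \<longrightarrow>
       norm (integral (cbox x (x + h *\<^sub>R One)) f /\<^sub>R h ^ DIM(real^'n) - f x) < e"
    using integrable_ccontinuous_explicit[of f] by metis
  have "v x = 0" if x: "x \<in> box a b" "x \<notin> N" for x
  proof (rule ccontr)
    assume "v x \<noteq> 0"
    then have "0 < norm (f x)" using x by (simp add: f_def)
    from N(2)[OF x(2) this] obtain d where d: "d > 0"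
      "\<And>h. 0 < h \<Longrightarrow> h < d \<Longrightarrow> norm (integral (cbox x (x + h *\<^sub>R One)) f /\<^sub>R h ^ DIM(real^'n) - f x) < norm (f x)"
      by metis
    have "\<forall>\<^sub>F h in at_right (0::real). x + h *\<^sub>R One \<in> box a b"
    proof -
      have "((\<lambda>h::real. x + h *\<^sub>R One) \<longlongrightarrow> x + 0 *\<^sub>R One) (at_right 0)" by (intro tendsto_intros)
      then show ?thesis
        using x(1) topological_tendstoD[of "\<lambda>h::real. x + h *\<^sub>R One" x "at_right 0" "box a b"] by (simp add: open_box)
    qed
    moreover have "\<forall>\<^sub>F h in at_right (0::real). 0 < h \<and> h < d"
      using d(1) by (auto simp: eventually_at_right intro!: exI[of _ d])
    ultimately have "\<forall>\<^sub>F h in at_right (0::real). x + h *\<^sub>R One \<in> box a b \<and> 0 < h \<and> h < d"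
      by eventually_elim simp
    then obtain h :: real where h: "x + h *\<^sub>R One \<in> box a b" "0 < h" "h < d"
      using eventually_happens'[OF trivial_limit_at_right_real] by blast
    have sub1: "cbox x (x + h *\<^sub>R One) \<subseteq> box a b"
      using x(1) h(1) by (auto simp: mem_box) (meson le_less_trans less_le_trans)+
    have sub2: "cbox x (x + h *\<^sub>R One) \<subseteq> \<Omega>"
      using sub1 sub box_subset_cbox by blast
    have "integral (cbox x (x + h *\<^sub>R One)) f = integral (box x (x + h *\<^sub>R One)) f"
      by (rule integral_open_interval[symmetric])
    also have "\<dots> = integral (box x (x + h *\<^sub>R One)) v"
      by (rule integral_cong) (use sub1 box_subset_cbox in \<open>fastforce simp: f_def\<close>)
    also have "\<dots> = 0"
      using set_lebesgue_integral_eq_integral(2)[OF int0(1)[OF sub2]] int0(2)[OF sub2] by simp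
    finally show False using d(2)[OF h(2,3)] by simp
  qed
  then have "{x \<in> cbox a b. v x \<noteq> 0} \<subseteq> N \<union> (cbox a b - box a b)" by blast
  then show ?thesis
    by (rule negligible_subset[OF negligible_Un[OF N(1) negligible_frontier_interval]])
qed

theorem fundamental_lemma:
  fixes \<Omega> :: "(real^'n::finite) set"
  assumes "open \<Omega>" and "square_integrable \<Omega> v"
    and "\<forall>\<phi>\<in>test_functions \<Omega>. (\<integral>x. v x * \<phi> x \<partial>lebesgue_on \<Omega>) = 0"
  shows "AE x in lebesgue_on \<Omega>. v x = 0"
proof -
  obtain I :: "((real^'n) \<Rightarrow> real \<times> real) set" and a' b' where I: "countable I" "\<Omega> = (\<Union>f\<in>I. cbox (a' f) (b' f))"
  proof (rule that)
    show "countable {f\<in>Basis \<rightarrow>\<^sub>E \<rat> \<times> \<rat>. cbox (\<Sum>i\<in>Basis. fst (f i) *\<^sub>R i) (\<Sum>i\<in>Basis. snd (f i) *\<^sub>R i) \<subseteq> \<Omega>}"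
      by (rule countable_subset[of _ "Basis \<rightarrow>\<^sub>E \<rat> \<times> \<rat>"]) (auto intro!: countable_PiE countable_rat)
    show "\<Omega> = (\<Union>f\<in>{f\<in>Basis \<rightarrow>\<^sub>E \<rat> \<times> \<rat>. cbox (\<Sum>i\<in>Basis. fst (f i) *\<^sub>R i) (\<Sum>i\<in>Basis. snd (f i) *\<^sub>R i) \<subseteq> \<Omega>}.
        cbox (\<Sum>i\<in>Basis. fst (f i) *\<^sub>R i) (\<Sum>i\<in>Basis. snd (f i) *\<^sub>R i))"
      by (rule open_UNION_cbox[OF assms(1)])
  qed
  have "negligible (\<Union>f\<in>I. {x \<in> cbox (a' f) (b' f). v x \<noteq> 0})"
  proof (rule negligible_countable_Union)
    fix S assume "S \<in> (\<lambda>f. {x \<in> cbox (a' f) (b' f). v x \<noteq> 0}) ` I"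
    then show "negligible S" using AE_cbox_eq_0[OF assms] I(2) by blast
  qed (use I in auto)
  moreover have "{x \<in> \<Omega>. v x \<noteq> 0} \<subseteq> (\<Union>f\<in>I. {x \<in> cbox (a' f) (b' f). v x \<noteq> 0})"
    using I(2) by blast
  ultimately have "negligible {x \<in> \<Omega>. v x \<noteq> 0}" using negligible_subset by blast
  then have "{x \<in> \<Omega>. v x \<noteq> 0} \<in> null_sets lebesgue" by (simp add: negligible_iff_null_sets)
  then have "AE x in lebesgue. x \<notin> {x \<in> \<Omega>. v x \<noteq> 0}" by (rule AE_not_in)
  then have "AE x in lebesgue. x \<in> \<Omega> \<longrightarrow> v x = 0" by eventually_elim blast
  then show ?thesis using assms(1) by (simp add: AE_restrict_space_iff)
qed

section \<open>Weak derivatives\<close>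

text \<open>
  The pairing with a fixed function, without conjugation. On \<open>L\<^sub>2\<close> it is an inner product with the
  conjugate of \<open>\<phi>\<close>, hence linear and continuous in \<open>u\<close>.
\<close>

definition pairing :: "(real^'n::finite) set \<Rightarrow> 'n fn set \<Rightarrow> 'n fn \<Rightarrow> complex" where
  "pairing \<Omega> u \<phi> = (\<integral>x. rep u x * \<phi> x \<partial>lebesgue_on \<Omega>)"

lemma pairing_eq_inner:
  assumes "u \<in> L2 \<Omega>" "square_integrable \<Omega> \<phi>"
  shows "pairing \<Omega> u \<phi> = L2_inner \<Omega> u (ae_class \<Omega> (\<lambda>x. cnj (\<phi> x)))"
proof -
  note c = square_integrable_cnj[OF assms(2)]
  have "L2_inner \<Omega> u (ae_class \<Omega> (\<lambda>x. cnj (\<phi> x))) = (\<integral>x. rep u x * cnj (cnj (\<phi> x)) \<partial>lebesgue_on \<Omega>)"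
    by (rule L2_inner_ae) (use assms c in \<open>auto intro: rep_meas square_integrable_meas ae_class_L2 rep_ae_class\<close>)
  then show ?thesis by (simp add: pairing_def)
qed

lemma pairing_add:
  assumes "u \<in> L2 \<Omega>" "v \<in> L2 \<Omega>" "square_integrable \<Omega> \<phi>"
  shows "pairing \<Omega> (cls_add \<Omega> u v) \<phi> = pairing \<Omega> u \<phi> + pairing \<Omega> v \<phi>"
  using assms by (simp add: pairing_eq_inner cls_add_L2 L2.ip_add ae_class_L2 square_integrable_cnj)

lemma pairing_scale:
  assumes "u \<in> L2 \<Omega>" "square_integrable \<Omega> \<phi>"
  shows "pairing \<Omega> (cls_scale \<Omega> c u) \<phi> = c * pairing \<Omega> u \<phi>"
  using assms by (simp add: pairing_eq_inner cls_scale_L2 L2.ip_scale ae_class_L2 square_integrable_cnj)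

lemma pairing_tendsto:
  assumes "\<And>n. u n \<in> L2 \<Omega>" "w \<in> L2 \<Omega>" "square_integrable \<Omega> \<phi>"
    and lim: "(\<lambda>n. L2_dist \<Omega> (u n) w) \<longlonglongrightarrow> 0"
  shows "(\<lambda>n::nat. pairing \<Omega> (u n) \<phi>) \<longlonglongrightarrow> pairing \<Omega> w \<phi>"
proof -
  let ?c = "ae_class \<Omega> (\<lambda>x. cnj (\<phi> x))"
  have c: "?c \<in> L2 \<Omega>" using assms(3) by (simp add: ae_class_L2 square_integrable_cnj)
  have "(\<lambda>n. pairing \<Omega> (u n) \<phi> - pairing \<Omega> w \<phi>) \<longlonglongrightarrow> 0"
  proof (rule Lim_null_comparison)
    show "\<forall>\<^sub>F n in sequentially. norm (pairing \<Omega> (u n) \<phi> - pairing \<Omega> w \<phi>)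
        \<le> L2_dist \<Omega> (u n) w * L2_norm \<Omega> ?c"
    proof (intro always_eventually allI)
      fix n
      have "pairing \<Omega> (u n) \<phi> - pairing \<Omega> w \<phi> = L2_inner \<Omega> (cls_diff \<Omega> (u n) w) ?c"
        using assms(1-3) c by (simp add: pairing_eq_inner L2.ip_sub flip: L2_sub_eq)
      then show "norm (pairing \<Omega> (u n) \<phi> - pairing \<Omega> w \<phi>) \<le> L2_dist \<Omega> (u n) w * L2_norm \<Omega> ?c"
        using L2.Cauchy_Schwarz[OF cls_diff_L2[OF assms(1,2)] c, of n] by simp
    qed
    show "(\<lambda>n. L2_dist \<Omega> (u n) w * L2_norm \<Omega> ?c) \<longlonglongrightarrow> 0"
      using tendsto_mult_right[OF lim, of "L2_norm \<Omega> ?c"] by simp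
  qed
  then show ?thesis by (simp add: LIM_zero_cancel)
qed

lemma has_weak_deriv_pairing:
  "has_weak_deriv \<Omega> \<alpha> u v \<longleftrightarrow>
    (\<forall>\<phi>\<in>test_functions \<Omega>. pairing \<Omega> u (multi_deriv \<alpha> \<phi>) = (-1) ^ mi_order \<alpha> * pairing \<Omega> v \<phi>)"
  by (simp add: has_weak_deriv_def pairing_def)

lemma has_weak_deriv_zero: "has_weak_deriv \<Omega> (\<lambda>_. 0) u u"
  by (simp add: has_weak_deriv_pairing multi_deriv_zero mi_order_def)

context
  fixes \<Omega> :: "(real^'n::finite) set"
  assumes open_\<Omega>: "open \<Omega>"
begin

lemma test_sq: "\<phi> \<in> test_functions \<Omega> \<Longrightarrow> square_integrable \<Omega> \<phi>"
  by (rule test_functions_square_integrable[OF open_\<Omega>])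

lemma test_sq_multi: "\<phi> \<in> test_functions \<Omega> \<Longrightarrow> square_integrable \<Omega> (multi_deriv \<alpha> \<phi>)"
  by (intro test_sq test_functions_multi_deriv)

lemma has_weak_deriv_unique:
  assumes "v \<in> L2 \<Omega>" "w \<in> L2 \<Omega>" "has_weak_deriv \<Omega> \<alpha> u v" "has_weak_deriv \<Omega> \<alpha> u w"
  shows "v = w"
proof (rule L2_eqI[OF assms(1,2)])
  have "AE x in lebesgue_on \<Omega>. rep v x - rep w x = 0"
  proof (rule fundamental_lemma[OF open_\<Omega>])
    show "square_integrable \<Omega> (\<lambda>x. rep v x - rep w x)"
      using assms(1,2) by (intro square_integrable_diff rep_L2)
    show "\<forall>\<phi>\<in>test_functions \<Omega>. (\<integral>x. (rep v x - rep w x) * \<phi> x \<partial>lebesgue_on \<Omega>) = 0"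
    proof
      fix \<phi> assume \<phi>: "\<phi> \<in> test_functions \<Omega>"
      have "integrable (lebesgue_on \<Omega>) (\<lambda>x. rep v x * \<phi> x)" "integrable (lebesgue_on \<Omega>) (\<lambda>x. rep w x * \<phi> x)"
        using assms(1,2) \<phi> by (auto intro: square_integrable_mult rep_L2 test_sq)
      then have "(\<integral>x. (rep v x - rep w x) * \<phi> x \<partial>lebesgue_on \<Omega>) = pairing \<Omega> v \<phi> - pairing \<Omega> w \<phi>"
        by (simp add: left_diff_distrib pairing_def)
      then show "(\<integral>x. (rep v x - rep w x) * \<phi> x \<partial>lebesgue_on \<Omega>) = 0"
        using assms(3,4) \<phi> by (simp add: has_weak_deriv_pairing)
    qed
  qed
  then show "AE x in lebesgue_on \<Omega>. rep v x = rep w x" by eventually_elim simp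
qed

lemma weak_deriv_eq:
  assumes "v \<in> L2 \<Omega>" "has_weak_deriv \<Omega> \<alpha> u v"
  shows "weak_deriv \<Omega> \<alpha> u = v"
  unfolding weak_deriv_def by (rule the_equality) (use assms has_weak_deriv_unique in blast)+

lemma weak_deriv_Hm:
  assumes "u \<in> Hm m \<Omega>" "mi_order \<alpha> \<le> m"
  shows "weak_deriv \<Omega> \<alpha> u \<in> L2 \<Omega>" "has_weak_deriv \<Omega> \<alpha> u (weak_deriv \<Omega> \<alpha> u)"
proof -
  obtain v where "v \<in> L2 \<Omega>" "has_weak_deriv \<Omega> \<alpha> u v" using assms by (auto simp: Hm_def)
  then show "weak_deriv \<Omega> \<alpha> u \<in> L2 \<Omega>" "has_weak_deriv \<Omega> \<alpha> u (weak_deriv \<Omega> \<alpha> u)"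
    using weak_deriv_eq by auto
qed

lemma has_weak_deriv_add:
  assumes "u \<in> L2 \<Omega>" "u' \<in> L2 \<Omega>" "v \<in> L2 \<Omega>" "v' \<in> L2 \<Omega>"
    "has_weak_deriv \<Omega> \<alpha> u v" "has_weak_deriv \<Omega> \<alpha> u' v'"
  shows "has_weak_deriv \<Omega> \<alpha> (cls_add \<Omega> u u') (cls_add \<Omega> v v')"
  using assms by (simp add: has_weak_deriv_pairing pairing_add test_sq test_sq_multi distrib_left)

lemma has_weak_deriv_scale:
  assumes "u \<in> L2 \<Omega>" "v \<in> L2 \<Omega>" "has_weak_deriv \<Omega> \<alpha> u v"
  shows "has_weak_deriv \<Omega> \<alpha> (cls_scale \<Omega> c u) (cls_scale \<Omega> c v)"
  using assms by (simp add: has_weak_deriv_pairing pairing_scale test_sq test_sq_multi)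

lemma finite_mi_order: "finite {\<alpha> :: 'n \<Rightarrow> nat. mi_order \<alpha> \<le> m}"
proof (rule finite_subset)
  show "{\<alpha> :: 'n \<Rightarrow> nat. mi_order \<alpha> \<le> m} \<subseteq> UNIV \<rightarrow>\<^sub>E {..m}"
  proof
    fix \<alpha> :: "'n \<Rightarrow> nat" assume "\<alpha> \<in> {\<alpha>. mi_order \<alpha> \<le> m}"
    then have "\<alpha> i \<le> m" for i
      using member_le_sum[of i UNIV \<alpha>] by (simp add: mi_order_def)
    then show "\<alpha> \<in> UNIV \<rightarrow>\<^sub>E {..m}" by (simp add: PiE_UNIV_domain)
  qed
  show "finite ((UNIV :: 'n set) \<rightarrow>\<^sub>E {..m})" by (intro finite_PiE) auto
qed

lemma Hm_L2_subspace: "L2_subspace \<Omega> (Hm m \<Omega>)"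
proof
  show sub: "Hm m \<Omega> \<subseteq> L2 \<Omega>" by (auto simp: Hm_def)
  show add: "cls_add \<Omega> u v \<in> Hm m \<Omega>" if "u \<in> Hm m \<Omega>" "v \<in> Hm m \<Omega>" for u v
  proof -
    have "cls_add \<Omega> (weak_deriv \<Omega> \<alpha> u) (weak_deriv \<Omega> \<alpha> v) \<in> L2 \<Omega>"
      "has_weak_deriv \<Omega> \<alpha> (cls_add \<Omega> u v) (cls_add \<Omega> (weak_deriv \<Omega> \<alpha> u) (weak_deriv \<Omega> \<alpha> v))"
      if \<alpha>: "mi_order \<alpha> \<le> m" for \<alpha>
      using weak_deriv_Hm[OF _ \<alpha>] \<open>u \<in> Hm m \<Omega>\<close> \<open>v \<in> Hm m \<Omega>\<close> sub
      by (auto intro!: has_weak_deriv_add cls_add_L2)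
    moreover have "cls_add \<Omega> u v \<in> L2 \<Omega>" using that sub by (auto intro: cls_add_L2)
    ultimately show ?thesis unfolding Hm_def by blast
  qed
  show scale: "cls_scale \<Omega> c u \<in> Hm m \<Omega>" if "u \<in> Hm m \<Omega>" for u c
  proof -
    have "cls_scale \<Omega> c (weak_deriv \<Omega> \<alpha> u) \<in> L2 \<Omega>"
      "has_weak_deriv \<Omega> \<alpha> (cls_scale \<Omega> c u) (cls_scale \<Omega> c (weak_deriv \<Omega> \<alpha> u))"
      if \<alpha>: "mi_order \<alpha> \<le> m" for \<alpha>
      using weak_deriv_Hm[OF _ \<alpha>] \<open>u \<in> Hm m \<Omega>\<close> sub
      by (auto intro!: has_weak_deriv_scale cls_scale_L2)
    moreover have "cls_scale \<Omega> c u \<in> L2 \<Omega>" using that sub by (auto intro: cls_scale_L2)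
    ultimately show ?thesis unfolding Hm_def by blast
  qed
  have "has_weak_deriv \<Omega> \<alpha> (cls_zero \<Omega>) (cls_zero \<Omega>)" for \<alpha>
  proof -
    have "pairing \<Omega> (cls_zero \<Omega>) \<phi> = 0" if "square_integrable \<Omega> \<phi>" for \<phi>
      using pairing_scale[OF cls_zero_L2 that, of 0] cls_scale_zero[OF cls_zero_L2, of \<Omega>] by simp
    then show ?thesis by (simp add: has_weak_deriv_pairing test_sq test_sq_multi)
  qed
  then show "cls_zero \<Omega> \<in> Hm m \<Omega>" using cls_zero_L2 by (auto simp: Hm_def)
qed

text \<open>
  The weak derivatives are closed operators: for fixed \<open>\<phi>\<close>, both sides of the identity that defines
  them pass to the limit.
\<close>

lemma Hm_graph_space: "graph_space \<Omega> (Hm m \<Omega>) {\<alpha>. mi_order \<alpha> \<le> m} (weak_deriv \<Omega>)"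
proof -
  interpret L2_subspace \<Omega> "Hm m \<Omega>" by (rule Hm_L2_subspace)
  show ?thesis
  proof
    show "finite {\<alpha> :: 'n \<Rightarrow> nat. mi_order \<alpha> \<le> m}" by (rule finite_mi_order)
  next
    fix \<alpha> :: "'n \<Rightarrow> nat" and u v :: "'n fn set" and c
    assume \<alpha>: "\<alpha> \<in> {\<alpha>. mi_order \<alpha> \<le> m}" and u: "u \<in> Hm m \<Omega>"
    then have \<alpha>': "mi_order \<alpha> \<le> m" by simp
    show "weak_deriv \<Omega> \<alpha> u \<in> L2 \<Omega>" by (rule weak_deriv_Hm[OF u \<alpha>'])
    show "weak_deriv \<Omega> \<alpha> (cls_scale \<Omega> c u) = cls_scale \<Omega> c (weak_deriv \<Omega> \<alpha> u)"
      using weak_deriv_Hm[OF u \<alpha>'] mem_L2[OF u]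
      by (intro weak_deriv_eq has_weak_deriv_scale cls_scale_L2)
    assume v: "v \<in> Hm m \<Omega>"
    show "weak_deriv \<Omega> \<alpha> (cls_add \<Omega> u v) = cls_add \<Omega> (weak_deriv \<Omega> \<alpha> u) (weak_deriv \<Omega> \<alpha> v)"
      using weak_deriv_Hm[OF u \<alpha>'] mem_L2[OF u] weak_deriv_Hm[OF v \<alpha>'] mem_L2[OF v]
      by (intro weak_deriv_eq has_weak_deriv_add cls_add_L2)
  next
    fix u assume u: "u \<in> Hm m \<Omega>"
    have "weak_deriv \<Omega> (\<lambda>_. 0) u = u"
      by (intro weak_deriv_eq has_weak_deriv_zero mem_L2 u)
    moreover have "(L2_norm \<Omega> (weak_deriv \<Omega> (\<lambda>_. 0) u))\<^sup>2 \<le> (\<Sum>\<alpha> | mi_order \<alpha> \<le> m. (L2_norm \<Omega> (weak_deriv \<Omega> \<alpha> u))\<^sup>2)"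
      by (rule member_le_sum) (use finite_mi_order in \<open>auto simp: mi_order_def\<close>)
    ultimately show "(L2_norm \<Omega> u)\<^sup>2 \<le> (\<Sum>\<alpha> | mi_order \<alpha> \<le> m. (L2_norm \<Omega> (weak_deriv \<Omega> \<alpha> u))\<^sup>2)" by simp
  next
    fix u :: "nat \<Rightarrow> 'n fn set" and w v
    assume u: "\<And>n. u n \<in> Hm m \<Omega>" and w: "w \<in> L2 \<Omega>" "(\<lambda>n. L2_dist \<Omega> (u n) w) \<longlonglongrightarrow> 0"
      and v: "\<And>\<alpha>. \<alpha> \<in> {\<alpha>. mi_order \<alpha> \<le> m} \<Longrightarrow> v \<alpha> \<in> L2 \<Omega>"
      "\<And>\<alpha>. \<alpha> \<in> {\<alpha>. mi_order \<alpha> \<le> m} \<Longrightarrow> (\<lambda>n. L2_dist \<Omega> (weak_deriv \<Omega> \<alpha> (u n)) (v \<alpha>)) \<longlonglongrightarrow> 0"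
    have weak: "has_weak_deriv \<Omega> \<alpha> w (v \<alpha>)" if \<alpha>: "mi_order \<alpha> \<le> m" for \<alpha>
      unfolding has_weak_deriv_pairing
    proof
      fix \<phi> assume \<phi>: "\<phi> \<in> test_functions \<Omega>"
      have lim1: "(\<lambda>n. pairing \<Omega> (u n) (multi_deriv \<alpha> \<phi>)) \<longlonglongrightarrow> pairing \<Omega> w (multi_deriv \<alpha> \<phi>)"
        by (rule pairing_tendsto[OF mem_L2[OF u] w(1) test_sq_multi[OF \<phi>] w(2)])
      have "(\<lambda>n. pairing \<Omega> (weak_deriv \<Omega> \<alpha> (u n)) \<phi>) \<longlonglongrightarrow> pairing \<Omega> (v \<alpha>) \<phi>"
        by (rule pairing_tendsto[OF weak_deriv_Hm(1)[OF u \<alpha>] _ test_sq[OF \<phi>]]) (use v \<alpha> in auto)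
      then have lim2: "(\<lambda>n. (-1) ^ mi_order \<alpha> * pairing \<Omega> (weak_deriv \<Omega> \<alpha> (u n)) \<phi>) \<longlonglongrightarrow> (-1) ^ mi_order \<alpha> * pairing \<Omega> (v \<alpha>) \<phi>"
        by (intro tendsto_intros)
      have eq: "pairing \<Omega> (u n) (multi_deriv \<alpha> \<phi>) = (-1) ^ mi_order \<alpha> * pairing \<Omega> (weak_deriv \<Omega> \<alpha> (u n)) \<phi>" for n
        using weak_deriv_Hm(2)[OF u \<alpha>, of n] \<phi> by (simp add: has_weak_deriv_pairing)
      show "pairing \<Omega> w (multi_deriv \<alpha> \<phi>) = (-1) ^ mi_order \<alpha> * pairing \<Omega> (v \<alpha>) \<phi>"
        by (rule LIMSEQ_unique[OF lim1[unfolded eq] lim2])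
    qed
    have "w \<in> Hm m \<Omega>" using w(1) v(1) weak by (auto simp: Hm_def)
    then show "w \<in> Hm m \<Omega> \<and> (\<forall>\<alpha>\<in>{\<alpha>. mi_order \<alpha> \<le> m}. weak_deriv \<Omega> \<alpha> w = v \<alpha>)"
      using weak_deriv_eq v(1) weak by auto
  qed
qed

lemma Hm_gnorm: "graph_space.gnorm \<Omega> {\<alpha>. mi_order \<alpha> \<le> m} (weak_deriv \<Omega>) = Hm_norm m \<Omega>"
  using graph_space.gnorm_def[OF Hm_graph_space] by (simp add: fun_eq_iff Hm_norm_def)

end

section \<open>Test functions in Sobolev spaces\<close>

lemma integral_translation:
  fixes f :: "'a::euclidean_space \<Rightarrow> 'b::{banach, second_countable_topology}"
  assumes "f \<in> borel_measurable borel"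
  shows "(\<integral>x. f (x + c) \<partial>lborel) = (\<integral>x. f x \<partial>lborel)"
proof -
  have "(\<integral>x. f x \<partial>lborel) = (\<integral>x. f x \<partial>distr lborel borel ((+) c))"
    by (simp add: lborel_distr_plus)
  also have "\<dots> = (\<integral>x. f (c + x) \<partial>lborel)"
    using assms by (intro integral_distr) auto
  finally show ?thesis by (simp add: add.commute)
qed

lemma continuous_compact_support_integrable:
  fixes f :: "'a::euclidean_space \<Rightarrow> 'b::{banach, second_countable_topology}"
  assumes "continuous_on UNIV f" "compact K" "\<And>x. x \<notin> K \<Longrightarrow> f x = 0"
  shows "integrable lborel f"
proof -
  have eq: "(\<lambda>x. indicator K x *\<^sub>R f x) = f" using assms(3) by (auto simp: indicator_def)
  show ?thesis
    using borel_integrable_compact[OF assms(2) continuous_on_subset[OF assms(1) subset_UNIV]] unfolding eq .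
qed

text \<open>
  The integral of a directional derivative vanishes: it is the limit of the integrals of the
  difference quotients, which are zero by translation invariance.
\<close>

lemma integral_derivative_compact_support:
  fixes g h :: "real^'n::finite \<Rightarrow> complex"
  assumes cont: "continuous_on UNIV g" "continuous_on UNIV h" and K: "compact K" "\<And>x. x \<notin> K \<Longrightarrow> g x = 0"
    "\<And>x. x \<notin> K \<Longrightarrow> h x = 0"
    and d: "\<And>x. ((\<lambda>t. g (x + t *\<^sub>R e)) has_vector_derivative h x) (at 0)"
  shows "(\<integral>x. h x \<partial>lborel) = 0"
proof -
  define q where "q n x = real (Suc n) *\<^sub>R (g (x + (1 / real (Suc n)) *\<^sub>R e) - g x)" for n x
  have [measurable]: "g \<in> borel_measurable borel" "h \<in> borel_measurable borel"
    using cont by (auto intro: borel_measurable_continuous_onI)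
  have [measurable]: "q n \<in> borel_measurable borel" for n unfolding q_def by measurable
  have gi: "integrable lborel g" by (rule continuous_compact_support_integrable[OF cont(1) K(1,2)])
  have gi': "integrable lborel (\<lambda>x. g (x + c))" for c
  proof (rule continuous_compact_support_integrable)
    show "continuous_on UNIV (\<lambda>x. g (x + c))"
      by (rule continuous_on_compose2[OF cont(1)]) (auto intro!: continuous_intros)
    show "compact ((\<lambda>k. k - c) ` K)" by (rule compact_continuous_image[OF _ K(1)]) (intro continuous_intros)
    show "g (x + c) = 0" if "x \<notin> (\<lambda>k. k - c) ` K" for x
      using that K(2) by (metis add_diff_cancel_right' imageI)
  qed
  have q0: "(\<integral>x. q n x \<partial>lborel) = 0" for n
    unfolding q_def using gi gi' by (simp add: integral_translation)
  have dd: "((\<lambda>t. g (x + t *\<^sub>R e)) has_vector_derivative h (x + s *\<^sub>R e)) (at s)" for x s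
  proof -
    have "((\<lambda>t. g ((x + s *\<^sub>R e) + t *\<^sub>R e)) has_vector_derivative h (x + s *\<^sub>R e)) (at (s - s))"
      using d[of "x + s *\<^sub>R e"] by simp
    moreover have "((\<lambda>t. t - s) has_vector_derivative 1) (at s)"
      unfolding has_real_derivative_iff_has_vector_derivative[symmetric] by (auto intro!: derivative_eq_intros)
    ultimately have "((\<lambda>t. g ((x + s *\<^sub>R e) + (t - s) *\<^sub>R e)) has_vector_derivative 1 *\<^sub>R h (x + s *\<^sub>R e)) (at s)"
      using vector_diff_chain_at[of "\<lambda>t. t - s" 1 s "\<lambda>t. g ((x + s *\<^sub>R e) + t *\<^sub>R e)" "h (x + s *\<^sub>R e)"]
      by (simp add: o_def)
    then show ?thesis by (simp add: algebra_simps)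
  qed
  have "compact (h ` K)" using cont(2) K(1) compact_continuous_image continuous_on_subset by blast
  then obtain B where "\<And>x. x \<in> K \<Longrightarrow> cmod (h x) \<le> B" and "B > 0"
    using compact_imp_bounded bounded_pos by (metis image_eqI)
  then have B: "cmod (h x) \<le> B" for x using K(3)[of x] by (cases "x \<in> K") auto
  \<comment> \<open>\<open>L\<close> contains the supports of all the difference quotients.\<close>
  define L where "L = (\<lambda>(k, s). k - s *\<^sub>R e) ` (K \<times> {0..1::real})"
  have L: "compact L" unfolding L_def
    by (intro compact_continuous_image compact_Times K) (auto simp: split_def intro!: continuous_intros)
  have KL: "x \<in> L" if "x + s *\<^sub>R e \<in> K" "0 \<le> s" "s \<le> 1" for x s
    unfolding L_def using that by (auto intro!: image_eqI[of _ _ "(x + s *\<^sub>R e, s)"])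
  have "(\<lambda>n. \<integral>x. q n x \<partial>lborel) \<longlonglongrightarrow> (\<integral>x. h x \<partial>lborel)"
  proof (rule integral_dominated_convergence)
    show "integrable lborel (\<lambda>x. indicator L x *\<^sub>R B)"
      by (rule borel_integrable_compact[OF L]) auto
    show "AE x in lborel. (\<lambda>n. q n x) \<longlonglongrightarrow> h x"
    proof (intro AE_I2)
      fix x
      let ?F = "\<lambda>t. g (x + t *\<^sub>R e)"
      have "((\<lambda>y. ((?F y - ?F 0) - (y - 0) *\<^sub>R h x) /\<^sub>R norm (y - 0)) \<longlongrightarrow> 0) (at 0)"
        using d[of x] unfolding has_vector_derivative_def has_derivative_at_within by blast
      moreover have "filterlim (\<lambda>n. 1 / real (Suc n)) (at 0) sequentially"
        unfolding filterlim_at using LIMSEQ_Suc[OF lim_1_over_n[where 'a=real]] by simp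
      ultimately have "(\<lambda>n. ((?F (1 / real (Suc n)) - ?F 0) - (1 / real (Suc n) - 0) *\<^sub>R h x) /\<^sub>R norm (1 / real (Suc n) - 0)) \<longlonglongrightarrow> 0"
        by (rule filterlim_compose)
      moreover have "((?F (1 / real (Suc n)) - ?F 0) - (1 / real (Suc n) - 0) *\<^sub>R h x) /\<^sub>R norm (1 / real (Suc n) - 0) = q n x - h x" for n
        unfolding q_def by (simp add: scaleR_diff_right del: of_nat_Suc)
      ultimately show "(\<lambda>n. q n x) \<longlonglongrightarrow> h x" by (simp add: LIM_zero_cancel)
    qed
    show "AE x in lborel. norm (q n x) \<le> indicator L x *\<^sub>R B" for n
    proof (intro AE_I2)
      fix x
      let ?s = "1 / real (Suc n)"
      have s: "0 < ?s" "?s \<le> 1" by auto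
      show "norm (q n x) \<le> indicator L x *\<^sub>R B"
      proof (cases "x \<in> L")
        case True
        have "norm (g (x + ?s *\<^sub>R e) - g (x + 0 *\<^sub>R e)) \<le> B * norm (?s - 0)"
        proof (rule differentiable_bound[of "{0..1}" "\<lambda>t. g (x + t *\<^sub>R e)" "\<lambda>t r. r *\<^sub>R h (x + t *\<^sub>R e)"])
          fix t :: real
          show "((\<lambda>t. g (x + t *\<^sub>R e)) has_derivative (\<lambda>r. r *\<^sub>R h (x + t *\<^sub>R e))) (at t within {0..1})"
            using dd[of x t] by (simp add: has_vector_derivative_def has_derivative_at_withinI)
          show "onorm (\<lambda>r. r *\<^sub>R h (x + t *\<^sub>R e)) \<le> B"
            by (rule onorm_bound) (use B \<open>B > 0\<close> in \<open>auto simp: mult.commute[of B] intro!: mult_left_mono\<close>)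
        qed (use s in auto)
        then have "real (Suc n) * norm (g (x + ?s *\<^sub>R e) - g x) \<le> real (Suc n) * (B * ?s)"
          by (intro mult_left_mono) auto
        then show ?thesis using True by (simp add: q_def)
      next
        case False
        then have "x + ?s *\<^sub>R e \<notin> K" "x + 0 *\<^sub>R e \<notin> K" using KL s by (metis less_imp_le order_refl zero_le_one)+
        then show ?thesis using K(2) False by (simp add: q_def)
      qed
    qed
  qed measurable
  then show ?thesis using q0 by (simp add: LIMSEQ_const_iff)
qed

lemma integral_lebesgue_on_support:
  fixes f :: "real^'n::finite \<Rightarrow> complex"
  assumes "open \<Omega>" "f \<in> borel_measurable borel" "\<And>x. x \<notin> \<Omega> \<Longrightarrow> f x = 0"
  shows "(\<integral>x. f x \<partial>lebesgue_on \<Omega>) = (\<integral>x. f x \<partial>lborel)"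
proof -
  have "(\<integral>x. f x \<partial>lebesgue_on \<Omega>) = (\<integral>x. indicator \<Omega> x *\<^sub>R f x \<partial>lebesgue)"
    using assms(1) by (intro integral_restrict_space) auto
  also have "(\<lambda>x. indicator \<Omega> x *\<^sub>R f x) = f"
    using assms(3) by (auto simp: indicator_def)
  also have "(\<integral>x. f x \<partial>lebesgue) = (\<integral>x. f x \<partial>lborel)"
    using assms(2) by (intro integral_completion) auto
  finally show ?thesis .
qed

lemma integration_by_parts:
  fixes \<Omega> :: "(real^'n::finite) set"
  assumes "open \<Omega>" "\<phi> \<in> test_functions \<Omega>" "\<psi> \<in> test_functions \<Omega>"
  shows "(\<integral>x. \<phi> x * partial_deriv i \<psi> x \<partial>lebesgue_on \<Omega>) = - (\<integral>x. partial_deriv i \<phi> x * \<psi> x \<partial>lebesgue_on \<Omega>)"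
proof -
  obtain K where K: "compact K" "K \<subseteq> \<Omega>" "\<And>x. x \<notin> K \<Longrightarrow> \<phi> x = 0" "smooth \<phi>"
    using test_functions_D[OF assms(2)] by blast
  obtain L where L: "compact L" "\<And>x. x \<notin> L \<Longrightarrow> partial_deriv i \<phi> x = 0" "smooth (partial_deriv i \<phi>)" "L \<subseteq> \<Omega>"
    using test_functions_D[OF test_functions_partial_deriv[OF assms(2)]] by metis
  have \<psi>: "smooth \<psi>" "smooth (partial_deriv i \<psi>)"
    using test_functions_D[OF assms(3)] smooth_partial_deriv by metis+
  note cont = K(4)[THEN smooth_continuous] L(3)[THEN smooth_continuous] \<psi>[THEN smooth_continuous]
  note [measurable] = cont[THEN borel_measurable_continuous_onI]
  have int: "integrable lborel (\<lambda>x. \<phi> x * partial_deriv i \<psi> x)"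
    by (rule continuous_compact_support_integrable[OF _ K(1)]) (use K in \<open>auto intro!: continuous_intros cont\<close>)
  have int': "integrable lborel (\<lambda>x. partial_deriv i \<phi> x * \<psi> x)"
    by (rule continuous_compact_support_integrable[OF _ L(1)]) (use L in \<open>auto intro!: continuous_intros cont\<close>)
  have "(\<integral>x. \<phi> x * partial_deriv i \<psi> x + partial_deriv i \<phi> x * \<psi> x \<partial>lborel) = 0"
  proof (rule integral_derivative_compact_support[where g="\<lambda>x. \<phi> x * \<psi> x" and K="K \<union> L" and e="axis i 1"])
    show "((\<lambda>t. \<phi> (x + t *\<^sub>R axis i 1) * \<psi> (x + t *\<^sub>R axis i 1)) has_vector_derivative
          \<phi> x * partial_deriv i \<psi> x + partial_deriv i \<phi> x * \<psi> x) (at 0)" for x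
      using has_vector_derivative_mult[OF smooth_has_partial_deriv[OF K(4)] smooth_has_partial_deriv[OF \<psi>(1)], of x i x i]
      by simp
  qed (use K L in \<open>auto intro!: continuous_intros cont\<close>)
  then have "(\<integral>x. \<phi> x * partial_deriv i \<psi> x \<partial>lborel) = - (\<integral>x. partial_deriv i \<phi> x * \<psi> x \<partial>lborel)"
    using int int' by (simp add: eq_neg_iff_add_eq_0)
  moreover have "(\<integral>x. \<phi> x * partial_deriv i \<psi> x \<partial>lebesgue_on \<Omega>) = (\<integral>x. \<phi> x * partial_deriv i \<psi> x \<partial>lborel)"
    by (rule integral_lebesgue_on_support[OF assms(1)]) (use K in auto)
  moreover have "(\<integral>x. partial_deriv i \<phi> x * \<psi> x \<partial>lebesgue_on \<Omega>) = (\<integral>x. partial_deriv i \<phi> x * \<psi> x \<partial>lborel)"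
    by (rule integral_lebesgue_on_support[OF assms(1)]) (use L in auto)
  ultimately show ?thesis by simp
qed

text \<open>No symmetry of mixed partial derivatives is needed: the word of derivatives is merely reversed.\<close>

lemma integration_by_parts_iter:
  fixes \<Omega> :: "(real^'n::finite) set"
  assumes "open \<Omega>" "\<phi> \<in> test_functions \<Omega>" "\<psi> \<in> test_functions \<Omega>"
  shows "(\<integral>x. \<phi> x * iter_partial w \<psi> x \<partial>lebesgue_on \<Omega>) =
    (-1) ^ length w * (\<integral>x. iter_partial (rev w) \<phi> x * \<psi> x \<partial>lebesgue_on \<Omega>)"
  using assms(2)
proof (induction w arbitrary: \<phi>)
  case Nil
  then show ?case by (simp add: iter_partial_Nil)
next
  case (Cons i w)
  have "(\<integral>x. \<phi> x * iter_partial (i # w) \<psi> x \<partial>lebesgue_on \<Omega>) = - (\<integral>x. partial_deriv i \<phi> x * iter_partial w \<psi> x \<partial>lebesgue_on \<Omega>)"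
    unfolding iter_partial_Cons
    by (rule integration_by_parts[OF assms(1) Cons.prems test_functions_iter_partial[OF assms(3)]])
  also have "\<dots> = (-1) ^ length (i # w) * (\<integral>x. iter_partial (rev (i # w)) \<phi> x * \<psi> x \<partial>lebesgue_on \<Omega>)"
    using Cons.IH[OF test_functions_partial_deriv[OF Cons.prems, of i]]
    by (simp add: iter_partial_append iter_partial_Cons iter_partial_Nil)
  finally show ?case .
qed

text \<open>
  A word with prescribed letter counts exists, so that the choice in \<open>multi_deriv\<close> is meaningful; its
  length is the order of the multi-index.
\<close>

lemma multi_index_word:
  fixes \<alpha> :: "'n::finite \<Rightarrow> nat"
  obtains w where "(SOME w. \<forall>i. count_list w i = \<alpha> i) = w" "length w = mi_order \<alpha>"
proof -
  obtain w0 where w0: "mset w0 = (\<Sum>i\<in>UNIV. replicate_mset (\<alpha> i) i)" using ex_mset by blast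
  have "count_list w0 i = \<alpha> i" for i
    unfolding count_mset[symmetric] w0 by (simp add: count_sum)
  then have "\<forall>i. count_list (SOME w. \<forall>i. count_list w i = \<alpha> i) i = \<alpha> i"
    by (intro someI_ex[of "\<lambda>w. \<forall>i. count_list w i = \<alpha> i"]) blast
  then have "length (SOME w. \<forall>i. count_list w i = \<alpha> i) = mi_order \<alpha>"
    using sum_count_set[of "SOME w. \<forall>i. count_list w i = \<alpha> i" UNIV] by (simp add: mi_order_def)
  then show ?thesis using that by blast
qed

lemma test_function_Hm:
  fixes \<Omega> :: "(real^'n::finite) set"
  assumes "open \<Omega>" "\<phi> \<in> test_functions \<Omega>"
  shows "ae_class \<Omega> \<phi> \<in> Hm m \<Omega>"
proof -
  note sq = test_functions_square_integrable[OF assms(1)]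
  have pair: "pairing \<Omega> (ae_class \<Omega> f) g = (\<integral>x. f x * g x \<partial>lebesgue_on \<Omega>)"
    if "f \<in> test_functions \<Omega>" "g \<in> test_functions \<Omega>" for f g
  proof -
    note [measurable] = sq[OF that(1), THEN square_integrable_meas] sq[OF that(2), THEN square_integrable_meas]
    note r = rep_ae_class[OF sq[OF that(1), THEN square_integrable_meas]]
    note [measurable] = r(1)
    show ?thesis unfolding pairing_def
    proof (rule integral_cong_AE)
      show "AE x in lebesgue_on \<Omega>. rep (ae_class \<Omega> f) x * g x = f x * g x"
        using r(2) by eventually_elim simp
    qed measurable
  qed
  have "\<exists>v\<in>L2 \<Omega>. has_weak_deriv \<Omega> \<alpha> (ae_class \<Omega> \<phi>) v" for \<alpha>
  proof -
    obtain w where w: "(SOME w. \<forall>i. count_list w i = \<alpha> i) = w" "length w = mi_order \<alpha>"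
      by (rule multi_index_word)
    have "has_weak_deriv \<Omega> \<alpha> (ae_class \<Omega> \<phi>) (ae_class \<Omega> (iter_partial (rev w) \<phi>))"
      unfolding has_weak_deriv_pairing multi_deriv_def w(1)
      using integration_by_parts_iter[OF assms, of _ w] w(2) assms(2)
      by (simp add: pair test_functions_iter_partial)
    then show ?thesis using sq test_functions_iter_partial[OF assms(2)] ae_class_L2 by blast
  qed
  then show ?thesis using ae_class_L2[OF sq[OF assms(2)]] by (auto simp: Hm_def)
qed

section \<open>The closure of the test functions\<close>

lemma zero_test_function: "(\<lambda>x. 0) \<in> test_functions \<Omega>"
  by (rule test_functions_I[OF bump_algebra_smooth[OF bump_algebra.const], of "{}"]) auto

context
  fixes \<Omega> :: "(real^'n::finite) set" and m :: nat
  assumes open_\<Omega>: "open \<Omega>"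
begin

interpretation H: graph_space \<Omega> "Hm m \<Omega>" "{\<alpha>. mi_order \<alpha> \<le> m}" "weak_deriv \<Omega>"
  rewrites "graph_space.gnorm \<Omega> {\<alpha>. mi_order \<alpha> \<le> m} (weak_deriv \<Omega>) = Hm_norm m \<Omega>"
  by (rule Hm_graph_space[OF open_\<Omega>]) (rule Hm_gnorm[OF open_\<Omega>])

lemma Hm_norm_diff_triangle:
  assumes "u \<in> Hm m \<Omega>" "v \<in> Hm m \<Omega>" "w \<in> Hm m \<Omega>"
  shows "Hm_norm m \<Omega> (cls_diff \<Omega> u w) \<le> Hm_norm m \<Omega> (cls_diff \<Omega> u v) + Hm_norm m \<Omega> (cls_diff \<Omega> v w)"
  using H.G.nrm_sub_triangle[OF assms] by (simp add: H.gnorm_eq H.sub_eq H.diff_mem assms)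

lemma Hm_norm_diff_add_le:
  assumes "u \<in> Hm m \<Omega>" "v \<in> Hm m \<Omega>" "x \<in> Hm m \<Omega>" "y \<in> Hm m \<Omega>"
  shows "Hm_norm m \<Omega> (cls_diff \<Omega> (cls_add \<Omega> u v) (cls_add \<Omega> x y)) \<le>
    Hm_norm m \<Omega> (cls_diff \<Omega> u x) + Hm_norm m \<Omega> (cls_diff \<Omega> v y)"
  using H.G.nrm_sub_add_le[OF assms] by (simp add: H.gnorm_eq H.sub_eq H.diff_mem H.add_mem assms)

lemma Hm_norm_diff_scale:
  assumes "u \<in> Hm m \<Omega>" "v \<in> Hm m \<Omega>"
  shows "Hm_norm m \<Omega> (cls_diff \<Omega> (cls_scale \<Omega> c u) (cls_scale \<Omega> c v)) = cmod c * Hm_norm m \<Omega> (cls_diff \<Omega> u v)"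
  using H.G.nrm_sub_scale[OF assms] by (simp add: H.gnorm_eq H.sub_eq H.diff_mem H.scale_mem assms)

lemma Hm0_I:
  assumes "u \<in> Hm m \<Omega>" "\<And>e. e > 0 \<Longrightarrow> \<exists>\<phi>\<in>test_functions \<Omega>. Hm_norm m \<Omega> (cls_diff \<Omega> u (ae_class \<Omega> \<phi>)) < e"
  shows "u \<in> Hm0 m \<Omega>"
  using assms by (simp add: Hm0_def)

lemma Hm0_D:
  assumes "u \<in> Hm0 m \<Omega>" "e > 0"
  obtains \<phi> where "\<phi> \<in> test_functions \<Omega>" "ae_class \<Omega> \<phi> \<in> Hm m \<Omega>" "Hm_norm m \<Omega> (cls_diff \<Omega> u (ae_class \<Omega> \<phi>)) < e"
  using assms test_function_Hm[OF open_\<Omega>] by (auto simp: Hm0_def)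

lemma Hm0_sub: "Hm0 m \<Omega> \<subseteq> Hm m \<Omega>"
  by (auto simp: Hm0_def)

lemma Hm0_closed:
  assumes "z \<in> Hm m \<Omega>" "\<And>e. e > 0 \<Longrightarrow> \<exists>y\<in>Hm0 m \<Omega>. Hm_norm m \<Omega> (cls_diff \<Omega> z y) < e"
  shows "z \<in> Hm0 m \<Omega>"
proof (rule Hm0_I[OF assms(1)])
  fix e :: real assume "e > 0"
  then have e2: "e / 2 > 0" by simp
  obtain y where y: "y \<in> Hm0 m \<Omega>" "Hm_norm m \<Omega> (cls_diff \<Omega> z y) < e / 2"
    using assms(2)[OF e2] by blast
  obtain \<phi> where \<phi>: "\<phi> \<in> test_functions \<Omega>" "ae_class \<Omega> \<phi> \<in> Hm m \<Omega>" "Hm_norm m \<Omega> (cls_diff \<Omega> y (ae_class \<Omega> \<phi>)) < e / 2"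
    using Hm0_D[OF y(1) e2] by blast
  have "y \<in> Hm m \<Omega>" using y(1) Hm0_sub by blast
  then have "Hm_norm m \<Omega> (cls_diff \<Omega> z (ae_class \<Omega> \<phi>)) < e"
    using Hm_norm_diff_triangle[OF assms(1) _ \<phi>(2), of y] y(2) \<phi>(3) by simp
  then show "\<exists>\<phi>\<in>test_functions \<Omega>. Hm_norm m \<Omega> (cls_diff \<Omega> z (ae_class \<Omega> \<phi>)) < e"
    using \<phi>(1) by blast
qed

lemma Hm0_L2_subspace: "L2_subspace \<Omega> (Hm0 m \<Omega>)"
proof
  note meas = test_functions_square_integrable[OF open_\<Omega>, THEN square_integrable_meas]
  show "Hm0 m \<Omega> \<subseteq> L2 \<Omega>" using Hm0_sub H.sub_L2 by blast
  show "cls_add \<Omega> u v \<in> Hm0 m \<Omega>" if uv: "u \<in> Hm0 m \<Omega>" "v \<in> Hm0 m \<Omega>" for u v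
  proof (rule Hm0_I)
    have uv': "u \<in> Hm m \<Omega>" "v \<in> Hm m \<Omega>" using uv Hm0_sub by auto
    show "cls_add \<Omega> u v \<in> Hm m \<Omega>" using uv' by (rule H.add_mem)
    fix e :: real assume "e > 0"
    then have e2: "e / 2 > 0" by simp
    obtain \<phi> where \<phi>: "\<phi> \<in> test_functions \<Omega>" "ae_class \<Omega> \<phi> \<in> Hm m \<Omega>" "Hm_norm m \<Omega> (cls_diff \<Omega> u (ae_class \<Omega> \<phi>)) < e / 2"
      using Hm0_D[OF uv(1) e2] by blast
    obtain \<psi> where \<psi>: "\<psi> \<in> test_functions \<Omega>" "ae_class \<Omega> \<psi> \<in> Hm m \<Omega>" "Hm_norm m \<Omega> (cls_diff \<Omega> v (ae_class \<Omega> \<psi>)) < e / 2"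
      using Hm0_D[OF uv(2) e2] by blast
    have "(\<lambda>x. \<phi> x + \<psi> x) \<in> test_functions \<Omega>"
      using test_functions_lincomb[OF \<phi>(1) \<psi>(1), of 1 1] by simp
    moreover have "Hm_norm m \<Omega> (cls_diff \<Omega> (cls_add \<Omega> u v) (ae_class \<Omega> (\<lambda>x. \<phi> x + \<psi> x))) < e"
      using Hm_norm_diff_add_le[OF uv' \<phi>(2) \<psi>(2)] \<phi>(3) \<psi>(3)
      by (simp add: cls_add_ae_class[OF meas[OF \<phi>(1)] meas[OF \<psi>(1)]])
    ultimately show "\<exists>\<phi>\<in>test_functions \<Omega>. Hm_norm m \<Omega> (cls_diff \<Omega> (cls_add \<Omega> u v) (ae_class \<Omega> \<phi>)) < e"
      by blast
  qed
  show scale: "cls_scale \<Omega> c u \<in> Hm0 m \<Omega>" if u: "u \<in> Hm0 m \<Omega>" for u c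
  proof (rule Hm0_I)
    have u': "u \<in> Hm m \<Omega>" using u Hm0_sub by auto
    show "cls_scale \<Omega> c u \<in> Hm m \<Omega>" using u' by (rule H.scale_mem)
    fix e :: real assume "e > 0"
    have pos: "cmod c + 1 > 0" by (simp add: add_nonneg_pos)
    then have e2: "e / (cmod c + 1) > 0" using \<open>e > 0\<close> by simp
    obtain \<phi> where \<phi>: "\<phi> \<in> test_functions \<Omega>" "ae_class \<Omega> \<phi> \<in> Hm m \<Omega>" "Hm_norm m \<Omega> (cls_diff \<Omega> u (ae_class \<Omega> \<phi>)) < e / (cmod c + 1)"
      using Hm0_D[OF u e2] by blast
    have "(\<lambda>x. c * \<phi> x) \<in> test_functions \<Omega>"
      using test_functions_lincomb[OF \<phi>(1) \<phi>(1), of c 0] by simp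
    moreover have "Hm_norm m \<Omega> (cls_diff \<Omega> (cls_scale \<Omega> c u) (ae_class \<Omega> (\<lambda>x. c * \<phi> x))) < e"
    proof -
      let ?d = "cls_diff \<Omega> u (ae_class \<Omega> \<phi>)"
      have "cmod c * Hm_norm m \<Omega> ?d \<le> cmod c * (e / (cmod c + 1))"
        using \<phi>(3) by (intro mult_left_mono) auto
      also have "\<dots> < e" using pos \<open>e > 0\<close> by (simp add: field_simps)
      finally show ?thesis
        using Hm_norm_diff_scale[OF u' \<phi>(2), of c] by (simp add: cls_scale_ae_class[OF meas[OF \<phi>(1)]])
    qed
    ultimately show "\<exists>\<phi>\<in>test_functions \<Omega>. Hm_norm m \<Omega> (cls_diff \<Omega> (cls_scale \<Omega> c u) (ae_class \<Omega> \<phi>)) < e"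
      by blast
  qed
  show "cls_zero \<Omega> \<in> Hm0 m \<Omega>"
  proof (rule Hm0_I[OF H.zero_mem])
    fix e :: real assume "e > 0"
    have "Hm_norm m \<Omega> (cls_diff \<Omega> (cls_zero \<Omega>) (ae_class \<Omega> (\<lambda>x. 0))) = 0"
      using Hm_norm_diff_scale[OF H.zero_mem H.zero_mem, of 0]
      by (simp add: cls_scale_zero cls_zero_L2 flip: cls_zero_def)
    then show "\<exists>\<phi>\<in>test_functions \<Omega>. Hm_norm m \<Omega> (cls_diff \<Omega> (cls_zero \<Omega>) (ae_class \<Omega> \<phi>)) < e"
      using zero_test_function \<open>e > 0\<close> by (intro bexI[of _ "\<lambda>x. 0"]) auto
  qed
qed

theorem Hm_adjoint:
  assumes "admissible_inner_product \<Omega> (Hm m \<Omega>) (Hm_norm m \<Omega>) a" "u \<in> L2 \<Omega>"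
    and "Eadj = hilbert_adjoint (Hm m \<Omega>) a (L2 \<Omega>) (L2_inner \<Omega>) (embedding (Hm m \<Omega>))"
  shows "Eadj u \<in> Hm m \<Omega> \<and> (\<forall>v\<in>Hm m \<Omega>. a (Eadj u) v = L2_inner \<Omega> u v) \<and>
         (\<forall>z\<in>Hm m \<Omega>. (\<forall>v\<in>Hm m \<Omega>. a z v = L2_inner \<Omega> u v) \<longrightarrow> z = Eadj u)"
  by (rule H.adjoint_of_graph_embedding[OF assms])

theorem Hm0_adjoint:
  assumes "admissible_inner_product \<Omega> (Hm0 m \<Omega>) (Hm_norm m \<Omega>) a" "u \<in> L2 \<Omega>"
    and "Eadj = hilbert_adjoint (Hm0 m \<Omega>) a (L2 \<Omega>) (L2_inner \<Omega>) (embedding (Hm0 m \<Omega>))"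
  shows "Eadj u \<in> Hm0 m \<Omega> \<and> (\<forall>v\<in>Hm0 m \<Omega>. a (Eadj u) v = L2_inner \<Omega> u v) \<and>
         (\<forall>z\<in>Hm0 m \<Omega>. (\<forall>v\<in>Hm0 m \<Omega>. a z v = L2_inner \<Omega> u v) \<longrightarrow> z = Eadj u)"
  by (rule H.adjoint_of_closed_subspace_embedding[OF Hm0_L2_subspace Hm0_sub Hm0_closed assms])

end

section \<open>Continuity of translations\<close>

lemma integrable_translation:
  fixes f :: "'a::euclidean_space \<Rightarrow> 'b::{banach, second_countable_topology}"
  assumes "integrable lborel f"
  shows "integrable lborel (\<lambda>x. f (x + c))"
proof -
  have "integrable (distr lborel borel ((+) c)) f" using assms by (simp add: lborel_distr_plus)
  then have "integrable lborel (\<lambda>x. f (c + x))" by (rule integrable_distr[rotated]) simp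
  then show ?thesis by (simp add: add.commute)
qed

lemma norm_add_diff_le: "norm (a + b - c) \<le> norm a + norm b + norm (c :: 'a :: real_normed_vector)"
  by (rule order_trans[OF norm_triangle_ineq4]) (simp add: norm_triangle_ineq)

text \<open>
  The \<open>L\<^sub>1\<close> distance of \<open>f\<close> from its translate by \<open>c\<close>.
\<close>

definition L1_modulus :: "('a::euclidean_space \<Rightarrow> 'b::{banach, second_countable_topology}) \<Rightarrow> 'a \<Rightarrow> real" where
  "L1_modulus f c = (\<integral>x. norm (f (x + c) - f x) \<partial>lborel)"

lemma L1_modulus_le:
  fixes f g :: "'a::euclidean_space \<Rightarrow> 'b::{banach, second_countable_topology}"
  assumes f: "integrable lborel f" and g: "integrable lborel g"
  shows "L1_modulus f c \<le> 2 * (\<integral>x. norm (f x - g x) \<partial>lborel) + L1_modulus g c"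
proof -
  note ft = integrable_translation[OF f, of c] and gt = integrable_translation[OF g, of c]
  have "L1_modulus f c \<le> (\<integral>x. norm (f (x + c) - g (x + c)) + norm (g (x + c) - g x) + norm (f x - g x) \<partial>lborel)"
    unfolding L1_modulus_def
  proof (rule integral_mono)
    fix x
    show "norm (f (x + c) - f x) \<le> norm (f (x + c) - g (x + c)) + norm (g (x + c) - g x) + norm (f x - g x)"
      using norm_add_diff_le[of "f (x + c) - g (x + c)" "g (x + c) - g x" "f x - g x"] by simp
  qed (intro Bochner_Integration.integrable_add Bochner_Integration.integrable_diff integrable_norm f g ft gt)+
  also have "\<dots> = (\<integral>x. norm (f (x + c) - g (x + c)) \<partial>lborel) + L1_modulus g c + (\<integral>x. norm (f x - g x) \<partial>lborel)"
    unfolding L1_modulus_def using f g ft gt by simp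
  also have "(\<integral>x. norm (f (x + c) - g (x + c)) \<partial>lborel) = (\<integral>x. norm (f x - g x) \<partial>lborel)"
    using borel_measurable_integrable[OF f] borel_measurable_integrable[OF g]
    by (intro integral_translation[of "\<lambda>x. norm (f x - g x)"]) simp
  finally show ?thesis by simp
qed

lemma L1_modulus_nonneg: "0 \<le> L1_modulus f c"
  by (simp add: L1_modulus_def)

lemma L1_modulus_tendsto_approx:
  fixes f :: "'a::euclidean_space \<Rightarrow> 'b::{banach, second_countable_topology}"
  assumes f: "integrable lborel f"
    and approx: "\<And>e. e > 0 \<Longrightarrow> \<exists>g. integrable lborel g \<and> (\<lambda>n. L1_modulus g (c n)) \<longlonglongrightarrow> 0 \<and> (\<integral>x. norm (f x - g x) \<partial>lborel) < e"
  shows "(\<lambda>n::nat. L1_modulus f (c n)) \<longlonglongrightarrow> 0"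
proof (rule LIMSEQ_I)
  fix e :: real assume e: "e > 0"
  then obtain g where g: "integrable lborel g" "(\<lambda>n. L1_modulus g (c n)) \<longlonglongrightarrow> 0" "(\<integral>x. norm (f x - g x) \<partial>lborel) < e / 4"
    using approx[of "e / 4"] by auto
  obtain N where N: "\<And>n. n \<ge> N \<Longrightarrow> norm (L1_modulus g (c n) - 0) < e / 2"
    using LIMSEQ_D[OF g(2), of "e / 2"] e by auto
  have "norm (L1_modulus f (c n) - 0) < e" if "n \<ge> N" for n
    using N[OF that] L1_modulus_le[OF f g(1), of "c n"] g(3) L1_modulus_nonneg[of f "c n"] by auto
  then show "\<exists>N. \<forall>n\<ge>N. norm (L1_modulus f (c n) - 0) < e" by blast
qed

text \<open>
  The modulus is \<open>2 |U| - 2 |U \<inter> (U - c)|\<close>, and for open \<open>U\<close> the measure of the intersection tends to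
  \<open>|U|\<close> by dominated convergence.
\<close>

lemma L1_modulus_open:
  fixes U :: "'a::euclidean_space set"
  assumes "open U" and fin: "emeasure lborel U < \<infinity>" and c: "c \<longlonglongrightarrow> 0"
  shows "(\<lambda>n::nat. L1_modulus (indicator U :: 'a \<Rightarrow> real) (c n)) \<longlonglongrightarrow> 0"
proof -
  have [measurable]: "U \<in> sets borel" using assms(1) by simp
  let ?i = "indicator U :: 'a \<Rightarrow> real"
  have i: "integrable lborel ?i" using fin by (intro integrable_real_indicator) auto
  have prod: "integrable lborel (\<lambda>x. ?i x * ?i (x + c n))" for n
    by (rule Bochner_Integration.integrable_bound[OF i]) (auto simp: indicator_def)
  have "(\<lambda>n. \<integral>x. ?i x * ?i (x + c n) \<partial>lborel) \<longlonglongrightarrow> (\<integral>x. ?i x \<partial>lborel)"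
  proof (rule integral_dominated_convergence[OF _ _ i])
    show "AE x in lborel. (\<lambda>n. ?i x * ?i (x + c n)) \<longlonglongrightarrow> ?i x"
    proof (intro AE_I2)
      fix x
      show "(\<lambda>n. ?i x * ?i (x + c n)) \<longlonglongrightarrow> ?i x"
      proof (cases "x \<in> U")
        case True
        have "(\<lambda>n. x + c n) \<longlonglongrightarrow> x + 0" by (intro tendsto_intros c)
        then have "\<forall>\<^sub>F n in sequentially. x + c n \<in> U"
          using topological_tendstoD[of "\<lambda>n. x + c n" x sequentially U] True assms(1) by simp
        then have "\<forall>\<^sub>F n in sequentially. ?i x * ?i (x + c n) = ?i x"
          by eventually_elim (use True in simp)
        then show ?thesis by (rule tendsto_eventually)
      qed simp
    qed
    show "AE x in lborel. norm (?i x * ?i (x + c n)) \<le> ?i x" for n by (auto simp: indicator_def)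
  qed measurable
  then have "(\<lambda>n. 2 * (\<integral>x. ?i x \<partial>lborel) - 2 * (\<integral>x. ?i x * ?i (x + c n) \<partial>lborel)) \<longlonglongrightarrow> 2 * (\<integral>x. ?i x \<partial>lborel) - 2 * (\<integral>x. ?i x \<partial>lborel)"
    by (intro tendsto_intros)
  moreover have "L1_modulus ?i (c n) = 2 * (\<integral>x. ?i x \<partial>lborel) - 2 * (\<integral>x. ?i x * ?i (x + c n) \<partial>lborel)" for n
  proof -
    have "L1_modulus ?i (c n) = (\<integral>x. ?i x + ?i (x + c n) - 2 * (?i x * ?i (x + c n)) \<partial>lborel)"
      unfolding L1_modulus_def by (rule Bochner_Integration.integral_cong) (auto simp: indicator_def)
    also have "\<dots> = (\<integral>x. ?i x \<partial>lborel) + (\<integral>x. ?i (x + c n) \<partial>lborel) - 2 * (\<integral>x. ?i x * ?i (x + c n) \<partial>lborel)"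
      using i integrable_translation[OF i] prod by simp
    also have "(\<integral>x. ?i (x + c n) \<partial>lborel) = (\<integral>x. ?i x \<partial>lborel)"
      by (rule integral_translation) simp
    finally show ?thesis by simp
  qed
  ultimately show ?thesis by simp
qed

theorem L1_modulus_tendsto:
  fixes f :: "'a::euclidean_space \<Rightarrow> 'b::{banach, second_countable_topology}"
  assumes "integrable lborel f" and c: "c \<longlonglongrightarrow> 0"
  shows "(\<lambda>n::nat. L1_modulus f (c n)) \<longlonglongrightarrow> 0"
  using assms(1)
proof (induct f rule: integrable_induct)
  case (base A k)
  have A: "A \<in> sets borel" using base by simp
  have ind: "integrable lborel (\<lambda>x. indicator B x *\<^sub>R k)" if "B \<in> sets borel" "emeasure lborel B < \<infinity>" for B
    using that by (intro integrable_scaleR_left integrable_real_indicator) auto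
  show ?case
  proof (rule L1_modulus_tendsto_approx[OF ind[OF A base(2)]])
    fix e :: real assume "e > 0"
    define e' where "e' = e / (norm k + 1)"
    have pos: "norm k + 1 > 0" by (simp add: add_nonneg_pos)
    then have "e' > 0" using \<open>e > 0\<close> by (simp add: e'_def)
    have "A \<in> sets lebesgue" using A by simp
    then obtain U where U: "open U" "A \<subseteq> U" "emeasure lebesgue (U - A) < ennreal e'"
      using sets_lebesgue_outer_open[OF _ \<open>e' > 0\<close>] by metis
    have Ub: "U \<in> sets borel" using U(1) by simp
    have d: "emeasure lborel (U - A) < ennreal e'" using U(3) Ub A by simp
    have "emeasure lborel U = emeasure lborel A + emeasure lborel (U - A)"
      using plus_emeasure[of A lborel "U - A"] A Ub U(2) by (simp add: Un_absorb1)
    then have Ufin: "emeasure lborel U < \<infinity>"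
      using base(2) d by (simp add: less_top[symmetric]) (metis order_less_trans ennreal_less_top less_top)
    have "(\<integral>x. norm (indicator A x *\<^sub>R k - indicator U x *\<^sub>R k) \<partial>lborel) = (\<integral>x. indicator (U - A) x * norm k \<partial>lborel)"
      using U(2) by (intro Bochner_Integration.integral_cong) (auto simp: indicator_def)
    also have "\<dots> = measure lborel (U - A) * norm k"
      using d by (simp add: A Ub)
    also have "\<dots> \<le> e' * norm k"
    proof (rule mult_right_mono)
      have "measure lborel (U - A) < e'" using d \<open>e' > 0\<close>
        by (metis emeasure_eq_ennreal_measure ennreal_less_iff measure_nonneg top.not_eq_extremum order_less_trans ennreal_less_top)
      then show "measure lborel (U - A) \<le> e'" by simp
    qed simp
    also have "\<dots> < e" using pos \<open>e > 0\<close> by (simp add: e'_def field_simps)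
    finally have close: "(\<integral>x. norm (indicator A x *\<^sub>R k - indicator U x *\<^sub>R k) \<partial>lborel) < e" .
    have "L1_modulus (\<lambda>x. indicator U x *\<^sub>R k) y = L1_modulus (indicator U :: 'a \<Rightarrow> real) y * norm k" for y
      unfolding L1_modulus_def by (simp flip: scaleR_diff_left)
    then have "(\<lambda>n. L1_modulus (\<lambda>x. indicator U x *\<^sub>R k) (c n)) \<longlonglongrightarrow> 0"
      using tendsto_mult_right[OF L1_modulus_open[OF U(1) Ufin c], of "norm k"] by simp
    then show "\<exists>g. integrable lborel g \<and> (\<lambda>n. L1_modulus g (c n)) \<longlonglongrightarrow> 0 \<and>
        (\<integral>x. norm (indicator A x *\<^sub>R k - g x) \<partial>lborel) < e"
      using ind[OF Ub Ufin] close by blast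
  qed
next
  case (add f g)
  have "(\<lambda>n. L1_modulus f (c n) + L1_modulus g (c n)) \<longlonglongrightarrow> 0"
    using tendsto_add[OF add(2,4)] by simp
  then show ?case
  proof (rule Lim_null_comparison[rotated], intro always_eventually allI)
    fix n
    note t = integrable_translation[OF add(1), of "c n"] integrable_translation[OF add(3), of "c n"]
    have "L1_modulus (\<lambda>x. f x + g x) (c n) \<le> (\<integral>x. norm (f (x + c n) - f x) + norm (g (x + c n) - g x) \<partial>lborel)"
      unfolding L1_modulus_def
    proof (rule integral_mono)
      show "norm (f (x + c n) + g (x + c n) - (f x + g x)) \<le> norm (f (x + c n) - f x) + norm (g (x + c n) - g x)" for x
        using norm_triangle_ineq[of "f (x + c n) - f x" "g (x + c n) - g x"] by (simp add: algebra_simps)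
    qed (intro Bochner_Integration.integrable_add Bochner_Integration.integrable_diff integrable_norm add t)+
    also have "\<dots> = L1_modulus f (c n) + L1_modulus g (c n)"
      unfolding L1_modulus_def using add t by simp
    finally show "norm (L1_modulus (\<lambda>x. f x + g x) (c n)) \<le> L1_modulus f (c n) + L1_modulus g (c n)"
      using L1_modulus_nonneg[of "\<lambda>x. f x + g x"] by simp
  qed
next
  case (lim f s)
  note [measurable] = borel_measurable_integrable[OF lim(1)] borel_measurable_integrable[OF lim(5)]
  have "(\<lambda>i. \<integral>x. norm (f x - s i x) \<partial>lborel) \<longlonglongrightarrow> (\<integral>x. 0 \<partial>(lborel :: 'a measure))"
  proof (rule integral_dominated_convergence)
    show "integrable lborel (\<lambda>x. 3 * norm (f x))" using lim(5) by simp
    show "AE x in lborel. (\<lambda>i. norm (f x - s i x)) \<longlonglongrightarrow> 0"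
    proof (intro AE_I2)
      fix x
      have "(\<lambda>i. norm (f x - s i x)) \<longlonglongrightarrow> norm (f x - f x)"
        by (intro tendsto_intros lim(3)) simp
      then show "(\<lambda>i. norm (f x - s i x)) \<longlonglongrightarrow> 0" by simp
    qed
    show "AE x in lborel. norm (norm (f x - s i x)) \<le> 3 * norm (f x)" for i
    proof (intro AE_I2)
      fix x show "norm (norm (f x - s i x)) \<le> 3 * norm (f x)"
        using norm_triangle_ineq4[of "f x" "s i x"] lim(4)[of x i] by simp
    qed
  qed measurable
  then have l: "(\<lambda>i. \<integral>x. norm (f x - s i x) \<partial>lborel) \<longlonglongrightarrow> 0" by simp
  show ?case
  proof (rule L1_modulus_tendsto_approx[OF lim(5)])
    fix e :: real assume "e > 0"
    then have "\<forall>\<^sub>F i in sequentially. (\<integral>x. norm (f x - s i x) \<partial>lborel) < e"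
      using order_tendstoD(2)[OF l] by blast
    then obtain i where "(\<integral>x. norm (f x - s i x) \<partial>lborel) < e"
      using eventually_happens'[OF sequentially_bot] by blast
    then show "\<exists>g. integrable lborel g \<and> (\<lambda>n. L1_modulus g (c n)) \<longlonglongrightarrow> 0 \<and> (\<integral>x. norm (f x - g x) \<partial>lborel) < e"
      using lim(1,2) by blast
  qed
qed

lemma integrable_sq_diff:
  fixes f g :: "'a \<Rightarrow> complex"
  assumes "f \<in> borel_measurable M" "g \<in> borel_measurable M"
    "integrable M (\<lambda>x. (cmod (f x))\<^sup>2)" "integrable M (\<lambda>x. (cmod (g x))\<^sup>2)"
  shows "integrable M (\<lambda>x. (cmod (f x - g x))\<^sup>2)"
proof (rule Bochner_Integration.integrable_bound)
  show "integrable M (\<lambda>x. 2 * (cmod (f x))\<^sup>2 + 2 * (cmod (g x))\<^sup>2)" using assms by simp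
  show "AE x in M. norm ((cmod (f x - g x))\<^sup>2) \<le> norm (2 * (cmod (f x))\<^sup>2 + 2 * (cmod (g x))\<^sup>2)"
    using norm_add_sq_le[of "f _" "- g _"] by (intro AE_I2) auto
qed (use assms in measurable)

text \<open>
  The squared \<open>L\<^sub>2\<close> distance of \<open>f\<close> from its translate by \<open>c\<close>.
\<close>

definition L2_modulus :: "('a::euclidean_space \<Rightarrow> complex) \<Rightarrow> 'a \<Rightarrow> real" where
  "L2_modulus f c = (\<integral>x. (cmod (f (x + c) - f x))\<^sup>2 \<partial>lborel)"

lemma L2_modulus_bounds:
  fixes f :: "'a::euclidean_space \<Rightarrow> complex"
  assumes [measurable]: "f \<in> borel_measurable borel" and sq: "integrable lborel (\<lambda>x. (cmod (f x))\<^sup>2)"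
  shows "0 \<le> L2_modulus f c" "L2_modulus f c \<le> 4 * (\<integral>x. (cmod (f x))\<^sup>2 \<partial>lborel)"
proof -
  have t: "integrable lborel (\<lambda>x. (cmod (f (x + c)))\<^sup>2)" using integrable_translation[OF sq] .
  show "0 \<le> L2_modulus f c" by (simp add: L2_modulus_def)
  have "L2_modulus f c \<le> (\<integral>x. 2 * (cmod (f (x + c)))\<^sup>2 + 2 * (cmod (f x))\<^sup>2 \<partial>lborel)"
    unfolding L2_modulus_def
  proof (rule integral_mono)
    show "integrable lborel (\<lambda>x. (cmod (f (x + c) - f x))\<^sup>2)"
      by (rule integrable_sq_diff) (use t sq in auto)
    show "(cmod (f (x + c) - f x))\<^sup>2 \<le> 2 * (cmod (f (x + c)))\<^sup>2 + 2 * (cmod (f x))\<^sup>2" for x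
      using norm_add_sq_le[of "f (x + c)" "- f x"] by simp
  qed (use t sq in simp)
  also have "\<dots> = 2 * (\<integral>x. (cmod (f (x + c)))\<^sup>2 \<partial>lborel) + 2 * (\<integral>x. (cmod (f x))\<^sup>2 \<partial>lborel)"
    using t sq by simp
  also have "(\<integral>x. (cmod (f (x + c)))\<^sup>2 \<partial>lborel) = (\<integral>x. (cmod (f x))\<^sup>2 \<partial>lborel)"
    by (rule integral_translation[of "\<lambda>x. (cmod (f x))\<^sup>2"]) measurable
  finally show "L2_modulus f c \<le> 4 * (\<integral>x. (cmod (f x))\<^sup>2 \<partial>lborel)" by simp
qed

text \<open>
  For bounded \<open>f\<close> the \<open>L\<^sub>2\<close> modulus is controlled by the \<open>L\<^sub>1\<close> modulus; in general, values of modulus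
  above \<open>M\<close> are cut off.
\<close>

theorem L2_modulus_tendsto:
  fixes f :: "'a::euclidean_space \<Rightarrow> complex"
  assumes [measurable]: "f \<in> borel_measurable borel"
    and int: "integrable lborel f" and sq: "integrable lborel (\<lambda>x. (cmod (f x))\<^sup>2)" and c: "c \<longlonglongrightarrow> 0"
  shows "(\<lambda>n::nat. L2_modulus f (c n)) \<longlonglongrightarrow> 0"
proof -
  define g where "g M x = (if cmod (f x) \<le> real M then f x else 0)" for M x
  have [measurable]: "g M \<in> borel_measurable borel" for M unfolding g_def by measurable
  have gb: "cmod (g M x) \<le> real M" "cmod (g M x) \<le> cmod (f x)" for M x by (auto simp: g_def)
  have gint: "integrable lborel (g M)" for M
    by (rule Bochner_Integration.integrable_bound[OF int]) (auto simp: gb)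
  have gsq: "integrable lborel (\<lambda>x. (cmod (g M x))\<^sup>2)" for M
    by (rule Bochner_Integration.integrable_bound[OF sq]) (auto simp: gb intro!: power_mono)
  define r where "r M = (\<integral>x. (cmod (f x - g M x))\<^sup>2 \<partial>lborel)" for M
  have rint: "integrable lborel (\<lambda>x. (cmod (f x - g M x))\<^sup>2)" for M
    by (rule integrable_sq_diff) (use sq gsq in auto)
  have "r \<longlonglongrightarrow> (\<integral>x. 0 \<partial>(lborel :: 'a measure))"
    unfolding r_def
  proof (rule integral_dominated_convergence[OF _ _ sq])
    show "AE x in lborel. (\<lambda>M. (cmod (f x - g M x))\<^sup>2) \<longlonglongrightarrow> 0"
    proof (intro AE_I2 tendsto_eventually)
      fix x
      obtain N where N: "cmod (f x) \<le> real N" using real_arch_simple by blast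
      show "\<forall>\<^sub>F M in sequentially. (cmod (f x - g M x))\<^sup>2 = 0"
        using eventually_ge_at_top[of N] by (rule eventually_mono) (use N in \<open>auto simp: g_def\<close>)
    qed
    show "AE x in lborel. norm ((cmod (f x - g M x))\<^sup>2) \<le> (cmod (f x))\<^sup>2" for M
      by (auto simp: g_def)
  qed measurable
  then have r0: "r \<longlonglongrightarrow> 0" by simp
  have bound: "L2_modulus f y \<le> 6 * r M + 6 * real M * L1_modulus (g M) y" for M y
  proof -
    have ti: "integrable lborel (\<lambda>x. (cmod (f (x + y) - g M (x + y)))\<^sup>2)"
      using integrable_translation[OF rint[of M]] .
    have gi: "integrable lborel (\<lambda>x. cmod (g M (x + y) - g M x))"
      using integrable_translation[OF gint] gint by (intro integrable_norm Bochner_Integration.integrable_diff)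
    have "L2_modulus f y \<le> (\<integral>x. 3 * (cmod (f (x + y) - g M (x + y)))\<^sup>2 + 6 * real M * cmod (g M (x + y) - g M x) + 3 * (cmod (f x - g M x))\<^sup>2 \<partial>lborel)"
      unfolding L2_modulus_def
    proof (rule integral_mono)
      show "integrable lborel (\<lambda>x. (cmod (f (x + y) - f x))\<^sup>2)"
        by (rule integrable_sq_diff) (use integrable_translation[OF sq] sq in auto)
      fix x
      let ?a = "cmod (f (x + y) - g M (x + y))" and ?b = "cmod (g M (x + y) - g M x)" and ?c = "cmod (f x - g M x)"
      have "cmod (f (x + y) - f x) \<le> ?a + ?b + ?c"
        using norm_add_diff_le[of "f (x + y) - g M (x + y)" "g M (x + y) - g M x" "f x - g M x"] by simp
      then have "(cmod (f (x + y) - f x))\<^sup>2 \<le> (?a + ?b + ?c)\<^sup>2" by (intro power_mono) auto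
      also have "\<dots> \<le> 3 * ?a\<^sup>2 + 3 * ?b\<^sup>2 + 3 * ?c\<^sup>2"
        using sum_squares_bound[of ?a ?b] sum_squares_bound[of ?a ?c] sum_squares_bound[of ?b ?c]
        by (simp add: power2_eq_square algebra_simps)
      also have "?b\<^sup>2 \<le> 2 * real M * ?b"
      proof -
        have "?b \<le> 2 * real M"
          using norm_triangle_ineq4[of "g M (x + y)" "g M x"] gb(1)[of M x] gb(1)[of M "x + y"] by linarith
        then show ?thesis by (simp add: power2_eq_square mult_right_mono)
      qed
      finally show "(cmod (f (x + y) - f x))\<^sup>2 \<le> 3 * ?a\<^sup>2 + 6 * real M * ?b + 3 * ?c\<^sup>2" by simp
    qed (use ti gi rint in auto)
    also have "\<dots> = 3 * (\<integral>x. (cmod (f (x + y) - g M (x + y)))\<^sup>2 \<partial>lborel) + 6 * real M * L1_modulus (g M) y + 3 * r M"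
      using ti gi rint by (simp add: L1_modulus_def r_def)
    also have "(\<integral>x. (cmod (f (x + y) - g M (x + y)))\<^sup>2 \<partial>lborel) = r M"
      unfolding r_def by (rule integral_translation[of "\<lambda>x. (cmod (f x - g M x))\<^sup>2"]) measurable
    finally show ?thesis by simp
  qed
  show ?thesis
  proof (rule LIMSEQ_I)
    fix e :: real assume e: "e > 0"
    have "\<forall>\<^sub>F M in sequentially. r M < e / 12" using order_tendstoD(2)[OF r0, of "e / 12"] e by simp
    then obtain M where M: "r M < e / 12" using eventually_happens'[OF sequentially_bot] by blast
    have "(\<lambda>n. 6 * real M * L1_modulus (g M) (c n)) \<longlonglongrightarrow> 6 * real M * 0"
      by (intro tendsto_intros L1_modulus_tendsto gint c)
    then obtain N where N: "\<And>n. n \<ge> N \<Longrightarrow> norm (6 * real M * L1_modulus (g M) (c n) - 6 * real M * 0) < e / 2"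
      using LIMSEQ_D[of _ _ "e / 2"] e by (metis half_gt_zero)
    have "norm (L2_modulus f (c n) - 0) < e" if "n \<ge> N" for n
      using N[OF that] bound[of "c n" M] M L2_modulus_bounds(1)[OF assms(1) sq, of "c n"] by auto
    then show "\<exists>N. \<forall>n\<ge>N. norm (L2_modulus f (c n) - 0) < e" by blast
  qed
qed

section \<open>Gaussians\<close>

lemma
  fixes h :: "'a::euclidean_space \<Rightarrow> real \<Rightarrow> complex"
  assumes "\<And>b. b \<in> Basis \<Longrightarrow> integrable lborel (h b)"
  shows integrable_lborel_prod: "integrable lborel (\<lambda>x. \<Prod>b\<in>Basis. h b (x \<bullet> b))"
    and integral_lborel_prod: "(\<integral>x. (\<Prod>b\<in>Basis. h b (x \<bullet> b)) \<partial>lborel) = (\<Prod>b\<in>Basis. \<integral>t. h b t \<partial>lborel)"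
proof -
  interpret product_sigma_finite "\<lambda>b::'a. lborel :: real measure" ..
  have m[measurable]: "h b \<in> borel_measurable borel" if "b \<in> Basis" for b
    using borel_measurable_integrable[OF assms[OF that]] by simp
  have meas: "(\<lambda>x. \<Prod>b\<in>Basis. h b (x \<bullet> b)) \<in> borel_measurable borel"
    by (intro borel_measurable_prod measurable_compose[OF _ m]) auto
  have s: "(\<Sum>b'\<in>Basis. f b' *\<^sub>R b') \<bullet> b = f b" if "b \<in> Basis" for f :: "'a \<Rightarrow> real" and b
    using that by simp
  have eq: "(\<Prod>b\<in>Basis. h b ((\<Sum>b'\<in>Basis. f b' *\<^sub>R b') \<bullet> b)) = (\<Prod>b\<in>Basis. h b (f b))" for f :: "'a \<Rightarrow> real"
    by (intro prod.cong refl) (simp only: s)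
  have T: "(\<lambda>f::'a \<Rightarrow> real. \<Sum>b\<in>Basis. f b *\<^sub>R b) \<in> measurable (\<Pi>\<^sub>M b\<in>Basis. lborel) borel"
    by measurable
  show "integrable lborel (\<lambda>x. \<Prod>b\<in>Basis. h b (x \<bullet> b))"
    unfolding lborel_eq[where 'a='a] using product_integrable_prod[OF finite_Basis assms]
    by (subst integrable_distr_eq[OF T meas]) (simp only: eq)
  show "(\<integral>x. (\<Prod>b\<in>Basis. h b (x \<bullet> b)) \<partial>lborel) = (\<Prod>b\<in>Basis. \<integral>t. h b t \<partial>lborel)"
    unfolding lborel_eq[where 'a='a] using product_integral_prod[OF finite_Basis assms]
    by (subst integral_distr[OF T meas]) (simp only: eq)
qed

text \<open>
  The standard Gaussian density, as a product over the coordinates.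
\<close>

definition gauss :: "'a::euclidean_space \<Rightarrow> real" where
  "gauss y = (\<Prod>b\<in>Basis. std_normal_density (y \<bullet> b))"

lemma gauss_nonneg: "0 \<le> gauss y"
  unfolding gauss_def by (intro prod_nonneg) simp

lemma gauss_eq: "gauss (y :: 'a::euclidean_space) = (1 / sqrt (2 * pi)) ^ DIM('a) * exp (- (norm y)\<^sup>2 / 2)"
proof -
  have "gauss y = (\<Prod>b\<in>(Basis::'a set). 1 / sqrt (2 * pi)) * (\<Prod>b\<in>(Basis::'a set). exp (- (y \<bullet> b)\<^sup>2 / 2))"
    unfolding gauss_def std_normal_density_def prod.distrib ..
  also have "(\<Prod>b\<in>Basis. exp (- (y \<bullet> b)\<^sup>2 / 2)) = exp (\<Sum>b\<in>Basis. - (y \<bullet> b)\<^sup>2 / 2)"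
    by (simp add: exp_sum)
  also have "(\<Sum>b\<in>Basis. - (y \<bullet> b)\<^sup>2 / 2) = - (norm y)\<^sup>2 / 2"
    unfolding power2_norm_eq_inner euclidean_inner[of y y]
    by (simp add: power2_eq_square sum_negf sum_divide_distrib)
  finally show ?thesis by simp
qed

lemma gauss_fourier:
  fixes t :: "'a::euclidean_space"
  shows "integrable lborel (\<lambda>y. of_real (gauss y) * cis (t \<bullet> y))"
    and "(\<integral>y. of_real (gauss y) * cis (t \<bullet> y) \<partial>lborel) = of_real (exp (- (norm t)\<^sup>2 / 2))"
proof -
  define h where "h b x = complex_of_real (std_normal_density x) * cis ((t \<bullet> b) * x)" for b :: 'a and x
  have prod: "of_real (gauss y) * cis (t \<bullet> y) = (\<Prod>b\<in>Basis. h b (y \<bullet> b))" for y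
  proof -
    have "cis (t \<bullet> y) = exp (\<Sum>b\<in>Basis. \<i> * of_real ((t \<bullet> b) * (y \<bullet> b)))"
      unfolding cis_conv_exp euclidean_inner[of t y] of_real_sum sum_distrib_left ..
    also have "\<dots> = (\<Prod>b\<in>Basis. cis ((t \<bullet> b) * (y \<bullet> b)))"
      by (simp add: exp_sum cis_conv_exp)
    finally show ?thesis by (simp add: gauss_def h_def prod.distrib)
  qed
  have hi: "integrable lborel (h b)" for b
  proof (rule Bochner_Integration.integrable_bound)
    show "integrable lborel std_normal_density" using integrable_std_normal_moment[of 0] by simp
    show "h b \<in> borel_measurable lborel" unfolding h_def cis_conv_exp by measurable
    show "AE x in lborel. norm (h b x) \<le> norm (std_normal_density x)" by (simp add: h_def norm_mult)
  qed
  have hv: "(\<integral>x. h b x \<partial>lborel) = of_real (exp (- (t \<bullet> b)\<^sup>2 / 2))" for b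
  proof -
    have "of_real (exp (- (t \<bullet> b)\<^sup>2 / 2)) = char std_normal_distribution (t \<bullet> b)"
      by (simp add: char_std_normal_distribution)
    also have "\<dots> = (\<integral>x. std_normal_density x *\<^sub>R iexp ((t \<bullet> b) * x) \<partial>lborel)"
      unfolding char_def by (subst integral_density) auto
    also have "\<dots> = (\<integral>x. h b x \<partial>lborel)"
      by (simp add: h_def cis_conv_exp scaleR_conv_of_real)
    finally show ?thesis by simp
  qed
  show "integrable lborel (\<lambda>y. of_real (gauss y) * cis (t \<bullet> y))"
    unfolding prod by (rule integrable_lborel_prod[OF hi])
  have "(\<integral>y. of_real (gauss y) * cis (t \<bullet> y) \<partial>lborel) = (\<Prod>b\<in>Basis. of_real (exp (- (t \<bullet> b)\<^sup>2 / 2)))"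
    unfolding prod using integral_lborel_prod[of h, OF hi] by (simp only: hv)
  also have "\<dots> = of_real (exp (\<Sum>b\<in>Basis. - (t \<bullet> b)\<^sup>2 / 2))"
    by (simp add: exp_sum)
  also have "(\<Sum>b\<in>Basis. - (t \<bullet> b)\<^sup>2 / 2) = - (norm t)\<^sup>2 / 2"
    unfolding power2_norm_eq_inner euclidean_inner[of t t]
    by (simp add: power2_eq_square sum_negf sum_divide_distrib)
  finally show "(\<integral>y. of_real (gauss y) * cis (t \<bullet> y) \<partial>lborel) = of_real (exp (- (norm t)\<^sup>2 / 2))" .
qed

lemma gauss_integrable: "integrable lborel (gauss :: 'a::euclidean_space \<Rightarrow> real)"
  and gauss_integral: "(\<integral>y. gauss (y::'a) \<partial>lborel) = 1"
proof -
  have i: "integrable lborel (\<lambda>y::'a. complex_of_real (gauss y))" and v: "(\<integral>y. complex_of_real (gauss (y::'a)) \<partial>lborel) = 1"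
    using gauss_fourier[of "0::'a"] by simp_all
  show "integrable lborel (gauss :: 'a \<Rightarrow> real)" using i by (simp add: complex_of_real_integrable_eq)
  show "(\<integral>y. gauss (y::'a) \<partial>lborel) = 1" using v by (simp add: integral_complex_of_real)
qed

lemma
  fixes f :: "'a::euclidean_space \<Rightarrow> 'b::{banach, second_countable_topology}"
  assumes [measurable]: "f \<in> borel_measurable borel" and "c > 0"
  shows integral_scale: "(\<integral>x. f x \<partial>lborel) = c ^ DIM('a) *\<^sub>R (\<integral>x. f (c *\<^sub>R x) \<partial>lborel)"
    and integrable_scale: "integrable lborel f \<longleftrightarrow> integrable lborel (\<lambda>x. f (c *\<^sub>R x))"
proof -
  have l: "lborel = density (distr lborel borel (\<lambda>x::'a. c *\<^sub>R x)) (\<lambda>_. ennreal (c ^ DIM('a)))"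
    using lborel_affine[of c "0::'a"] assms(2) by simp
  show "(\<integral>x. f x \<partial>lborel) = c ^ DIM('a) *\<^sub>R (\<integral>x. f (c *\<^sub>R x) \<partial>lborel)"
    using assms(2) by (subst l) (simp add: integral_density integral_distr)
  have "integrable lborel f \<longleftrightarrow> integrable lborel (\<lambda>x. c ^ DIM('a) *\<^sub>R f (c *\<^sub>R x))"
    using assms(2) by (subst l) (simp add: integrable_density integrable_distr_eq)
  also have "\<dots> \<longleftrightarrow> integrable lborel (\<lambda>x. f (c *\<^sub>R x))"
  proof
    assume "integrable lborel (\<lambda>x. c ^ DIM('a) *\<^sub>R f (c *\<^sub>R x))"
    from integrable_scaleR_right[OF this, of "inverse (c ^ DIM('a))"]
    show "integrable lborel (\<lambda>x. f (c *\<^sub>R x))" using assms(2) by simp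
  qed (intro integrable_scaleR_right)
  finally show "integrable lborel f \<longleftrightarrow> integrable lborel (\<lambda>x. f (c *\<^sub>R x))" .
qed

section \<open>Plancherel's theorem for integrable functions\<close>

lemma cis_measurable[measurable]: "cis \<in> borel_measurable borel"
  unfolding cis_conv_exp by measurable

lemma integrable_pair_mult:
  fixes a :: "'a::euclidean_space \<Rightarrow> real" and b :: "'b::euclidean_space \<Rightarrow> real"
  assumes a: "integrable lborel a" and b: "integrable lborel b"
  shows "integrable (lborel \<Otimes>\<^sub>M lborel) (\<lambda>(x, y). a x * b y)"
proof (rule lborel_pair.Fubini_integrable)
  note [measurable] = borel_measurable_integrable[OF a] borel_measurable_integrable[OF b]
  show "(\<lambda>(x, y). a x * b y) \<in> borel_measurable (lborel \<Otimes>\<^sub>M lborel)" by measurable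
  have "(\<lambda>x. \<integral>y. norm (case (x, y) of (x, y) \<Rightarrow> a x * b y) \<partial>lborel) = (\<lambda>x. \<bar>a x\<bar> * (\<integral>y. \<bar>b y\<bar> \<partial>lborel))"
    by (simp add: abs_mult)
  then show "integrable lborel (\<lambda>x. \<integral>y. norm (case (x, y) of (x, y) \<Rightarrow> a x * b y) \<partial>lborel)"
    using a by simp
  show "AE x in lborel. integrable lborel (\<lambda>y. case (x, y) of (x, y) \<Rightarrow> a x * b y)"
    using b by simp
qed

lemma Fubini_bounded:
  fixes F :: "'a::euclidean_space \<Rightarrow> 'b::euclidean_space \<Rightarrow> complex"
  assumes F: "(\<lambda>(x, y). F x y) \<in> borel_measurable (lborel \<Otimes>\<^sub>M lborel)"
    and a: "integrable lborel a" and b: "integrable lborel b"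
    and le: "\<And>x y. cmod (F x y) \<le> a x * b y"
  shows "(\<integral>x. (\<integral>y. F x y \<partial>lborel) \<partial>lborel) = (\<integral>y. (\<integral>x. F x y \<partial>lborel) \<partial>lborel)"
proof -
  have "integrable (lborel \<Otimes>\<^sub>M lborel) (\<lambda>(x, y). F x y)"
  proof (rule Bochner_Integration.integrable_bound[OF integrable_pair_mult[OF a b] F])
    show "AE p in lborel \<Otimes>\<^sub>M lborel. norm (case p of (x, y) \<Rightarrow> F x y) \<le> norm (case p of (x, y) \<Rightarrow> a x * b y)"
      using le by (intro AE_I2) (auto intro: order_trans[OF _ abs_ge_self])
  qed
  then show ?thesis by (rule lborel_pair.Fubini_integral[symmetric])
qed

text \<open>
  The Fourier integral with respect to the Borel measure \<open>lborel\<close>, for which Fubini's theorem is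
  available. It is compared with \<open>fourier_integral\<close>, which uses the completed measure, in
  \<open>fourier_integral_Plancherel\<close>.
\<close>

definition FT :: "('a::euclidean_space \<Rightarrow> complex) \<Rightarrow> 'a \<Rightarrow> complex" where
  "FT f \<xi> = (\<integral>x. cis (- (2 * pi * (\<xi> \<bullet> x))) * f x \<partial>lborel)"

text \<open>
  The damping factor increases to 1 as \<open>l \<rightarrow> \<infinity>\<close>. Its Fourier transform is the density
  \<open>mollifier l\<close>, which concentrates at the origin.
\<close>

definition damp :: "real \<Rightarrow> 'a::euclidean_space \<Rightarrow> real" where
  "damp l \<xi> = exp (- (norm ((2 * pi / l) *\<^sub>R \<xi>))\<^sup>2 / 2)"

definition mollifier :: "real \<Rightarrow> 'a::euclidean_space \<Rightarrow> real" where
  "mollifier l z = l ^ DIM('a) * gauss (l *\<^sub>R z)"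

lemma gauss_measurable[measurable]: "gauss \<in> borel_measurable borel"
  unfolding gauss_def by measurable

lemma damp_measurable[measurable]: "damp l \<in> borel_measurable borel"
  unfolding damp_def by measurable

lemma mollifier_measurable[measurable]: "mollifier l \<in> borel_measurable borel"
  unfolding mollifier_def by measurable

lemma
  fixes z :: "'a::euclidean_space"
  assumes l: "l > 0"
  shows damp_cis_integrable: "integrable lborel (\<lambda>\<xi>. of_real (damp l \<xi>) * cis (- (2 * pi * (\<xi> \<bullet> z))))"
    and damp_fourier: "(\<integral>\<xi>. of_real (damp l \<xi>) * cis (- (2 * pi * (\<xi> \<bullet> z))) \<partial>lborel) = of_real (mollifier l z)"
proof -
  define c where "c = 2 * pi / l"
  define q where "q = 1 / sqrt (2 * pi)"
  define D where "D = DIM('a)"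
  have pos: "c > 0" "q > 0" "q ^ D \<noteq> 0" "c ^ D \<noteq> 0" using l by (simp_all add: c_def q_def)
  define t where "t = - (l *\<^sub>R z)"
  define g where "g y = of_real (gauss y) * cis (t \<bullet> y)" for y :: 'a
  have [measurable]: "g \<in> borel_measurable borel" unfolding g_def by measurable
  have gc: "g (c *\<^sub>R \<xi>) = of_real (q ^ D) * (of_real (damp l \<xi>) * cis (- (2 * pi * (\<xi> \<bullet> z))))" for \<xi>
  proof -
    have "t \<bullet> (c *\<^sub>R \<xi>) = - (2 * pi * (\<xi> \<bullet> z))"
      using l by (simp add: t_def c_def inner_commute)
    then show ?thesis by (simp add: g_def gauss_eq damp_def c_def q_def D_def)
  qed
  have gi: "integrable lborel g" and gv: "(\<integral>y. g y \<partial>lborel) = of_real (exp (- (norm t)\<^sup>2 / 2))"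
    unfolding g_def by (rule gauss_fourier)+
  have "integrable lborel (\<lambda>\<xi>. g (c *\<^sub>R \<xi>))" using gi pos by (simp add: integrable_scale[of g c])
  then have "integrable lborel (\<lambda>\<xi>. of_real (1 / q ^ D) * g (c *\<^sub>R \<xi>))" by (rule integrable_mult_right)
  then show "integrable lborel (\<lambda>\<xi>. of_real (damp l \<xi>) * cis (- (2 * pi * (\<xi> \<bullet> z))))"
    unfolding gc using pos by simp
  have "of_real (exp (- (norm t)\<^sup>2 / 2)) = c ^ D *\<^sub>R (\<integral>\<xi>. g (c *\<^sub>R \<xi>) \<partial>lborel)"
    unfolding gv[symmetric] D_def by (rule integral_scale) (use pos in auto)
  also have "\<dots> = of_real (c ^ D * q ^ D) * (\<integral>\<xi>. of_real (damp l \<xi>) * cis (- (2 * pi * (\<xi> \<bullet> z))) \<partial>lborel)"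
    unfolding gc by (simp add: scaleR_conv_of_real mult.assoc)
  finally have e1: "of_real (exp (- (norm t)\<^sup>2 / 2)) = of_real (c ^ D * q ^ D) *
      (\<integral>\<xi>. of_real (damp l \<xi>) * cis (- (2 * pi * (\<xi> \<bullet> z))) \<partial>lborel)" .
  have "mollifier l z = l ^ D * q ^ D * exp (- (norm t)\<^sup>2 / 2)"
    by (simp add: mollifier_def gauss_eq t_def q_def D_def)
  moreover have "l ^ D * q ^ D * (c ^ D * q ^ D) = 1"
  proof -
    have "l * q * (c * q) = 1" using l by (simp add: c_def q_def)
    then have "(l * q * (c * q)) ^ D = 1" by simp
    then show ?thesis by (simp add: power_mult_distrib)
  qed
  ultimately have "mollifier l z * (c ^ D * q ^ D) = exp (- (norm t)\<^sup>2 / 2)"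
    by (simp add: mult.assoc mult.left_commute mult.commute)
  then have "of_real (mollifier l z) * of_real (c ^ D * q ^ D) = complex_of_real (exp (- (norm t)\<^sup>2 / 2))"
    by (simp flip: of_real_mult)
  then have "of_real (c ^ D * q ^ D) * (\<integral>\<xi>. of_real (damp l \<xi>) * cis (- (2 * pi * (\<xi> \<bullet> z))) \<partial>lborel)
      = complex_of_real (c ^ D * q ^ D) * of_real (mollifier l z)"
    unfolding e1[symmetric] by (simp only: mult.commute)
  moreover have "complex_of_real (c ^ D * q ^ D) \<noteq> 0" using pos by simp
  ultimately show "(\<integral>\<xi>. of_real (damp l \<xi>) * cis (- (2 * pi * (\<xi> \<bullet> z))) \<partial>lborel) = of_real (mollifier l z)"
    using mult_left_cancel by blast
qed

lemma damp_integrable: "l > 0 \<Longrightarrow> integrable lborel (damp l :: 'a::euclidean_space \<Rightarrow> real)"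
  using damp_cis_integrable[of l "0::'a"] by (simp add: complex_of_real_integrable_eq)

lemma damp_bounds: "0 \<le> damp l \<xi>" "damp l \<xi> \<le> 1"
  by (simp_all add: damp_def)

lemma mollifier_nonneg: "l > 0 \<Longrightarrow> 0 \<le> mollifier l z"
  by (simp add: mollifier_def gauss_nonneg)

lemma mollifier_integrable:
  assumes "l > 0" shows "integrable lborel (mollifier l :: 'a::euclidean_space \<Rightarrow> real)"
  unfolding mollifier_def using gauss_integrable[where 'a='a] assms
  by (intro integrable_mult_right) (simp add: integrable_scale[of gauss l])

lemma FT_bound: "cmod (FT f \<xi>) \<le> (\<integral>x. cmod (f x) \<partial>lborel)"
  unfolding FT_def using integral_norm_bound[of lborel "\<lambda>x. cis (- (2 * pi * (\<xi> \<bullet> x))) * f x"]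
  by (simp add: norm_mult)

lemma FT_measurable[measurable]:
  assumes [measurable]: "f \<in> borel_measurable borel"
  shows "FT f \<in> borel_measurable borel"
proof -
  have "(\<lambda>\<xi>. \<integral>x. cis (- (2 * pi * (\<xi> \<bullet> x))) * f x \<partial>lborel) \<in> borel_measurable borel"
    by measurable
  then show ?thesis unfolding FT_def[abs_def] .
qed

context
  fixes f :: "'a::euclidean_space \<Rightarrow> complex"
  assumes f_meas[measurable]: "f \<in> borel_measurable borel"
    and f_int: "integrable lborel f"
    and f_sq: "integrable lborel (\<lambda>x. (cmod (f x))\<^sup>2)"
begin

text \<open>
  The autocorrelation of \<open>f\<close>; its real part is \<open>\<parallel>f\<parallel>\<^sup>2 - \<parallel>f (\<cdot> + z) - f\<parallel>\<^sup>2 / 2\<close>.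
\<close>

definition correlation :: "'a \<Rightarrow> complex" where
  "correlation z = (\<integral>y. f (y + z) * cnj (f y) \<partial>lborel)"

lemma shift_mult_integrable: "integrable lborel (\<lambda>y. f (y + z) * cnj (f y))"
  and shift_mult_norm_le: "(\<integral>y. cmod (f (y + z) * cnj (f y)) \<partial>lborel) \<le> (\<integral>x. (cmod (f x))\<^sup>2 \<partial>lborel)"
proof -
  let ?b = "\<lambda>y. ((cmod (f (y + z)))\<^sup>2 + (cmod (f y))\<^sup>2) / 2"
  have b: "integrable lborel ?b" using integrable_translation[OF f_sq, of z] f_sq by simp
  have le: "cmod (f (y + z) * cnj (f y)) \<le> ?b y" for y
    using sum_squares_bound[of "cmod (f (y + z))" "cmod (f y)"] by (simp add: norm_mult mult.assoc)
  show i: "integrable lborel (\<lambda>y. f (y + z) * cnj (f y))"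
    by (rule Bochner_Integration.integrable_bound[OF b]) (use le in \<open>auto intro: order_trans[OF _ abs_ge_self]\<close>)
  have "(\<integral>y. cmod (f (y + z) * cnj (f y)) \<partial>lborel) \<le> (\<integral>y. ?b y \<partial>lborel)"
    by (rule integral_mono[OF integrable_norm[OF i] b le])
  also have "\<dots> = ((\<integral>y. (cmod (f (y + z)))\<^sup>2 \<partial>lborel) + (\<integral>y. (cmod (f y))\<^sup>2 \<partial>lborel)) / 2"
    using integrable_translation[OF f_sq, of z] f_sq by simp
  also have "(\<integral>y. (cmod (f (y + z)))\<^sup>2 \<partial>lborel) = (\<integral>y. (cmod (f y))\<^sup>2 \<partial>lborel)"
    by (rule integral_translation[of "\<lambda>y. (cmod (f y))\<^sup>2"]) measurable
  finally show "(\<integral>y. cmod (f (y + z) * cnj (f y)) \<partial>lborel) \<le> (\<integral>x. (cmod (f x))\<^sup>2 \<partial>lborel)" by simp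
qed

lemma Re_correlation: "Re (correlation z) = (\<integral>x. (cmod (f x))\<^sup>2 \<partial>lborel) - L2_modulus f z / 2"
proof -
  let ?A = "\<integral>x. (cmod (f x))\<^sup>2 \<partial>lborel"
  have t: "integrable lborel (\<lambda>y. (cmod (f (y + z)))\<^sup>2)" by (rule integrable_translation[OF f_sq])
  define h where "h y = Re (f (y + z) * cnj (f y))" for y
  have r: "integrable lborel h"
    unfolding h_def using shift_mult_integrable[of z] by (rule integrable_Re)
  have eq: "(cmod (f (y + z) - f y))\<^sup>2 = (cmod (f (y + z)))\<^sup>2 + (cmod (f y))\<^sup>2 - 2 * h y" for y
    unfolding cmod_power2 h_def by (simp add: power2_eq_square algebra_simps)
  have "L2_modulus f z = (\<integral>y. (cmod (f (y + z)))\<^sup>2 \<partial>lborel) + ?A - 2 * (\<integral>y. h y \<partial>lborel)"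
    unfolding L2_modulus_def eq using t f_sq r by simp
  also have "(\<integral>y. (cmod (f (y + z)))\<^sup>2 \<partial>lborel) = ?A"
    by (rule integral_translation[of "\<lambda>y. (cmod (f y))\<^sup>2"]) measurable
  also have "(\<integral>y. h y \<partial>lborel) = Re (correlation z)"
    unfolding correlation_def h_def by (rule integral_Re[OF shift_mult_integrable])
  finally show ?thesis by (simp add: field_simps)
qed

lemma damped_inverse:
  assumes l: "l > 0"
  shows "(\<integral>\<xi>. of_real (damp l \<xi>) * FT f \<xi> * cis (2 * pi * (\<xi> \<bullet> y)) \<partial>lborel) = (\<integral>z. of_real (mollifier l z) * f (y + z) \<partial>lborel)"
proof -
  have "(\<integral>\<xi>. of_real (damp l \<xi>) * FT f \<xi> * cis (2 * pi * (\<xi> \<bullet> y)) \<partial>lborel) =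
     (\<integral>\<xi>. (\<integral>x. of_real (damp l \<xi>) * cis (- (2 * pi * (\<xi> \<bullet> (x - y)))) * f x \<partial>lborel) \<partial>lborel)"
  proof (rule Bochner_Integration.integral_cong[OF refl])
    fix \<xi>
    have "of_real (damp l \<xi>) * FT f \<xi> * cis (2 * pi * (\<xi> \<bullet> y)) =
        (\<integral>x. (of_real (damp l \<xi>) * cis (2 * pi * (\<xi> \<bullet> y))) * (cis (- (2 * pi * (\<xi> \<bullet> x))) * f x) \<partial>lborel)"
      unfolding FT_def by (subst integral_mult_right_zero) (simp add: mult_ac)
    also have "(\<lambda>x. (of_real (damp l \<xi>) * cis (2 * pi * (\<xi> \<bullet> y))) * (cis (- (2 * pi * (\<xi> \<bullet> x))) * f x)) =
        (\<lambda>x. of_real (damp l \<xi>) * cis (- (2 * pi * (\<xi> \<bullet> (x - y)))) * f x)"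
    proof
      fix x
      have "cis (2 * pi * (\<xi> \<bullet> y)) * cis (- (2 * pi * (\<xi> \<bullet> x))) = cis (- (2 * pi * (\<xi> \<bullet> (x - y))))"
        unfolding cis_mult by (simp add: inner_diff_right algebra_simps)
      then show "(of_real (damp l \<xi>) * cis (2 * pi * (\<xi> \<bullet> y))) * (cis (- (2 * pi * (\<xi> \<bullet> x))) * f x) =
          of_real (damp l \<xi>) * cis (- (2 * pi * (\<xi> \<bullet> (x - y)))) * f x"
        by (simp only: mult.assoc[symmetric]) (simp only: mult.assoc)
    qed
    finally show "of_real (damp l \<xi>) * FT f \<xi> * cis (2 * pi * (\<xi> \<bullet> y)) =
        (\<integral>x. of_real (damp l \<xi>) * cis (- (2 * pi * (\<xi> \<bullet> (x - y)))) * f x \<partial>lborel)" .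
  qed
  also have "\<dots> = (\<integral>x. (\<integral>\<xi>. of_real (damp l \<xi>) * cis (- (2 * pi * (\<xi> \<bullet> (x - y)))) * f x \<partial>lborel) \<partial>lborel)"
  proof (rule Fubini_bounded[OF _ damp_integrable[OF l] integrable_norm[OF f_int]])
    show "(\<lambda>(\<xi>, x). of_real (damp l \<xi>) * cis (- (2 * pi * (\<xi> \<bullet> (x - y)))) * f x) \<in> borel_measurable (lborel \<Otimes>\<^sub>M lborel)"
      by measurable
  qed (simp add: norm_mult damp_bounds)
  also have "\<dots> = (\<integral>x. of_real (mollifier l (x - y)) * f x \<partial>lborel)"
    by (simp add: damp_fourier[OF l])
  also have "\<dots> = (\<integral>z. of_real (mollifier l ((z + y) - y)) * f (z + y) \<partial>lborel)"
    by (rule integral_translation[symmetric, of "\<lambda>x. of_real (mollifier l (x - y)) * f x"]) measurable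
  also have "\<dots> = (\<integral>z. of_real (mollifier l z) * f (y + z) \<partial>lborel)"
    by (simp add: add.commute)
  finally show ?thesis .
qed

text \<open>
  Inserting the Fourier integrals and exchanging integrations turns the left-hand side into the
  integral of \<open>mollifier l\<close> against the autocorrelation; scaling the variable gives the right-hand side.
\<close>

lemma damped_norm:
  assumes l: "l > 0"
  shows "(\<integral>\<xi>. damp l \<xi> * (cmod (FT f \<xi>))\<^sup>2 \<partial>lborel) =
    (\<integral>y. gauss y * ((\<integral>x. (cmod (f x))\<^sup>2 \<partial>lborel) - L2_modulus f ((1 / l) *\<^sub>R y) / 2) \<partial>lborel)"
proof -
  let ?A = "\<integral>x. (cmod (f x))\<^sup>2 \<partial>lborel"
  have pair_int: "integrable (lborel \<Otimes>\<^sub>M lborel) (\<lambda>(z, y). of_real (mollifier l z) * (f (y + z) * cnj (f y)))"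
    proof (rule lborel_pair.Fubini_integrable)
      show "(\<lambda>(z, y). of_real (mollifier l z) * (f (y + z) * cnj (f y))) \<in> borel_measurable (lborel \<Otimes>\<^sub>M lborel)"
        by measurable
      show "AE z in lborel. integrable lborel (\<lambda>y. case (z, y) of (z, y) \<Rightarrow> of_real (mollifier l z) * (f (y + z) * cnj (f y)))"
        using shift_mult_integrable by simp
      have "integrable lborel (\<lambda>z. mollifier l z * (\<integral>y. cmod (f (y + z) * cnj (f y)) \<partial>lborel))"
      proof (rule Bochner_Integration.integrable_bound[OF integrable_mult_left[OF mollifier_integrable[OF l], of ?A]])
        show "AE z in lborel. norm (mollifier l z * (\<integral>y. cmod (f (y + z) * cnj (f y)) \<partial>lborel)) \<le> norm (mollifier l z * ?A)"
        proof (intro AE_I2)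
          fix z
          have "mollifier l z * (\<integral>y. cmod (f (y + z) * cnj (f y)) \<partial>lborel) \<le> mollifier l z * ?A"
            by (rule mult_left_mono[OF shift_mult_norm_le mollifier_nonneg[OF l]])
          moreover have "0 \<le> mollifier l z * (\<integral>y. cmod (f (y + z) * cnj (f y)) \<partial>lborel)"
            by (intro mult_nonneg_nonneg mollifier_nonneg l) simp
          ultimately show "norm (mollifier l z * (\<integral>y. cmod (f (y + z) * cnj (f y)) \<partial>lborel)) \<le> norm (mollifier l z * ?A)"
            by simp
        qed
      qed measurable
      then show "integrable lborel (\<lambda>z. \<integral>y. norm (case (z, y) of (z, y) \<Rightarrow> of_real (mollifier l z) * (f (y + z) * cnj (f y))) \<partial>lborel)"
        by (simp add: norm_mult abs_of_nonneg[OF mollifier_nonneg[OF l]])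
    qed
  have int: "integrable lborel (\<lambda>z. \<integral>y. of_real (mollifier l z) * (f (y + z) * cnj (f y)) \<partial>lborel)"
    using lborel_pair.integrable_fst'[OF pair_int] by simp
  have "of_real (\<integral>\<xi>. damp l \<xi> * (cmod (FT f \<xi>))\<^sup>2 \<partial>lborel) =
      (\<integral>\<xi>. of_real (damp l \<xi>) * FT f \<xi> * cnj (FT f \<xi>) \<partial>lborel)"
    unfolding integral_complex_of_real[symmetric] of_real_mult complex_norm_square mult.assoc ..
  also have "\<dots> = (\<integral>\<xi>. (\<integral>y. of_real (damp l \<xi>) * FT f \<xi> * cis (2 * pi * (\<xi> \<bullet> y)) * cnj (f y) \<partial>lborel) \<partial>lborel)"
  proof (rule Bochner_Integration.integral_cong[OF refl])
    fix \<xi>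
    have "cnj (FT f \<xi>) = (\<integral>y. cis (2 * pi * (\<xi> \<bullet> y)) * cnj (f y) \<partial>lborel)"
      unfolding FT_def by (subst Bochner_Integration.integral_cnj[symmetric]) (simp add: cis_cnj)
    then show "of_real (damp l \<xi>) * FT f \<xi> * cnj (FT f \<xi>) =
        (\<integral>y. of_real (damp l \<xi>) * FT f \<xi> * cis (2 * pi * (\<xi> \<bullet> y)) * cnj (f y) \<partial>lborel)"
      by (simp add: mult.assoc)
  qed
  also have "\<dots> = (\<integral>y. (\<integral>\<xi>. of_real (damp l \<xi>) * FT f \<xi> * cis (2 * pi * (\<xi> \<bullet> y)) * cnj (f y) \<partial>lborel) \<partial>lborel)"
  proof (rule Fubini_bounded[OF _ integrable_mult_left[OF damp_integrable[OF l]] integrable_norm[OF f_int]])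
    show "(\<lambda>(\<xi>, y). of_real (damp l \<xi>) * FT f \<xi> * cis (2 * pi * (\<xi> \<bullet> y)) * cnj (f y)) \<in> borel_measurable (lborel \<Otimes>\<^sub>M lborel)"
      by measurable
    show "cmod (of_real (damp l \<xi>) * FT f \<xi> * cis (2 * pi * (\<xi> \<bullet> y)) * cnj (f y)) \<le>
        damp l \<xi> * (\<integral>x. cmod (f x) \<partial>lborel) * cmod (f y)" for \<xi> y
      using FT_bound[of f \<xi>] damp_bounds[of l \<xi>] by (auto simp: norm_mult intro!: mult_right_mono mult_left_mono)
  qed
  also have "\<dots> = (\<integral>y. (\<integral>z. of_real (mollifier l z) * (f (y + z) * cnj (f y)) \<partial>lborel) \<partial>lborel)"
    using damped_inverse[OF l] by (simp flip: mult.assoc)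
  also have "\<dots> = (\<integral>z. (\<integral>y. of_real (mollifier l z) * (f (y + z) * cnj (f y)) \<partial>lborel) \<partial>lborel)"
    by (rule lborel_pair.Fubini_integral[OF pair_int])
  finally have "(\<integral>\<xi>. damp l \<xi> * (cmod (FT f \<xi>))\<^sup>2 \<partial>lborel) =
      Re (\<integral>z. (\<integral>y. of_real (mollifier l z) * (f (y + z) * cnj (f y)) \<partial>lborel) \<partial>lborel)"
    by (metis Re_complex_of_real)
  also have "\<dots> = (\<integral>z. Re (\<integral>y. of_real (mollifier l z) * (f (y + z) * cnj (f y)) \<partial>lborel) \<partial>lborel)"
    by (rule integral_Re[OF int, symmetric])
  also have "\<dots> = (\<integral>z. mollifier l z * (?A - L2_modulus f z / 2) \<partial>lborel)"
    unfolding integral_mult_right_zero by (simp add: Re_correlation flip: correlation_def)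
  also have "\<dots> = l ^ DIM('a) *\<^sub>R (\<integral>z. gauss (l *\<^sub>R z) * (?A - L2_modulus f ((1 / l) *\<^sub>R (l *\<^sub>R z)) / 2) \<partial>lborel)"
    using l by (simp add: mollifier_def mult.assoc)
  also have "\<dots> = (\<integral>y. gauss y * (?A - L2_modulus f ((1 / l) *\<^sub>R y) / 2) \<partial>lborel)"
  proof (rule integral_scale[symmetric, OF _ l])
    have [measurable]: "L2_modulus f \<in> borel_measurable borel" unfolding L2_modulus_def[abs_def] by measurable
    show "(\<lambda>y. gauss y * (?A - L2_modulus f ((1 / l) *\<^sub>R y) / 2)) \<in> borel_measurable borel" by measurable
  qed
  finally show ?thesis .
qed

theorem Plancherel_L1_L2:
  "(\<integral>\<^sup>+\<xi>. ennreal ((cmod (FT f \<xi>))\<^sup>2) \<partial>lborel) = (\<integral>\<^sup>+x. ennreal ((cmod (f x))\<^sup>2) \<partial>lborel)"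
proof -
  let ?A = "\<integral>x. (cmod (f x))\<^sup>2 \<partial>lborel"
  define I where "I n = (\<integral>\<xi>. damp (real (Suc n)) \<xi> * (cmod (FT f \<xi>))\<^sup>2 \<partial>lborel)" for n
  have mod[measurable]: "L2_modulus f \<in> borel_measurable borel" unfolding L2_modulus_def[abs_def] by measurable
  have "I \<longlonglongrightarrow> (\<integral>y. gauss (y::'a) * (?A - 0 / 2) \<partial>lborel)"
    unfolding I_def[abs_def] damped_norm[OF of_nat_0_less_iff[THEN iffD2, OF zero_less_Suc]]
  proof (rule integral_dominated_convergence)
    show "integrable lborel (\<lambda>y::'a. gauss y * (3 * ?A))"
      by (intro integrable_mult_left gauss_integrable)
    show "AE y in lborel. (\<lambda>n. gauss y * (?A - L2_modulus f ((1 / real (Suc n)) *\<^sub>R y) / 2)) \<longlonglongrightarrow> gauss y * (?A - 0 / 2)"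
    proof (intro AE_I2 tendsto_intros)
      fix y :: 'a
      have "(\<lambda>n. (1 / real (Suc n)) *\<^sub>R y) \<longlonglongrightarrow> 0 *\<^sub>R y"
        by (intro tendsto_intros LIMSEQ_Suc[OF lim_1_over_n])
      then show "(\<lambda>n. L2_modulus f ((1 / real (Suc n)) *\<^sub>R y)) \<longlonglongrightarrow> 0"
        by (intro L2_modulus_tendsto f_meas f_int f_sq) simp
    qed simp
    show "AE y in lborel. norm (gauss y * (?A - L2_modulus f ((1 / real (Suc n)) *\<^sub>R y) / 2)) \<le> gauss y * (3 * ?A)" for n
    proof (intro AE_I2)
      fix y :: 'a
      have "\<bar>?A - L2_modulus f ((1 / real (Suc n)) *\<^sub>R y) / 2\<bar> \<le> 3 * ?A"
        using L2_modulus_bounds[OF f_meas f_sq, of "(1 / real (Suc n)) *\<^sub>R y"] by linarith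
      then show "norm (gauss y * (?A - L2_modulus f ((1 / real (Suc n)) *\<^sub>R y) / 2)) \<le> gauss y * (3 * ?A)"
        using gauss_nonneg[of y] by (simp add: abs_mult mult_left_mono del: of_nat_Suc)
    qed
  qed measurable
  then have "I \<longlonglongrightarrow> ?A" using gauss_integral[where 'a='a] by simp
  then have lim1: "(\<lambda>n. ennreal (I n)) \<longlonglongrightarrow> ennreal ?A" by (rule tendsto_ennrealI)
  have I: "ennreal (I n) = (\<integral>\<^sup>+\<xi>. ennreal (damp (real (Suc n)) \<xi> * (cmod (FT f \<xi>))\<^sup>2) \<partial>lborel)" for n
    unfolding I_def
  proof (rule nn_integral_eq_integral[symmetric])
    let ?B = "\<integral>x. cmod (f x) \<partial>lborel"
    have di: "integrable lborel (\<lambda>\<xi>::'a. damp (real (Suc n)) \<xi> * ?B\<^sup>2)"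
      by (intro integrable_mult_left damp_integrable) simp
    show "integrable lborel (\<lambda>\<xi>. damp (real (Suc n)) \<xi> * (cmod (FT f \<xi>))\<^sup>2)"
    proof (rule Bochner_Integration.integrable_bound[OF di])
      show "AE \<xi> in lborel. norm (damp (real (Suc n)) \<xi> * (cmod (FT f \<xi>))\<^sup>2) \<le> norm (damp (real (Suc n)) \<xi> * ?B\<^sup>2)"
        using FT_bound[of f] damp_bounds by (auto simp: abs_mult intro!: AE_I2 mult_left_mono power_mono)
    qed auto
  qed (simp add: damp_bounds)
  have "(\<lambda>n. \<integral>\<^sup>+\<xi>. ennreal (damp (real (Suc n)) \<xi> * (cmod (FT f \<xi>))\<^sup>2) \<partial>lborel) \<longlonglongrightarrow> (\<integral>\<^sup>+\<xi>. ennreal ((cmod (FT f \<xi>))\<^sup>2) \<partial>lborel)"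
  proof (rule nn_integral_LIMSEQ)
    have mono: "damp (real (Suc m)) \<xi> \<le> damp (real (Suc n)) \<xi>" if "m \<le> n" for m n and \<xi> :: 'a
    proof -
      have le: "2 * pi / real (Suc n) \<le> 2 * pi / real (Suc m)" using that by (intro divide_left_mono) auto
      have "norm ((2 * pi / real (Suc n)) *\<^sub>R \<xi>) \<le> norm ((2 * pi / real (Suc m)) *\<^sub>R \<xi>)"
        using mult_right_mono[OF le norm_ge_zero[of \<xi>]] by (simp del: of_nat_Suc)
      then have "(norm ((2 * pi / real (Suc n)) *\<^sub>R \<xi>))\<^sup>2 \<le> (norm ((2 * pi / real (Suc m)) *\<^sub>R \<xi>))\<^sup>2"
        by (intro power_mono) auto
      then show ?thesis by (simp add: damp_def del: of_nat_Suc norm_scaleR)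
    qed
    show "incseq (\<lambda>n \<xi>. ennreal (damp (real (Suc n)) \<xi> * (cmod (FT f \<xi>))\<^sup>2))"
      by (auto simp: incseq_def le_fun_def simp del: of_nat_Suc intro!: ennreal_leI mult_right_mono mono)
    fix \<xi> :: 'a
    have "(\<lambda>n. exp (- (norm ((2 * pi * (1 / real (Suc n))) *\<^sub>R \<xi>))\<^sup>2 / 2)) \<longlonglongrightarrow> exp (- (norm ((2 * pi * 0) *\<^sub>R \<xi>))\<^sup>2 / 2)"
      by (intro tendsto_intros LIMSEQ_Suc[OF lim_1_over_n]) auto
    then have "(\<lambda>n. damp (real (Suc n)) \<xi>) \<longlonglongrightarrow> 1" by (simp add: damp_def)
    then have "(\<lambda>n. damp (real (Suc n)) \<xi> * (cmod (FT f \<xi>))\<^sup>2) \<longlonglongrightarrow> 1 * (cmod (FT f \<xi>))\<^sup>2"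
      by (intro tendsto_intros)
    then show "(\<lambda>n. ennreal (damp (real (Suc n)) \<xi> * (cmod (FT f \<xi>))\<^sup>2)) \<longlonglongrightarrow> ennreal ((cmod (FT f \<xi>))\<^sup>2)"
      by (intro tendsto_ennrealI) simp
  qed measurable
  then have "(\<integral>\<^sup>+\<xi>. ennreal ((cmod (FT f \<xi>))\<^sup>2) \<partial>lborel) = ennreal ?A"
    using LIMSEQ_unique lim1 unfolding I by blast
  also have "\<dots> = (\<integral>\<^sup>+x. ennreal ((cmod (f x))\<^sup>2) \<partial>lborel)"
    using f_sq by (intro nn_integral_eq_integral[symmetric]) auto
  finally show ?thesis .
qed

end

section \<open>The Fourier transform on L2\<close>

lemma borel_representative:
  fixes g :: "'a::euclidean_space \<Rightarrow> complex"
  assumes "g \<in> borel_measurable lebesgue"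
  obtains f where "f \<in> borel_measurable borel" "AE x in lborel. g x = f x"
proof -
  have "(\<lambda>x. Re (g x)) \<in> borel_measurable lebesgue" "(\<lambda>x. Im (g x)) \<in> borel_measurable lebesgue"
    using assms by measurable
  from this[THEN completion_ex_borel_measurable_real] obtain a b where
    ab: "a \<in> borel_measurable lborel" "AE x in lborel. Re (g x) = a x"
      "b \<in> borel_measurable lborel" "AE x in lborel. Im (g x) = b x" by blast
  show ?thesis
  proof (rule that[of "\<lambda>x. of_real (a x) + \<i> * of_real (b x)"])
    show "(\<lambda>x. of_real (a x) + \<i> * of_real (b x)) \<in> borel_measurable borel"
      using ab(1,3) by measurable
    show "AE x in lborel. g x = of_real (a x) + \<i> * of_real (b x)"
      using ab(2,4) by eventually_elim (simp add: complex_eq_iff)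
  qed
qed

lemma fourier_integral_cis:
  "fourier_integral g \<xi> = (\<integral>x. cis (- (2 * pi * (\<xi> \<bullet> x))) * g x \<partial>lebesgue)"
  by (simp add: fourier_integral_def cis_conv_exp mult_ac)

lemma cis_lebesgue_measurable[measurable]:
  "(\<lambda>x::real^'n::finite. cis (- (2 * pi * (\<xi> \<bullet> x)))) \<in> borel_measurable lebesgue"
  by (rule measurable_completion) measurable

lemma fourier_integral_cong:
  assumes [measurable]: "g \<in> borel_measurable lebesgue" "h \<in> borel_measurable lebesgue"
    and "AE x in lebesgue. g x = h x"
  shows "fourier_integral g = fourier_integral h"
proof
  fix \<xi>
  show "fourier_integral g \<xi> = fourier_integral h \<xi>"
    unfolding fourier_integral_cis
  proof (rule integral_cong_AE)
    show "AE x in lebesgue. cis (- (2 * pi * (\<xi> \<bullet> x))) * g x = cis (- (2 * pi * (\<xi> \<bullet> x))) * h x"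
      using assms(3) by eventually_elim simp
  qed measurable
qed

lemma fourier_integrand_integrable:
  fixes g :: "real^'n::finite \<Rightarrow> complex"
  assumes "integrable lebesgue g"
  shows "integrable lebesgue (\<lambda>x. cis (- (2 * pi * (\<xi> \<bullet> x))) * g x)"
proof (rule Bochner_Integration.integrable_bound[OF assms])
  note [measurable] = borel_measurable_integrable[OF assms]
  show "(\<lambda>x. cis (- (2 * pi * (\<xi> \<bullet> x))) * g x) \<in> borel_measurable lebesgue" by measurable
qed (simp add: norm_mult)

lemma fourier_integral_add:
  assumes "integrable lebesgue g" "integrable lebesgue h"
  shows "fourier_integral (\<lambda>x. g x + h x) \<xi> = fourier_integral g \<xi> + fourier_integral h \<xi>"
  using fourier_integrand_integrable[OF assms(1), of \<xi>] fourier_integrand_integrable[OF assms(2), of \<xi>]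
  by (simp add: fourier_integral_cis distrib_left)

lemma fourier_integral_cmult: "fourier_integral (\<lambda>x. c * g x) \<xi> = c * fourier_integral g \<xi>"
proof -
  have "fourier_integral (\<lambda>x. c * g x) \<xi> = (\<integral>x. c * (cis (- (2 * pi * (\<xi> \<bullet> x))) * g x) \<partial>lebesgue)"
    unfolding fourier_integral_cis by (simp add: mult_ac)
  then show ?thesis by (simp add: fourier_integral_cis)
qed

lemma fourier_integral_Plancherel:
  fixes g :: "real^'n::finite \<Rightarrow> complex"
  assumes g: "square_integrable UNIV g" "integrable lebesgue g"
  shows "square_integrable UNIV (fourier_integral g)"
    and "sqdist lebesgue (fourier_integral g) (\<lambda>x. 0) = sqdist lebesgue g (\<lambda>x. 0)"
proof -
  have gm[measurable]: "g \<in> borel_measurable lebesgue"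
    using g(1) by (simp add: square_integrable_def lebesgue_on_UNIV_eq)
  obtain f where f[measurable]: "f \<in> borel_measurable borel" and ae: "AE x in lborel. g x = f x"
    by (rule borel_representative[OF gm])
  have fl[measurable]: "f \<in> borel_measurable lebesgue" by (rule measurable_completion) simp
  have ael: "AE x in lebesgue. g x = f x" using ae by (rule AE_completion)
  have F: "fourier_integral g = FT f"
  proof
    fix \<xi>
    have "fourier_integral g \<xi> = fourier_integral f \<xi>" using fourier_integral_cong[OF gm fl ael] by simp
    also have "\<dots> = FT f \<xi>"
      unfolding fourier_integral_cis FT_def by (rule integral_completion) measurable
    finally show "fourier_integral g \<xi> = FT f \<xi>" .
  qed
  have "integrable lebesgue f"
    using g(2) integrable_cong_AE[OF gm fl ael] by simp
  then have f1: "integrable lborel f" by (simp add: integrable_completion)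
  have "integrable lebesgue (\<lambda>x. (cmod (g x))\<^sup>2)"
    using g(1) by (simp add: square_integrable_def lebesgue_on_UNIV_eq)
  moreover have "AE x in lebesgue. (cmod (g x))\<^sup>2 = (cmod (f x))\<^sup>2" using ael by eventually_elim simp
  ultimately have "integrable lebesgue (\<lambda>x. (cmod (f x))\<^sup>2)"
    by (subst (asm) integrable_cong_AE) auto
  then have f2: "integrable lborel (\<lambda>x. (cmod (f x))\<^sup>2)" by (subst (asm) integrable_completion) auto
  have Fm[measurable]: "FT f \<in> borel_measurable borel" by measurable
  show eq: "sqdist lebesgue (fourier_integral g) (\<lambda>x. 0) = sqdist lebesgue g (\<lambda>x. 0)"
  proof -
    have "sqdist lebesgue g (\<lambda>x. 0) = sqdist lebesgue f (\<lambda>x. 0)"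
      by (rule nn_integral_cong_AE) (use ael in \<open>eventually_elim, simp\<close>)
    then show ?thesis
      using Plancherel_L1_L2[OF f f1 f2] by (simp add: F nn_integral_completion)
  qed
  have "fourier_integral g \<in> borel_measurable (lebesgue_on UNIV)"
    unfolding F lebesgue_on_UNIV_eq by (rule measurable_completion) simp
  moreover have "sqdist lebesgue g (\<lambda>x. 0) < \<infinity>"
    using g(1) square_integrable_iff[of g UNIV] by (simp add: square_integrable_meas lebesgue_on_UNIV_eq)
  ultimately show "square_integrable UNIV (fourier_integral g)"
    using eq by (simp add: square_integrable_iff lebesgue_on_UNIV_eq)
qed

lemma L2_norm_ae_class:
  assumes "square_integrable \<Omega> f"
  shows "sqdist (lebesgue_on \<Omega>) f (\<lambda>x. 0) = ennreal ((L2_norm \<Omega> (ae_class \<Omega> f))\<^sup>2)"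
proof -
  have "sqdist (lebesgue_on \<Omega>) f (\<lambda>x. 0) = sqdist (lebesgue_on \<Omega>) (rep (ae_class \<Omega> f)) (\<lambda>x. 0)"
    by (rule nn_integral_cong_AE) (use rep_ae_class(2)[OF square_integrable_meas[OF assms]] in \<open>eventually_elim, simp\<close>)
  then show ?thesis using L2_norm_nn_integral[OF ae_class_L2[OF assms]] by simp
qed

lemma fourier_integral_L2_norm:
  fixes g :: "real^'n::finite \<Rightarrow> complex"
  assumes g: "square_integrable UNIV g" "integrable lebesgue g"
  shows "L2_norm UNIV (ae_class UNIV (fourier_integral g)) = L2_norm UNIV (ae_class UNIV g)"
proof -
  have "ennreal ((L2_norm UNIV (ae_class UNIV (fourier_integral g)))\<^sup>2) = ennreal ((L2_norm UNIV (ae_class UNIV g))\<^sup>2)"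
    using fourier_integral_Plancherel[OF g] L2_norm_ae_class[OF g(1)] L2_norm_ae_class[of UNIV "fourier_integral g"]
    by (simp add: lebesgue_on_UNIV_eq)
  then show ?thesis
    using L2_norm_nonneg[OF ae_class_L2[OF g(1)]] L2_norm_nonneg[OF ae_class_L2[OF fourier_integral_Plancherel(1)[OF g]]]
    by (simp add: power2_eq_iff_nonneg)
qed

text \<open>
  The restriction of \<open>u\<close> to the ball of radius \<open>R\<close>, as a function (\<open>cutoff\<close>) and as a class
  (\<open>truncation\<close>). It is integrable, so that its Fourier integral \<open>truncated_fourier\<close> converges.
\<close>

definition cutoff :: "real \<Rightarrow> 'n fn set \<Rightarrow> 'n::finite fn" where
  "cutoff R u x = indicator (ball 0 R) x * rep u x"

definition truncation :: "real \<Rightarrow> 'n fn set \<Rightarrow> 'n::finite fn set" where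
  "truncation R u = ae_class UNIV (cutoff R u)"

definition truncated_fourier :: "real \<Rightarrow> 'n fn set \<Rightarrow> 'n::finite fn set" where
  "truncated_fourier R u = ae_class UNIV (fourier_integral (cutoff R u))"

lemma cutoff_measurable:
  assumes "u \<in> L2 UNIV" shows "cutoff R u \<in> borel_measurable lebesgue"
proof -
  have [measurable]: "rep u \<in> borel_measurable lebesgue" using rep_meas[OF assms] by (simp add: lebesgue_on_UNIV_eq)
  have [measurable]: "(indicator (ball 0 R) :: real^'a \<Rightarrow> complex) \<in> borel_measurable lebesgue"
    by (rule borel_measurable_indicator) simp
  show ?thesis unfolding cutoff_def by measurable
qed

lemma cutoff_square_integrable:
  assumes "u \<in> L2 UNIV" shows "square_integrable UNIV (cutoff R u)"
  by (rule square_integrable_bound[OF _ rep_L2(1)[OF assms]])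
     (use cutoff_measurable[OF assms] in \<open>auto simp: lebesgue_on_UNIV_eq cutoff_def norm_mult indicator_def\<close>)

lemma cutoff_integrable:
  fixes u :: "'n::finite fn set"
  assumes "u \<in> L2 UNIV" shows "integrable lebesgue (cutoff R u)"
proof -
  have "square_integrable UNIV (indicator (ball 0 R) :: real^'n \<Rightarrow> complex)"
  proof -
    have [measurable]: "(indicator (ball 0 R) :: real^'n \<Rightarrow> complex) \<in> borel_measurable lebesgue"
      by (rule borel_measurable_indicator) simp
    have eq: "(\<lambda>x::real^'n. (cmod (indicator (ball 0 R) x))\<^sup>2) = indicator (ball 0 R)" by (auto simp: indicator_def)
    have "integrable lebesgue (indicator (ball 0 R) :: real^'n \<Rightarrow> real)"
      by (rule integrable_real_indicator) (use lmeasurable_ball[of "0::real^'n" R] in \<open>auto simp: fmeasurable_def\<close>)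
    then show ?thesis by (simp add: square_integrable_def lebesgue_on_UNIV_eq eq)
  qed
  from square_integrable_mult[OF this rep_L2(1)[OF assms]] show ?thesis
    by (simp add: cutoff_def[abs_def] lebesgue_on_UNIV_eq)
qed

lemma truncation_L2: "u \<in> L2 UNIV \<Longrightarrow> truncation R u \<in> L2 UNIV"
  unfolding truncation_def by (intro ae_class_L2 cutoff_square_integrable)

lemma truncated_fourier_L2: "u \<in> L2 UNIV \<Longrightarrow> truncated_fourier R u \<in> L2 UNIV"
  unfolding truncated_fourier_def
  by (intro ae_class_L2 fourier_integral_Plancherel cutoff_square_integrable cutoff_integrable)

lemma truncated_fourier_norm: "u \<in> L2 UNIV \<Longrightarrow> L2_norm UNIV (truncated_fourier R u) = L2_norm UNIV (truncation R u)"
  unfolding truncated_fourier_def truncation_def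
  by (intro fourier_integral_L2_norm cutoff_square_integrable cutoff_integrable)

lemma truncated_fourier_dist:
  assumes u: "u \<in> L2 UNIV"
  shows "L2_dist UNIV (truncated_fourier R u) (truncated_fourier S u) =
    L2_dist UNIV (truncation R u) (truncation S u)"
proof -
  note sq = cutoff_square_integrable[OF u] and i = cutoff_integrable[OF u]
  let ?d = "\<lambda>x. cutoff R u x + (-1) * cutoff S u x"
  have d: "square_integrable UNIV ?d" "integrable lebesgue ?d"
    using square_integrable_add[OF sq square_integrable_cmult[OF sq, of "-1"], of R S] i[of R] i[of S] by auto
  have F: "fourier_integral ?d = (\<lambda>\<xi>. fourier_integral (cutoff R u) \<xi> - fourier_integral (cutoff S u) \<xi>)"
  proof
    fix \<xi>
    have "integrable lebesgue (\<lambda>x. (-1) * cutoff S u x)" using i[of S] by (rule integrable_mult_right)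
    from fourier_integral_add[OF i[of R] this, of \<xi>]
    show "fourier_integral ?d \<xi> = fourier_integral (cutoff R u) \<xi> - fourier_integral (cutoff S u) \<xi>"
      using fourier_integral_cmult[of "-1" "cutoff S u" \<xi>] by simp
  qed
  have "cls_diff UNIV (truncated_fourier R u) (truncated_fourier S u) = ae_class UNIV (fourier_integral ?d)"
    unfolding truncated_fourier_def F
    by (intro cls_diff_ae_class square_integrable_meas fourier_integral_Plancherel sq i)
  moreover have "cls_diff UNIV (truncation R u) (truncation S u) = ae_class UNIV ?d"
    unfolding truncation_def using cls_diff_ae_class[OF sq[THEN square_integrable_meas] sq[THEN square_integrable_meas]] by simp
  ultimately show ?thesis using fourier_integral_L2_norm[OF d] by simp
qed

lemma truncated_fourier_add:
  assumes u: "u \<in> L2 UNIV" and v: "v \<in> L2 UNIV"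
  shows "truncated_fourier R (cls_add UNIV u v) = cls_add UNIV (truncated_fourier R u) (truncated_fourier R v)"
proof -
  note cm = cutoff_measurable
  have "AE x in lebesgue. cutoff R (cls_add UNIV u v) x = cutoff R u x + cutoff R v x"
    using rep_cls_add[OF u v] unfolding lebesgue_on_UNIV_eq cutoff_def by eventually_elim (simp add: distrib_left)
  then have "fourier_integral (cutoff R (cls_add UNIV u v)) = fourier_integral (\<lambda>x. cutoff R u x + cutoff R v x)"
    using cm[OF u] cm[OF v] by (intro fourier_integral_cong cm cls_add_L2 u v) auto
  also have "\<dots> = (\<lambda>\<xi>. fourier_integral (cutoff R u) \<xi> + fourier_integral (cutoff R v) \<xi>)"
    by (intro ext fourier_integral_add cutoff_integrable u v)
  finally show ?thesis
    unfolding truncated_fourier_def using u v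
    by (simp add: cls_add_ae_class square_integrable_meas fourier_integral_Plancherel cutoff_square_integrable cutoff_integrable)
qed

lemma truncated_fourier_scale:
  assumes u: "u \<in> L2 UNIV"
  shows "truncated_fourier R (cls_scale UNIV c u) = cls_scale UNIV c (truncated_fourier R u)"
proof -
  note cm = cutoff_measurable
  have "AE x in lebesgue. cutoff R (cls_scale UNIV c u) x = c * cutoff R u x"
    using rep_cls_scale[OF u, of c] unfolding lebesgue_on_UNIV_eq cutoff_def by eventually_elim simp
  then have "fourier_integral (cutoff R (cls_scale UNIV c u)) = fourier_integral (\<lambda>x. c * cutoff R u x)"
    using cm[OF u] by (intro fourier_integral_cong cm cls_scale_L2[OF u]) auto
  also have "\<dots> = (\<lambda>\<xi>. c * fourier_integral (cutoff R u) \<xi>)"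
    by (intro ext fourier_integral_cmult)
  finally show ?thesis
    unfolding truncated_fourier_def using u
    by (simp add: cls_scale_ae_class square_integrable_meas fourier_integral_Plancherel cutoff_square_integrable cutoff_integrable)
qed

lemma truncation_tendsto:
  fixes u :: "'n::finite fn set"
  assumes u: "u \<in> L2 UNIV"
  shows "((\<lambda>R. L2_dist UNIV (truncation R u) u) \<longlongrightarrow> 0) at_top"
proof -
  have [measurable]: "rep u \<in> borel_measurable lebesgue" "\<And>R. cutoff R u \<in> borel_measurable lebesgue"
    using rep_meas[OF u] cutoff_measurable[OF u] by (simp_all add: lebesgue_on_UNIV_eq)
  have ru: "integrable lebesgue (\<lambda>x. (cmod (rep u x))\<^sup>2)"
    using rep_L2(1)[OF u] by (simp add: square_integrable_def lebesgue_on_UNIV_eq)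
  define d where "d R = L2_dist UNIV (truncation R u) u" for R
  have d0: "0 \<le> d R" for R unfolding d_def by (intro L2_norm_nonneg cls_diff_L2 truncation_L2 u)
  have d: "ennreal ((d R)\<^sup>2) = sqdist lebesgue (cutoff R u) (rep u)" for R
  proof -
    have "ennreal ((d R)\<^sup>2) = sqdist lebesgue (rep (truncation R u)) (rep u)"
      unfolding d_def using sqdist_L2[OF truncation_L2[OF u] u, of R] by (simp add: lebesgue_on_UNIV_eq)
    also have "\<dots> = sqdist lebesgue (cutoff R u) (rep u)"
    proof (rule nn_integral_cong_AE)
      have "AE x in lebesgue. rep (truncation R u) x = cutoff R u x"
        using rep_ae_class(2)[of "cutoff R u" UNIV] cutoff_measurable[OF u]
        unfolding truncation_def lebesgue_on_UNIV_eq by blast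
      then show "AE x in lebesgue. ennreal ((cmod (rep (truncation R u) x - rep u x))\<^sup>2) =
          ennreal ((cmod (cutoff R u x - rep u x))\<^sup>2)"
        by eventually_elim simp
    qed
    finally show ?thesis .
  qed
  have int: "integrable lebesgue (\<lambda>x. (cmod (cutoff R u x - rep u x))\<^sup>2)" for R
  proof (rule Bochner_Integration.integrable_bound[OF ru])
    show "AE x in lebesgue. norm ((cmod (cutoff R u x - rep u x))\<^sup>2) \<le> norm ((cmod (rep u x))\<^sup>2)"
      by (auto simp: cutoff_def indicator_def)
  qed measurable
  have "(\<lambda>n. \<integral>x. (cmod (cutoff (real n) u x - rep u x))\<^sup>2 \<partial>lebesgue) \<longlonglongrightarrow> (\<integral>x. 0 \<partial>(lebesgue :: (real^'n) measure))"
  proof (rule integral_dominated_convergence[OF _ _ ru])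
    show "AE x in lebesgue. (\<lambda>n. (cmod (cutoff (real n) u x - rep u x))\<^sup>2) \<longlonglongrightarrow> 0"
    proof (intro AE_I2 tendsto_eventually)
      fix x :: "real^'n"
      obtain N where N: "norm x < real N" using reals_Archimedean2 by blast
      show "\<forall>\<^sub>F n in sequentially. (cmod (cutoff (real n) u x - rep u x))\<^sup>2 = 0"
        using eventually_ge_at_top[of N] by (rule eventually_mono) (use N in \<open>auto simp: cutoff_def indicator_def\<close>)
    qed
    show "AE x in lebesgue. norm ((cmod (cutoff (real n) u x - rep u x))\<^sup>2) \<le> (cmod (rep u x))\<^sup>2" for n
      by (auto simp: cutoff_def indicator_def)
  qed measurable
  moreover have "(d (real n))\<^sup>2 = (\<integral>x. (cmod (cutoff (real n) u x - rep u x))\<^sup>2 \<partial>lebesgue)" for n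
  proof -
    have "ennreal ((d (real n))\<^sup>2) = ennreal (\<integral>x. (cmod (cutoff (real n) u x - rep u x))\<^sup>2 \<partial>lebesgue)"
      unfolding d by (rule nn_integral_eq_integral[OF int]) simp
    then show ?thesis by simp
  qed
  ultimately have "(\<lambda>n. (d (real n))\<^sup>2) \<longlonglongrightarrow> 0" by simp
  then have "(\<lambda>n. sqrt ((d (real n))\<^sup>2)) \<longlonglongrightarrow> sqrt 0" by (rule tendsto_real_sqrt)
  then have dn: "(\<lambda>n. d (real n)) \<longlonglongrightarrow> 0" using d0 by simp
  have mono: "d R \<le> d S" if "S \<le> R" for R S
  proof -
    have "ennreal ((d R)\<^sup>2) \<le> ennreal ((d S)\<^sup>2)"
      unfolding d by (rule nn_integral_mono) (use that in \<open>auto simp: cutoff_def indicator_def intro!: ennreal_leI\<close>)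
    then show ?thesis using power2_le_imp_le[OF _ d0[of S]] by simp
  qed
  show ?thesis
    unfolding d_def[symmetric] tendsto_iff
  proof (intro allI impI)
    fix e :: real assume "e > 0"
    then have "\<forall>\<^sub>F n in sequentially. d (real n) < e" using order_tendstoD(2)[OF dn] by blast
    then obtain n where n: "d (real n) < e" using eventually_happens'[OF sequentially_bot] by blast
    show "\<forall>\<^sub>F R in at_top. dist (d R) 0 < e"
      using eventually_ge_at_top[of "real n"]
      by (rule eventually_mono) (use mono[of "real n"] n d0 in \<open>auto simp: dist_real_def intro: le_less_trans\<close>)
  qed
qed

lemma L2_limit_unique:
  assumes "\<And>x. f x \<in> L2 \<Omega>" "v \<in> L2 \<Omega>" "w \<in> L2 \<Omega>" "F \<noteq> bot"
    "((\<lambda>x. L2_dist \<Omega> (f x) v) \<longlongrightarrow> 0) F" "((\<lambda>x. L2_dist \<Omega> (f x) w) \<longlongrightarrow> 0) F"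
  shows "v = w"
proof -
  have "((\<lambda>x. L2_dist \<Omega> (f x) v + L2_dist \<Omega> (f x) w) \<longlongrightarrow> 0 + 0) F"
    by (intro tendsto_intros assms)
  moreover have "L2_dist \<Omega> v w \<le> L2_dist \<Omega> (f x) v + L2_dist \<Omega> (f x) w" for x
    using L2_diff_triangle[OF assms(2,1,3), of x] L2_diff_comm[OF assms(1,2), of x] by simp
  ultimately have "L2_dist \<Omega> v w \<le> 0"
    using tendsto_le[OF assms(4) _ tendsto_const] by (metis (no_types, lifting) add_0 always_eventually)
  then have "cls_diff \<Omega> v w = cls_zero \<Omega>"
    using L2_norm_eq_0 L2_norm_nonneg cls_diff_L2 assms(2,3) by (metis order_antisym)
  then show ?thesis using cls_diff_eq_zero assms(2,3) by blast
qed

lemma L2_norm_tendsto: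
  assumes "\<And>x. f x \<in> L2 \<Omega>" "v \<in> L2 \<Omega>" "((\<lambda>x. L2_dist \<Omega> (f x) v) \<longlongrightarrow> 0) F"
  shows "((\<lambda>x. L2_norm \<Omega> (f x)) \<longlongrightarrow> L2_norm \<Omega> v) F"
proof -
  have "((\<lambda>x. L2_norm \<Omega> (f x) - L2_norm \<Omega> v) \<longlongrightarrow> 0) F"
    by (rule Lim_null_comparison[OF _ assms(3)])
       (use L2.nrm_diff_le[OF assms(1,2)] L2_sub_eq[OF assms(1,2)] in \<open>auto intro!: always_eventually\<close>)
  then show ?thesis by (simp add: LIM_zero_cancel)
qed

text \<open>
  The condition defining \<open>fourier u\<close>, in terms of the norm of \<open>L\<^sub>2\<close>.
\<close>

definition is_fourier :: "'n fn set \<Rightarrow> 'n::finite fn set \<Rightarrow> bool" where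
  "is_fourier u v \<longleftrightarrow> v \<in> L2 UNIV \<and>
     ((\<lambda>R. L2_dist UNIV (truncated_fourier R u) v) \<longlongrightarrow> 0) at_top"

lemma is_fourier_iff:
  assumes u: "u \<in> L2 UNIV" and v: "v \<in> L2 UNIV"
  shows "is_fourier u v \<longleftrightarrow> ((\<lambda>R. \<integral>\<^sup>+\<xi>. ennreal ((cmod (fourier_integral (\<lambda>x. indicator (ball 0 R) x * rep u x) \<xi>
         - rep v \<xi>))\<^sup>2) \<partial>lebesgue) \<longlongrightarrow> 0) at_top"
proof -
  define d where "d R = L2_dist UNIV (truncated_fourier R u) v" for R
  have d0: "0 \<le> d R" for R unfolding d_def by (intro L2_norm_nonneg cls_diff_L2 truncated_fourier_L2 u v)
  have d: "sqdist lebesgue (fourier_integral (\<lambda>x. indicator (ball 0 R) x * rep u x)) (rep v) = ennreal ((d R)\<^sup>2)" for R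
  proof -
    have F: "fourier_integral (cutoff R u) \<in> borel_measurable (lebesgue_on UNIV)"
      by (intro square_integrable_meas fourier_integral_Plancherel cutoff_square_integrable cutoff_integrable u)
    have "ennreal ((d R)\<^sup>2) = sqdist lebesgue (rep (truncated_fourier R u)) (rep v)"
      unfolding d_def using sqdist_L2[OF truncated_fourier_L2[OF u] v, of R] by (simp add: lebesgue_on_UNIV_eq)
    also have "\<dots> = sqdist lebesgue (fourier_integral (cutoff R u)) (rep v)"
    proof (rule nn_integral_cong_AE)
      have "AE x in lebesgue. rep (truncated_fourier R u) x = fourier_integral (cutoff R u) x"
        using rep_ae_class(2)[OF F] unfolding truncated_fourier_def lebesgue_on_UNIV_eq .
      then show "AE x in lebesgue. ennreal ((cmod (rep (truncated_fourier R u) x - rep v x))\<^sup>2) =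
          ennreal ((cmod (fourier_integral (cutoff R u) x - rep v x))\<^sup>2)"
        by eventually_elim simp
    qed
    finally show ?thesis by (simp add: cutoff_def[abs_def])
  qed
  have "((\<lambda>R. ennreal ((d R)\<^sup>2)) \<longlongrightarrow> 0) at_top \<longleftrightarrow> ((\<lambda>R. (d R)\<^sup>2) \<longlongrightarrow> 0) at_top"
    using tendsto_ennreal_iff[where F=at_top and f="\<lambda>R. (d R)\<^sup>2" and x=0] by simp
  also have "\<dots> \<longleftrightarrow> (d \<longlongrightarrow> 0) at_top"
  proof
    assume "((\<lambda>R. (d R)\<^sup>2) \<longlongrightarrow> 0) at_top"
    then have "((\<lambda>R. sqrt ((d R)\<^sup>2)) \<longlongrightarrow> sqrt 0) at_top" by (rule tendsto_real_sqrt)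
    then show "(d \<longlongrightarrow> 0) at_top" using d0 by simp
  qed (simp add: tendsto_null_power)
  finally show ?thesis unfolding d is_fourier_def using v by (simp add: d_def[abs_def])
qed

lemma is_fourier_unique: "\<lbrakk>u \<in> L2 UNIV; is_fourier u v; is_fourier u w\<rbrakk> \<Longrightarrow> v = w"
  unfolding is_fourier_def
  by (rule L2_limit_unique[of "\<lambda>R. truncated_fourier R u" UNIV v w at_top]) (auto intro: truncated_fourier_L2)

lemma is_fourier_exists:
  assumes u: "u \<in> L2 UNIV" shows "\<exists>v. is_fourier u v"
proof -
  note T = truncated_fourier_L2[OF u] and S = truncation_L2[OF u]
  have close: "\<exists>R0. \<forall>R\<ge>R0. \<forall>R'\<ge>R0. L2_dist UNIV (truncated_fourier R u) (truncated_fourier R' u) < e"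
    if "e > 0" for e
  proof -
    have "\<forall>\<^sub>F R in at_top. L2_dist UNIV (truncation R u) u < e / 2"
      using order_tendstoD(2)[OF truncation_tendsto[OF u], of "e / 2"] that by simp
    then obtain R0 where R0: "\<And>R. R \<ge> R0 \<Longrightarrow> L2_dist UNIV (truncation R u) u < e / 2"
      by (auto simp: eventually_at_top_linorder)
    have "L2_dist UNIV (truncated_fourier R u) (truncated_fourier R' u) < e" if "R \<ge> R0" "R' \<ge> R0" for R R'
      unfolding truncated_fourier_dist[OF u]
      using L2_diff_triangle[OF S u S, of R R'] L2_diff_comm[OF u S, of R'] R0[OF that(1)] R0[OF that(2)] by simp
    then show ?thesis by blast
  qed
  have "\<exists>v\<in>L2 UNIV. (\<lambda>n. L2_dist UNIV (truncated_fourier (real n) u) v) \<longlonglongrightarrow> 0"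
  proof (rule L2_complete[OF T])
    fix e :: real assume "e > 0"
    then obtain R0 where R0: "\<And>R R'. R \<ge> R0 \<Longrightarrow> R' \<ge> R0 \<Longrightarrow>
        L2_dist UNIV (truncated_fourier R u) (truncated_fourier R' u) < e"
      using close by blast
    obtain N where "R0 \<le> real N" using real_arch_simple by blast
    then show "\<exists>N. \<forall>m\<ge>N. \<forall>n\<ge>N. L2_dist UNIV (truncated_fourier (real m) u) (truncated_fourier (real n) u) < e"
      using R0 by (intro exI[of _ N]) (auto intro: order_trans)
  qed
  then obtain v where v: "v \<in> L2 UNIV" "(\<lambda>n. L2_dist UNIV (truncated_fourier (real n) u) v) \<longlonglongrightarrow> 0" by blast
  have "((\<lambda>R. L2_dist UNIV (truncated_fourier R u) v) \<longlongrightarrow> 0) at_top"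
    unfolding tendsto_iff
  proof (intro allI impI)
    fix e :: real assume "e > 0"
    then obtain R0 where R0: "\<And>R R'. R \<ge> R0 \<Longrightarrow> R' \<ge> R0 \<Longrightarrow>
        L2_dist UNIV (truncated_fourier R u) (truncated_fourier R' u) < e / 2"
      using close[of "e / 2"] by auto
    obtain N where N: "R0 \<le> real N" using real_arch_simple by blast
    have "\<forall>\<^sub>F n in sequentially. L2_dist UNIV (truncated_fourier (real n) u) v < e / 2 \<and> n \<ge> N"
      using order_tendstoD(2)[OF v(2), of "e / 2"] \<open>e > 0\<close> eventually_ge_at_top[of N] by (auto intro: eventually_conj)
    then obtain n where n: "L2_dist UNIV (truncated_fourier (real n) u) v < e / 2" "n \<ge> N"
      using eventually_happens'[OF sequentially_bot] by blast
    have n': "real n \<ge> R0" using N n(2) by simp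
    show "\<forall>\<^sub>F R in at_top. dist (L2_dist UNIV (truncated_fourier R u) v) 0 < e"
      using eventually_ge_at_top[of R0]
    proof (rule eventually_mono)
      fix R assume "R0 \<le> R"
      then show "dist (L2_dist UNIV (truncated_fourier R u) v) 0 < e"
        using L2_diff_triangle[OF T T v(1), of R "real n"] R0[OF _ n', of R] n(1) L2_norm_nonneg[OF cls_diff_L2[OF T v(1)], of R]
        by (simp add: dist_real_def)
    qed
  qed
  then show ?thesis using v(1) by (auto simp: is_fourier_def)
qed

lemma fourier_eqI:
  assumes "u \<in> L2 UNIV" "is_fourier u v" shows "fourier u = v"
  unfolding fourier_def
proof (rule the_equality)
  show "v \<in> L2 UNIV \<and> ((\<lambda>R. \<integral>\<^sup>+\<xi>. ennreal ((cmod (fourier_integral (\<lambda>x. indicator (ball 0 R) x * rep u x) \<xi>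
         - rep v \<xi>))\<^sup>2) \<partial>lebesgue) \<longlongrightarrow> 0) at_top"
    using is_fourier_iff[OF assms(1), of v] assms(2) by (simp add: is_fourier_def)
  show "w = v" if "w \<in> L2 UNIV \<and> ((\<lambda>R. \<integral>\<^sup>+\<xi>. ennreal ((cmod (fourier_integral (\<lambda>x. indicator (ball 0 R) x * rep u x) \<xi>
         - rep w \<xi>))\<^sup>2) \<partial>lebesgue) \<longlongrightarrow> 0) at_top" for w
    using is_fourier_iff[OF assms(1), of w] is_fourier_unique[OF assms(1)] assms(2) that by blast
qed

lemma fourier_is_fourier: "u \<in> L2 UNIV \<Longrightarrow> is_fourier u (fourier u)"
  using is_fourier_exists fourier_eqI by metis

lemma fourier_L2: "u \<in> L2 UNIV \<Longrightarrow> fourier u \<in> L2 UNIV"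
  using fourier_is_fourier unfolding is_fourier_def by blast

theorem Plancherel:
  assumes u: "u \<in> L2 UNIV" shows "L2_norm UNIV (fourier u) = L2_norm UNIV u"
proof -
  have "((\<lambda>R. L2_norm UNIV (truncated_fourier R u)) \<longlongrightarrow> L2_norm UNIV (fourier u)) at_top"
    by (rule L2_norm_tendsto[OF truncated_fourier_L2[OF u] fourier_L2[OF u]])
       (use fourier_is_fourier[OF u] in \<open>simp add: is_fourier_def\<close>)
  moreover have "((\<lambda>R. L2_norm UNIV (truncated_fourier R u)) \<longlongrightarrow> L2_norm UNIV u) at_top"
    unfolding truncated_fourier_norm[OF u]
    by (rule L2_norm_tendsto[OF truncation_L2[OF u] u truncation_tendsto[OF u]])
  ultimately show ?thesis using tendsto_unique[OF trivial_limit_at_top_linorder] by blast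
qed

lemma fourier_add:
  assumes u: "u \<in> L2 UNIV" and v: "v \<in> L2 UNIV"
  shows "fourier (cls_add UNIV u v) = cls_add UNIV (fourier u) (fourier v)"
proof (rule fourier_eqI[OF cls_add_L2[OF u v]])
  note F = fourier_L2[OF u] fourier_L2[OF v] and T = truncated_fourier_L2[OF u] truncated_fourier_L2[OF v]
  have lim: "((\<lambda>R. L2_dist UNIV (truncated_fourier R u) (fourier u) +
      L2_dist UNIV (truncated_fourier R v) (fourier v)) \<longlongrightarrow> 0 + 0) at_top"
    using fourier_is_fourier[OF u] fourier_is_fourier[OF v] by (intro tendsto_add) (auto simp: is_fourier_def)
  have "((\<lambda>R. L2_dist UNIV (truncated_fourier R (cls_add UNIV u v)) (cls_add UNIV (fourier u) (fourier v))) \<longlongrightarrow> 0) at_top"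
  proof (rule Lim_null_comparison[OF always_eventually lim[unfolded add_0]], rule allI)
    fix R
    let ?a = "truncated_fourier R u" and ?b = "truncated_fourier R v"
    show "norm (L2_dist UNIV (truncated_fourier R (cls_add UNIV u v)) (cls_add UNIV (fourier u) (fourier v)))
        \<le> L2_dist UNIV ?a (fourier u) + L2_dist UNIV ?b (fourier v)"
      using L2_diff_add_le[OF T F, of R R] L2_norm_nonneg[OF cls_diff_L2[OF cls_add_L2[OF T] cls_add_L2[OF F]], of R R]
      by (simp add: truncated_fourier_add[OF u v])
  qed
  then show "is_fourier (cls_add UNIV u v) (cls_add UNIV (fourier u) (fourier v))"
    using cls_add_L2[OF F] by (simp add: is_fourier_def)
qed

lemma fourier_scale:
  assumes u: "u \<in> L2 UNIV"
  shows "fourier (cls_scale UNIV c u) = cls_scale UNIV c (fourier u)"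
proof (rule fourier_eqI[OF cls_scale_L2[OF u]])
  note F = fourier_L2[OF u] and T = truncated_fourier_L2[OF u]
  have lim: "((\<lambda>R. cmod c * L2_dist UNIV (truncated_fourier R u) (fourier u)) \<longlongrightarrow> cmod c * 0) at_top"
    using fourier_is_fourier[OF u] by (intro tendsto_mult_left) (auto simp: is_fourier_def)
  have eq: "L2_dist UNIV (truncated_fourier R (cls_scale UNIV c u)) (cls_scale UNIV c (fourier u)) =
     cmod c * L2_dist UNIV (truncated_fourier R u) (fourier u)" for R
    by (simp add: truncated_fourier_scale[OF u] L2_diff_scale[OF T F])
  show "is_fourier (cls_scale UNIV c u) (cls_scale UNIV c (fourier u))"
    using cls_scale_L2[OF F, of c] lim unfolding is_fourier_def eq by simp
qed

section \<open>Sobolev spaces of fractional order\<close>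

text \<open>
  The weight in the Sobolev norm of order \<open>s\<close>.
\<close>

definition weight :: "real \<Rightarrow> real^'n::finite \<Rightarrow> real" where
  "weight s \<xi> = (1 + 4 * pi\<^sup>2 * (norm \<xi>)\<^sup>2) powr (s / 2)"

lemma weight_ge_1: "s \<ge> 0 \<Longrightarrow> weight s \<xi> \<ge> 1"
  unfolding weight_def by (intro ge_one_powr_ge_zero) auto

lemma weight_measurable: "(\<lambda>\<xi>. complex_of_real (weight s \<xi>)) \<in> borel_measurable (lebesgue_on UNIV)"
  unfolding weight_def lebesgue_on_UNIV_eq by (rule measurable_completion) measurable

lemma weighted_fourier_measurable:
  assumes "u \<in> L2 UNIV"
  shows "(\<lambda>\<xi>. of_real (weight s \<xi>) * rep (fourier u) \<xi>) \<in> borel_measurable (lebesgue_on UNIV)"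
  using weight_measurable rep_meas[OF fourier_L2[OF assms]] by (intro borel_measurable_times)

lemma weighted_fourier_eq:
  "weighted_fourier s u = ae_class UNIV (\<lambda>\<xi>. of_real (weight s \<xi>) * rep (fourier u) \<xi>)"
  by (simp add: weighted_fourier_def weight_def)

lemma rep_weighted_fourier:
  assumes "u \<in> L2 UNIV"
  shows "AE \<xi> in lebesgue_on UNIV. rep (weighted_fourier s u) \<xi> = of_real (weight s \<xi>) * rep (fourier u) \<xi>"
  unfolding weighted_fourier_eq by (rule rep_ae_class(2)[OF weighted_fourier_measurable[OF assms]])

lemma weighted_fourier_add:
  assumes "u \<in> L2 UNIV" "v \<in> L2 UNIV"
  shows "weighted_fourier s (cls_add UNIV u v) = cls_add UNIV (weighted_fourier s u) (weighted_fourier s v)"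
proof -
  have "cls_add UNIV (weighted_fourier s u) (weighted_fourier s v) =
      ae_class UNIV (\<lambda>\<xi>. of_real (weight s \<xi>) * rep (fourier u) \<xi> + of_real (weight s \<xi>) * rep (fourier v) \<xi>)"
    unfolding weighted_fourier_eq by (intro cls_add_ae_class weighted_fourier_measurable assms)
  also have "\<dots> = weighted_fourier s (cls_add UNIV u v)"
    unfolding weighted_fourier_eq fourier_add[OF assms]
    by (rule ae_class_cong) (use rep_cls_add[OF assms[THEN fourier_L2]] in \<open>eventually_elim, simp add: distrib_left\<close>)
  finally show ?thesis ..
qed

lemma weighted_fourier_scale:
  assumes "u \<in> L2 UNIV"
  shows "weighted_fourier s (cls_scale UNIV c u) = cls_scale UNIV c (weighted_fourier s u)"
proof -
  note m = weighted_fourier_measurable[OF assms]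
  have "cls_scale UNIV c (weighted_fourier s u) =
      ae_class UNIV (\<lambda>\<xi>. c * (of_real (weight s \<xi>) * rep (fourier u) \<xi>))"
    unfolding weighted_fourier_eq by (rule cls_scale_ae_class[OF m])
  also have "\<dots> = weighted_fourier s (cls_scale UNIV c u)"
    unfolding weighted_fourier_eq fourier_scale[OF assms]
    by (rule ae_class_cong)
       (use rep_cls_scale[OF fourier_L2[OF assms], of c] in \<open>eventually_elim, simp add: mult.left_commute\<close>)
  finally show ?thesis ..
qed

text \<open>
  Division by the weight. It is a contraction on \<open>L\<^sub>2\<close> for \<open>s \<ge> 0\<close>, and recovers the Fourier transform
  from the weighted one.
\<close>

definition unweight :: "real \<Rightarrow> 'n fn set \<Rightarrow> 'n::finite fn set" where
  "unweight s u = ae_class UNIV (\<lambda>\<xi>. of_real (1 / weight s \<xi>) * rep u \<xi>)"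

lemma
  assumes u: "u \<in> L2 UNIV" and s: "s \<ge> 0"
  shows unweight_L2: "unweight s u \<in> L2 UNIV"
    and rep_unweight: "AE \<xi> in lebesgue_on UNIV. rep (unweight s u) \<xi> = of_real (1 / weight s \<xi>) * rep u \<xi>"
    and unweight_norm_le: "L2_norm UNIV (unweight s u) \<le> L2_norm UNIV u"
proof -
  let ?f = "\<lambda>\<xi>. of_real (1 / weight s \<xi>) * rep u \<xi>"
  have m: "?f \<in> borel_measurable (lebesgue_on UNIV)"
  proof (rule borel_measurable_times[OF _ rep_meas[OF u]])
    show "(\<lambda>\<xi>. complex_of_real (1 / weight s \<xi>)) \<in> borel_measurable (lebesgue_on UNIV)"
      unfolding weight_def lebesgue_on_UNIV_eq by (rule measurable_completion) measurable
  qed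
  have le: "cmod (?f \<xi>) \<le> cmod (rep u \<xi>)" for \<xi>
  proof -
    have "1 / weight s \<xi> \<le> 1" "0 \<le> 1 / weight s \<xi>" using weight_ge_1[OF s, of \<xi>] by auto
    then show ?thesis unfolding norm_mult norm_of_real by (intro mult_left_le_one_le) auto
  qed
  have sq: "square_integrable UNIV ?f"
    by (rule square_integrable_bound[OF m rep_L2(1)[OF u]]) (use le in auto)
  show "unweight s u \<in> L2 UNIV" unfolding unweight_def using sq by (rule ae_class_L2)
  show "AE \<xi> in lebesgue_on UNIV. rep (unweight s u) \<xi> = ?f \<xi>"
    unfolding unweight_def using m by (rule rep_ae_class(2))
  have "ennreal ((L2_norm UNIV (unweight s u))\<^sup>2) \<le> ennreal ((L2_norm UNIV u)\<^sup>2)"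
    unfolding unweight_def L2_norm_ae_class[OF sq, symmetric] L2_norm_nn_integral[OF u, symmetric]
    by (rule nn_integral_mono) (use le in \<open>auto intro!: ennreal_leI power_mono\<close>)
  then show "L2_norm UNIV (unweight s u) \<le> L2_norm UNIV u"
    using power2_le_imp_le[OF _ L2_norm_nonneg[OF u]] by simp
qed

lemma unweight_weighted_fourier:
  assumes "u \<in> L2 UNIV" "weighted_fourier s u \<in> L2 UNIV" "s \<ge> 0"
  shows "unweight s (weighted_fourier s u) = fourier u"
proof (rule L2_eqI[OF unweight_L2[OF assms(2,3)] fourier_L2[OF assms(1)]])
  show "AE \<xi> in lebesgue_on UNIV. rep (unweight s (weighted_fourier s u)) \<xi> = rep (fourier u) \<xi>"
    using rep_unweight[OF assms(2,3)] rep_weighted_fourier[OF assms(1), of s]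
  proof eventually_elim
    case (elim \<xi>)
    have "weight s \<xi> \<noteq> 0" using weight_ge_1[OF assms(3), of \<xi>] by simp
    then show ?case using elim by simp
  qed
qed

lemma unweight_diff:
  assumes "u \<in> L2 UNIV" "v \<in> L2 UNIV" "s \<ge> 0"
  shows "unweight s (cls_diff UNIV u v) = cls_diff UNIV (unweight s u) (unweight s v)"
proof (rule L2_eqI)
  note D = cls_diff_L2[OF assms(1,2)] and U = unweight_L2[OF assms(1,3)] unweight_L2[OF assms(2,3)]
  show "AE \<xi> in lebesgue_on UNIV. rep (unweight s (cls_diff UNIV u v)) \<xi> = rep (cls_diff UNIV (unweight s u) (unweight s v)) \<xi>"
    using rep_unweight[OF D assms(3)] rep_cls_diff[OF assms(1,2)] rep_cls_diff[OF U]
      rep_unweight[OF assms(1,3)] rep_unweight[OF assms(2,3)]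
    by eventually_elim (simp add: diff_divide_distrib)
  show "unweight s (cls_diff UNIV u v) \<in> L2 UNIV" by (rule unweight_L2[OF D assms(3)])
  show "cls_diff UNIV (unweight s u) (unweight s v) \<in> L2 UNIV" by (rule cls_diff_L2[OF U])
qed

lemma fourier_diff:
  assumes "u \<in> L2 UNIV" "v \<in> L2 UNIV"
  shows "fourier (cls_diff UNIV u v) = cls_diff UNIV (fourier u) (fourier v)"
proof -
  have s: "cls_scale UNIV (-1) v \<in> L2 UNIV" using cls_scale_L2[OF assms(2)] .
  show ?thesis
    by (simp add: cls_diff_eq[OF assms] cls_diff_eq[OF assms[THEN fourier_L2]] fourier_add[OF assms(1) s] fourier_scale[OF assms(2)])
qed

text \<open>
  The operator is closed: if \<open>x\<^sub>n \<rightarrow> w\<close> and the weighted transforms of \<open>x\<^sub>n\<close> tend to \<open>y\<close>, then dividing by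
  the weight gives \<open>F x\<^sub>n \<rightarrow> y / weight\<close>, while \<open>F x\<^sub>n \<rightarrow> F w\<close> by Plancherel's theorem.
\<close>

lemma Hfrac_graph_space:
  assumes s: "s \<ge> 0"
  shows "graph_space UNIV (Hfrac s) {()} (\<lambda>_. weighted_fourier s :: 'n::finite fn set \<Rightarrow> 'n fn set)"
proof
  show "Hfrac s \<subseteq> L2 UNIV" by (auto simp: Hfrac_def)
  show add: "cls_add UNIV u v \<in> Hfrac s" if "u \<in> Hfrac s" "v \<in> Hfrac s" for u v :: "'n fn set"
    using that by (simp add: Hfrac_def cls_add_L2 weighted_fourier_add)
  show scale: "cls_scale UNIV c u \<in> Hfrac s" if "u \<in> Hfrac s" for u :: "'n fn set" and c
    using that cls_scale_L2 by (auto simp: Hfrac_def weighted_fourier_scale)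
  show "cls_zero UNIV \<in> (Hfrac s :: 'n fn set set)"
  proof -
    let ?z = "cls_zero UNIV :: 'n fn set"
    have z: "fourier ?z = ?z"
      using fourier_scale[OF cls_zero_L2, of 0] by (simp add: cls_scale_zero cls_zero_L2 fourier_L2)
    have "weighted_fourier s ?z = ?z"
      unfolding weighted_fourier_eq z unfolding cls_zero_def[of UNIV]
      by (rule ae_class_cong) (use rep_cls_zero[of UNIV, unfolded cls_zero_def] in \<open>eventually_elim, simp\<close>)
    then show ?thesis by (simp add: Hfrac_def cls_zero_L2)
  qed
next
  fix u :: "'n fn set" assume u: "u \<in> Hfrac s"
  then have u': "u \<in> L2 UNIV" "weighted_fourier s u \<in> L2 UNIV" by (auto simp: Hfrac_def)
  have "L2_norm UNIV u = L2_norm UNIV (unweight s (weighted_fourier s u))"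
    by (simp add: unweight_weighted_fourier u' s Plancherel)
  also have "\<dots> \<le> L2_norm UNIV (weighted_fourier s u)" by (rule unweight_norm_le[OF u'(2) s])
  finally show "(L2_norm UNIV u)\<^sup>2 \<le> (\<Sum>i\<in>{()}. (L2_norm UNIV (weighted_fourier s u))\<^sup>2)"
    using L2_norm_nonneg[OF u'(1)] by (simp add: power_mono)
next
  fix x :: "nat \<Rightarrow> 'n fn set" and w and y :: "unit \<Rightarrow> 'n fn set"
  assume x: "\<And>n. x n \<in> Hfrac s" and w: "w \<in> L2 UNIV" "(\<lambda>n. L2_dist UNIV (x n) w) \<longlonglongrightarrow> 0"
    and y': "\<And>i. i \<in> {()} \<Longrightarrow> y i \<in> L2 UNIV"
      "\<And>i. i \<in> {()} \<Longrightarrow> (\<lambda>n. L2_dist UNIV (weighted_fourier s (x n)) (y i)) \<longlonglongrightarrow> 0"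
  have x': "x n \<in> L2 UNIV" "weighted_fourier s (x n) \<in> L2 UNIV" for n using x by (auto simp: Hfrac_def)
  have y: "y () \<in> L2 UNIV" "(\<lambda>n. L2_dist UNIV (weighted_fourier s (x n)) (y ())) \<longlonglongrightarrow> 0"
    using y' by auto
  have "unweight s (y ()) = fourier w"
  proof (rule L2_limit_unique[of "\<lambda>n. fourier (x n)" UNIV _ _ sequentially])
    show "(\<lambda>n. L2_dist UNIV (fourier (x n)) (fourier w)) \<longlonglongrightarrow> 0"
      using w(2) by (simp add: Plancherel cls_diff_L2 x' w(1) flip: fourier_diff)
    show "(\<lambda>n. L2_dist UNIV (fourier (x n)) (unweight s (y ()))) \<longlonglongrightarrow> 0"
    proof (rule Lim_null_comparison[OF always_eventually y(2)], rule allI)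
      fix n
      have "cls_diff UNIV (fourier (x n)) (unweight s (y ())) = unweight s (cls_diff UNIV (weighted_fourier s (x n)) (y ()))"
        by (simp add: unweight_diff x' y(1) s unweight_weighted_fourier)
      then show "norm (L2_dist UNIV (fourier (x n)) (unweight s (y ())))
          \<le> L2_dist UNIV (weighted_fourier s (x n)) (y ())"
        using unweight_norm_le[OF cls_diff_L2[OF x'(2) y(1)] s, of n] L2_norm_nonneg[OF unweight_L2[OF cls_diff_L2[OF x'(2) y(1)] s], of n]
        by simp
    qed
  qed (auto intro: fourier_L2 x' w unweight_L2 y s)
  then have "weighted_fourier s w = ae_class UNIV (\<lambda>\<xi>. of_real (weight s \<xi>) * rep (unweight s (y ())) \<xi>)"
    by (simp add: weighted_fourier_eq)
  also have "\<dots> = ae_class UNIV (rep (y ()))"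
  proof (rule ae_class_cong)
    show "AE \<xi> in lebesgue_on UNIV. of_real (weight s \<xi>) * rep (unweight s (y ())) \<xi> = rep (y ()) \<xi>"
      using rep_unweight[OF y(1) s]
    proof eventually_elim
      case (elim \<xi>)
      have "weight s \<xi> \<noteq> 0" using weight_ge_1[OF s, of \<xi>] by simp
      then show ?case using elim by simp
    qed
  qed
  also have "\<dots> = y ()" using rep_L2(2)[OF y(1)] .
  finally have "weighted_fourier s w = y ()" .
  then show "w \<in> Hfrac s \<and> (\<forall>i\<in>{()}. weighted_fourier s w = y i)"
    using w(1) y(1) by (simp add: Hfrac_def)
qed (auto simp: Hfrac_def weighted_fourier_add weighted_fourier_scale)

lemma Hfrac_gnorm:
  assumes "s \<ge> 0"
  shows "graph_space.gnorm UNIV {()} (\<lambda>_. weighted_fourier s :: 'n::finite fn set \<Rightarrow> 'n fn set) = Hfrac_norm s"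
proof
  fix u :: "'n fn set"
  have "L2_norm UNIV (weighted_fourier s u) \<ge> 0"
    unfolding L2_norm_def L2_inner_def complex_norm_square[symmetric] integral_complex_of_real by simp
  then show "graph_space.gnorm UNIV {()} (\<lambda>_. weighted_fourier s) u = Hfrac_norm s u"
    using graph_space.gnorm_def[OF Hfrac_graph_space[OF assms], of u] by (simp add: Hfrac_norm_def)
qed

theorem Hfrac_adjoint:
  assumes "s \<ge> 0" "admissible_inner_product UNIV (Hfrac s) (Hfrac_norm s) a" "u \<in> L2 UNIV"
    and "Eadj = hilbert_adjoint (Hfrac s) a (L2 UNIV) (L2_inner UNIV) (embedding (Hfrac s))"
  shows "Eadj u \<in> Hfrac s \<and> (\<forall>v\<in>Hfrac s. a (Eadj u) v = L2_inner UNIV u v) \<and>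
         (\<forall>z\<in>Hfrac s. (\<forall>v\<in>Hfrac s. a z v = L2_inner UNIV u v) \<longrightarrow> z = Eadj u)"
  by (rule graph_space.adjoint_of_graph_embedding[OF Hfrac_graph_space[OF assms(1)] _ assms(3,4)])
     (use assms(2) in \<open>simp add: Hfrac_gnorm[OF assms(1)]\<close>)

theorem proposition3p1:
  fixes \<Omega> :: "(real^'n::finite) set"
    and u :: "'n fn set"
  assumes "open \<Omega>" and "\<Omega> \<noteq> {}" and "u \<in> L2 \<Omega>"
  shows "(\<forall>(s::real) a l Eadj.
            0 \<le> s \<longrightarrow> (s \<in> \<nat> \<or> \<Omega> = UNIV) \<longrightarrow>
            admissible_inner_product \<Omega> (Hs s \<Omega>) (Hs_norm s \<Omega>) a \<longrightarrow>
            l = (\<lambda>v. L2_inner \<Omega> u v) \<longrightarrow>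
            Eadj = hilbert_adjoint (Hs s \<Omega>) a (L2 \<Omega>) (L2_inner \<Omega>) (embedding (Hs s \<Omega>)) \<longrightarrow>
            Eadj u \<in> Hs s \<Omega> \<and> (\<forall>v\<in>Hs s \<Omega>. a (Eadj u) v = l v) \<and>
            (\<forall>z\<in>Hs s \<Omega>. (\<forall>v\<in>Hs s \<Omega>. a z v = l v) \<longrightarrow> z = Eadj u))
       \<and> (\<forall>(m::nat) a l Eadj.
            admissible_inner_product \<Omega> (Hm0 m \<Omega>) (Hm_norm m \<Omega>) a \<longrightarrow>
            l = (\<lambda>v. L2_inner \<Omega> u v) \<longrightarrow>
            Eadj = hilbert_adjoint (Hm0 m \<Omega>) a (L2 \<Omega>) (L2_inner \<Omega>) (embedding (Hm0 m \<Omega>)) \<longrightarrow>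
            Eadj u \<in> Hm0 m \<Omega> \<and> (\<forall>v\<in>Hm0 m \<Omega>. a (Eadj u) v = l v) \<and>
            (\<forall>z\<in>Hm0 m \<Omega>. (\<forall>v\<in>Hm0 m \<Omega>. a z v = l v) \<longrightarrow> z = Eadj u))"
proof (intro conjI[of "\<forall>s. _ s"] allI impI, goal_cases)
  case (1 s a l Eadj)
  show ?case
  proof (cases "s \<in> \<nat>")
    case True
    have Hs: "Hs s \<Omega> = Hm (nat \<lfloor>s\<rfloor>) \<Omega>" "Hs_norm s \<Omega> = Hm_norm (nat \<lfloor>s\<rfloor>) \<Omega>"
      using True by (auto simp: Hs_def Hs_norm_def)
    show ?thesis
      using Hm_adjoint[OF assms(1) 1(3)[unfolded Hs] assms(3) 1(5)[unfolded Hs]] unfolding Hs 1(4) .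
  next
    case False
    then have U: "\<Omega> = UNIV" using 1(2) by simp
    have Hs: "Hs s UNIV = (Hfrac s :: 'n fn set set)" "Hs_norm s UNIV = (Hfrac_norm s :: 'n fn set \<Rightarrow> real)"
      using False by (auto simp: Hs_def Hs_norm_def)
    show ?thesis
      using Hfrac_adjoint[OF 1(1) 1(3)[unfolded U Hs] assms(3)[unfolded U] 1(5)[unfolded U Hs]] unfolding U Hs 1(4) .
  qed
next
  case (2 m a l Eadj)
  show ?case
    using Hm0_adjoint[OF assms(1) 2(1) assms(3) 2(3)] unfolding 2(2) .
qed

end
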